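(* Let $\alpha\in(0,1)$ and $T>0$. (i) The coaction $\Delta^-:\tilde{\mathcal{T}}\to\mathcal{T}_-\otimes\tilde{\mathcal{T}}$ coincides with $\delta^-:\tilde{\mathcal{H}}\to\mathcal{H}_-\otimes\tilde{\mathcal{H}}$, under the identifications $\tilde{\mathcal{H}}\leftrightarrow\tilde{\mathcal{T}}$ and $\mathcal{H}_-\leftrightarrow\mathcal{T}_-$. (ii) Let $v\in\mathcal{B}_-^*$ and let $\ell\in\mathcal{G}_-\subset\mathcal{T}_-^*$ be the associated character. Then the following diagram commutes: $$\begin{array}{ccc}\mathbf{X}&\longleftrightarrow&\mathbf{\Pi}\\ \downarrow&&\downarrow\\ M_v\mathbf{X}&\longleftrightarrow&\mathbf{\Pi}^{\mathrm{M}_\ell}\end{array}$$ that is, if $\mathbf{X}\in\mathscr{R}^\alpha_{[0,T]}$ and $\mathbf{\Pi}=(\Pi,\Gamma)\in\mathscr{M}_{[0,T]}$ is the model associated to $\mathbf{X}$, then the model associated to the translated branched rough path $M_v\mathbf{X}$ is the renormalised model $\mathbf{\Pi}^{\mathrm{M}_\ell}$. (iii) For $v,v'\in\mathcal{B}_-$ (identified with $\mathcal{B}_-^*$ via the basis of trees) with associated characters $\ell,\ell'\in\mathcal{G}_-$, the character associated to $v+v'$ is $\ell\circ\ell'$, so that $(\mathcal{B}_-,+)\cong(\mathcal{G}_-,\circ)$.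
   Context: **Trees and branched rough paths.** $\mathcal{B}$ is the real vector space spanned by unordered rooted trees with nodes labelled by $\{0,\dots,d\}$; $\mathcal{H}$ is spanned by forests (including the empty forest $1$), the free commutative algebra over $\mathcal{B}$ with product $\odot$ (often omitted). $\bullet_i$ is the one-node tree; $[\tau_1\cdots\tau_n]_{\bullet_i}$ is obtained by grafting trees onto a root labelled $i$; $|\tau|$ is the number of nodes of a forest $\tau$. The coproduct $\Delta_\star$ on $\mathcal{H}$ is the algebra morphism with $\Delta_\star[\tau_1\cdots\tau_n]_{\bullet_i}=[\tau_1\cdots\tau_n]_{\bullet_i}\otimes1+(\mathrm{id}\otimes[\cdot]_{\bullet_i})\Delta_\star(\tau_1\cdots\tau_n)$; $\star$ is the dual product on $\mathcal{H}^*$ (formal series of forests, product topology); $\mathcal{B}^*\subset\mathcal{H}^*$ is the space of series of trees; $\mathcal{G}\subset\mathcal{H}^*$ is the group of characters of $(\mathcal{H},\odot)$. The pre-Lie product on $\mathcal{B}$ (and $\mathcal{B}^*$) is $\tau_1\curvearrowright\tau_2=\sum_\tau n(\tau_1,\tau_2,\tau)\tau$, with $n(\tau_1,\tau_2,\tau)$ the number of single admissible cuts of $\tau$ (removals of one edge) with branch $\tau_1$ and trunk $\tau_2$ (the trunk containing the root). For $v\in\mathcal{B}^*$, $M_v:\mathcal{H}^*\to\mathcal{H}^*$ is the unique continuous algebra morphism (for $\star$) whose restriction to $\mathcal{B}^*$ is a pre-Lie algebra morphism of $\mathcal{B}^*$ to itself, with $M_v\bullet_0=\bullet_0+v$ and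 $M_v\bullet_i=\bullet_i$ for $i=1,\dots,d$; $(M_v\mathbf{X})_{s,t}:=M_v(\mathbf{X}_{s,t})$. $\mathscr{R}^\alpha_{[0,T]}$ is the set of $(1+d)$-dimensional $\alpha$-Hölder branched rough paths $\mathbf{X}:[0,T]^2\to\mathcal{G}$ (i.e. $\mathbf{X}_{s,t}=\mathbf{X}_{s,u}\star\mathbf{X}_{u,t}$ and $\sup_{s\neq t}|\langle\mathbf{X}_{s,t},\tau\rangle|/|t-s|^{\alpha|\tau|}<\infty$ for every forest $\tau$) whose zeroth component is time, i.e. $\langle\mathbf{X}_{s,t},\bullet_0\rangle=t-s$ and $\langle\mathbf{X}_{s,t},[\tau]_{\bullet_0}\rangle=\int_s^t\langle\mathbf{X}_{s,u},\tau\rangle\,du$ for all $\tau\in\mathcal{H}$, $s,t\in[0,T]$. **Extraction.** $\mathcal{A}$ is the free unital commutative algebra generated by trees in $\mathcal{B}$ (product $\cdot$, unit $\mathbf{1}$). For a tree $\tau$, $\delta\tau=\sum\tau_1\cdot\ldots\cdot\tau_k\otimes\tilde\tau\in\mathcal{A}\otimes\mathcal{B}$, the sum over all (possibly empty) collections of pairwise disjoint non-empty subtrees $\tau_1,\dots,\tau_k$ of $\tau$ (single nodes allowed), $\tilde\tau$ being $\tau$ with each $\tau_j$ contracted to a single node labelled $0$. $\mathcal{B}_-\subset\mathcal{B}$ is the subspace spanned by the trees with no label $0$ and with at most $\lfloor1/\alpha\rfloor$ nodes; $\mathcal{H}_-$ is the free unital commutative algebra generated by $\mathcal{B}_-$;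 $\pi_-:\mathcal{B}\to\mathcal{B}_-$ is the projection onto $\mathcal{B}_-$ (terms of negative degree), killing all other trees, extended to an algebra morphism $\mathcal{A}\to\mathcal{H}_-$. $\delta^-:=(\pi_-\otimes\mathrm{id})\delta$. $\mathcal{B}_-^*\subset\mathcal{B}^*$ via the tree basis. **Symbols.** $\tilde{\mathcal{W}}$ is the set of symbols defined inductively: for $n\ge0$ and $\sigma_1,\dots,\sigma_n\in\tilde{\mathcal{W}}$, the commutative products $\mathcal{I}(\sigma_1)\cdots\mathcal{I}(\sigma_n)$ (equal to $1$ if $n=0$) and $\mathcal{I}(\sigma_1)\cdots\mathcal{I}(\sigma_n)\Xi_i$, $i\in\{1,\dots,d\}$, are in $\tilde{\mathcal{W}}$. Symbols are viewed as rooted trees: each $\mathcal{I}$ is an edge, each $\Xi_i$ is an edge of type $i$ ending in a leaf. Degrees are additive under products with $|1|=0$, $|\Xi_i|=\alpha-1$, $|\mathcal{I}(\sigma)|=|\sigma|+1$. $\tilde{\mathcal{T}}=\mathrm{span}(\tilde{\mathcal{W}})$. Set $\tilde{\mathcal{H}}=\mathcal{H}\oplus\mathcal{H}\Xi_1\oplus\dots\oplus\mathcal{H}\Xi_d$. The map $\phi$, $\phi([\tau_1\cdots\tau_n]_{\bullet_i})=\mathcal{I}(\phi(\tau_1))\cdots\mathcal{I}(\phi(\tau_n))\Xi_i$ with $\Xi_0:=1$, is a linear isomorphism $\mathcal{B}\to\tilde{\mathcal{T}}$; also $\mathcal{B}\cong\tilde{\mathcal{H}}$ by $[\tau_1\cdots\tau_n]_{\bullet_i}\leftrightarrow\tau_1\cdots\tau_n\Xi_i$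 ($\Xi_0=1$), giving $\tilde{\mathcal{H}}\leftrightarrow\tilde{\mathcal{T}}$; $\delta^-$ is regarded as a map on $\tilde{\mathcal{H}}$ via $\mathcal{B}\cong\tilde{\mathcal{H}}$. $\mathcal{W}_-=\{\sigma\in\tilde{\mathcal{W}}:|\sigma|<0\}$, $\mathcal{T}_-$ is the free unital commutative algebra generated by $\mathcal{W}_-$, and $\phi:\mathcal{B}_-\to\langle\mathcal{W}_-\rangle$ is the canonical isomorphism, inducing $\mathcal{H}_-\leftrightarrow\mathcal{T}_-$. $\mathcal{G}_-$ is the set of characters of $\mathcal{T}_-$; the character $\ell$ associated to $v\in\mathcal{B}_-^*$ is given by $\ell(\phi(\tau_1)\cdots\phi(\tau_n))=\langle v,\tau_1\rangle\cdots\langle v,\tau_n\rangle$ for $\tau_j\in\mathcal{B}_-$ (product in $\mathcal{T}_-$). **Negative renormalization.** For $\sigma\in\tilde{\mathcal{W}}$, $\Delta^-\sigma=\sum_AA\otimes R_A\sigma$, over all subgraphs $A$ of $\sigma$ (including the empty one) without isolated vertices whose connected components are all trees in $\mathcal{W}_-$, $A$ being identified with the product of its components in $\mathcal{T}_-$, and $R_A\sigma$ obtained by contracting each component of $A$ to a node. The coproduct $\Delta^-:\mathcal{T}_-\to\mathcal{T}_-\otimes\mathcal{T}_-$ is the algebra morphism given on $\mathcal{W}_-$ by the same formula with the right factor projected to $\mathcal{T}_-$ (the symbol $1$ is sent to the unit, symbols in $\mathcal{W}_-$ are kept, all other symbols are sent to $0$). $\ell\circ\ell':=(\ell\otimes\ell')\Delta^-$.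 $\mathrm{M}_\ell:=(\ell\otimes\mathrm{id})\Delta^-:\tilde{\mathcal{T}}\to\tilde{\mathcal{T}}$. **Structure group.** $\tilde{\mathcal{T}}_+$ is the free unital commutative algebra generated by $\{\mathcal{J}(\sigma):\sigma\in\tilde{\mathcal{W}}\}$, with $\tilde{\mathcal{G}}_+$ its set of characters. $\Delta^+:\tilde{\mathcal{T}}\to\tilde{\mathcal{T}}\otimes\tilde{\mathcal{T}}_+$ is multiplicative with $\Delta^+1=1\otimes1$, $\Delta^+\Xi_i=\Xi_i\otimes1$, $\Delta^+\mathcal{I}(\sigma)=(\mathcal{I}\otimes\mathrm{id})\Delta^+\sigma+1\otimes\mathcal{J}(\sigma)$. For $g\in\tilde{\mathcal{G}}_+$, $\Gamma_g=(\mathrm{id}\otimes g)\Delta^+$; $G=\{\Gamma_g:g\in\tilde{\mathcal{G}}_+\}$. $\mathcal{G}\cong\tilde{\mathcal{G}}_+$ by $g(\mathcal{J}(\phi(\tau)))=\langle g,\tau\rangle$ for trees $\tau$. The regularity structure is $(A,\tilde{\mathcal{T}},G)$ with $A=\{0\}\cup\alpha\mathbb{N}\cup(\alpha\mathbb{N}-1)$. **Models.** A model for $(A,\tilde{\mathcal{T}},G)$ on $\mathbb{R}$ is a pair $(\Pi,\Gamma)$ of linear maps $\Pi_t$, $t\in\mathbb{R}$, from $\tilde{\mathcal{T}}$ to distributions on $\mathbb{R}$, and $\Gamma_{st}\in G$, $s,t\in\mathbb{R}$, with $\Gamma_{tt}=\mathrm{id}$, $\Gamma_{st}\Gamma_{tu}=\Gamma_{su}$,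 $\Pi_s\Gamma_{st}=\Pi_t$, such that for each homogeneous $\sigma\in\tilde{\mathcal{T}}$ and each compact $K\subset\mathbb{R}$ there is $C$ with $|(\Pi_t\sigma)(\lambda^{-1}\varphi((\cdot-t)/\lambda))|\le C\lambda^{|\sigma|}$ for all $t\in K$, $\lambda\in(0,1]$ and smooth $\varphi$ supported in $[-1,1]$ with $\|\varphi\|_{C^1}\le1$, and such that the components of $\Gamma_{st}\sigma$ of degree $\beta<|\sigma|$ are bounded by $C|t-s|^{|\sigma|-\beta}$ for $s,t\in K$. $\mathscr{M}_{[0,T]}$ is the set of all such models with: $\Pi_t1$ is the constant function $1$ for all $t\in\mathbb{R}$; $\Gamma_{st}=\mathrm{id}$ for $s,t\in(-\infty,0]$ and for $s,t\in[T,\infty)$; $(\Pi_t\mathcal{I}y)'=\Pi_ty$ (distributional derivative) for all $t\in\mathbb{R}$, $y\in\tilde{\mathcal{T}}$. The correspondence $\mathbf{X}\leftrightarrow\mathbf{\Pi}$ is the bijection $\mathscr{R}^\alpha_{[0,T]}\to\mathscr{M}_{[0,T]}$ sending $\mathbf{X}$ to the unique $(\Pi,\Gamma)\in\mathscr{M}_{[0,T]}$ with $(\Pi_s\mathcal{I}\phi(\tau))(t)=\langle\mathbf{X}_{s,t},\tau\rangle$ for all $\tau\in\mathcal{B}$, $s,t\in[0,T]$. Writing $\Gamma_{ts}=(\mathrm{id}\otimes\gamma_{ts})\Delta^+$ with $\gamma_{ts}\in\tilde{\mathcal{G}}_+$, the renormalised model $\mathbf{\Pi}^{\mathrm{M}_\ell}$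 is $\Pi^{\mathrm{M}_\ell}_s=\Pi_s\mathrm{M}_\ell$, $\Gamma^{\mathrm{M}_\ell}_{ts}=(\mathrm{id}\otimes\gamma_{ts}\mathrm{M}_\ell)\Delta^+$, where $\mathrm{M}_\ell$ acts on $\tilde{\mathcal{T}}_+$ as the algebra morphism with $\mathrm{M}_\ell\mathcal{J}(\sigma)=\mathcal{J}(\mathrm{M}_\ell\sigma)$.
   Formalization: As defined, M_[0,T] is empty; here (Π_t I y)'=Π_t y is required only on an open set containing (0,T), Π_t is unique only on (0,T), and X is assumed to have a model. When 1/α is an integer, B_- omits the trees with 1/α nodes (degree 0). *)

theory Defs
  imports "HOL-Analysis.Analysis" "HOL-Analysis.Finite_Function_Topology" "HOL-Algebra.Group"
begin

section \<open>Free vector spaces and free commutative algebras\<close>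

text \<open>
  The vector space with basis \<open>'a\<close> is \<open>'a \<Rightarrow>\<^sub>0 real\<close>; a tensor product of two such spaces is
  \<open>('a \<times> 'b) \<Rightarrow>\<^sub>0 real\<close>.  The free unital commutative algebra generated by \<open>'a\<close> is
  \<open>'a multiset \<Rightarrow>\<^sub>0 real\<close> with the (convolution) multiplication of \<open>Poly_Mapping\<close>; together with the
  componentwise addition on pairs this also gives the algebra structure on tensor products of free
  algebras.  Elements of a (full) algebraic dual are functions on the basis.
\<close>

definition vec :: "'a \<Rightarrow> ('a \<Rightarrow>\<^sub>0 real)" where
  "vec a = Poly_Mapping.single a 1"

text \<open>Linear extension of a function on the basis; for \<open>f :: 'a \<Rightarrow> real\<close> this is the duality pairing.\<close>

definition lin :: "('a \<Rightarrow> 'v::real_vector) \<Rightarrow> ('a \<Rightarrow>\<^sub>0 real) \<Rightarrow> 'v" where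
  "lin f x = (\<Sum>a\<in>Poly_Mapping.keys x. Poly_Mapping.lookup x a *\<^sub>R f a)"

definition push :: "('a \<Rightarrow> 'b) \<Rightarrow> ('a \<Rightarrow>\<^sub>0 real) \<Rightarrow> ('b \<Rightarrow>\<^sub>0 real)" where
  "push f = lin (\<lambda>a. vec (f a))"

definition tensor :: "('a \<Rightarrow>\<^sub>0 real) \<Rightarrow> ('b \<Rightarrow>\<^sub>0 real) \<Rightarrow> ('a \<times> 'b \<Rightarrow>\<^sub>0 real)" where
  "tensor x y = lin (\<lambda>a. lin (\<lambda>b. vec (a, b)) y) x"

definition tensor_map ::
  "('a \<Rightarrow> ('c \<Rightarrow>\<^sub>0 real)) \<Rightarrow> ('b \<Rightarrow> ('e \<Rightarrow>\<^sub>0 real)) \<Rightarrow> ('a \<times> 'b \<Rightarrow>\<^sub>0 real) \<Rightarrow> ('c \<times> 'e \<Rightarrow>\<^sub>0 real)" where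
  "tensor_map f g = lin (\<lambda>(a, b). tensor (f a) (g b))"

text \<open>\<open>(f \<otimes> id)\<close> and \<open>(id \<otimes> g)\<close> for linear functionals \<open>f\<close>, \<open>g\<close>.\<close>

definition contract_left :: "('a \<Rightarrow> real) \<Rightarrow> ('a \<times> 'b \<Rightarrow>\<^sub>0 real) \<Rightarrow> ('b \<Rightarrow>\<^sub>0 real)" where
  "contract_left f = lin (\<lambda>(a, b). f a *\<^sub>R vec b)"

definition contract_right :: "('b \<Rightarrow> real) \<Rightarrow> ('a \<times> 'b \<Rightarrow>\<^sub>0 real) \<Rightarrow> ('a \<Rightarrow>\<^sub>0 real)" where
  "contract_right g = lin (\<lambda>(a, b). g b *\<^sub>R vec a)"

definition characters :: "('a multiset \<Rightarrow> real) set" where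
  "characters = {g. g {#} = 1 \<and> (\<forall>A B. g (A + B) = g A * g B)}"


section \<open>Trees, forests and symbols\<close>

text \<open>
  Labels \<open>{0,\<dots>,d}\<close> are rendered by \<open>'d option\<close> with \<open>d = CARD('d)\<close>: \<open>None\<close> is the label \<open>0\<close>.
\<close>

datatype 'l tree = Node (root_label: 'l) (kids: "'l tree multiset")

type_synonym 'd rtree = "'d option tree"
type_synonym 'd forest = "'d option tree multiset"

text \<open>\<open>Symb None {#\<sigma>\<^sub>1,\<dots>,\<sigma>\<^sub>n#}\<close> is \<open>\<I>(\<sigma>\<^sub>1)\<cdots>\<I>(\<sigma>\<^sub>n)\<close> and \<open>Symb (Some i) {#\<sigma>\<^sub>1,\<dots>,\<sigma>\<^sub>n#}\<close> is
  \<open>\<I>(\<sigma>\<^sub>1)\<cdots>\<I>(\<sigma>\<^sub>n)\<Xi>\<^sub>i\<close>.\<close>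

datatype 'd symb = Symb (noise: "'d option") (factors: "'d symb multiset")

primrec num_nodes :: "'l tree \<Rightarrow> nat" where
  "num_nodes (Node i ts) = Suc (\<Sum>t\<in>#ts. num_nodes t)"

definition forest_nodes :: "'l tree multiset \<Rightarrow> nat" where
  "forest_nodes F = (\<Sum>t\<in>#F. num_nodes t)"

primrec degree :: "real \<Rightarrow> 'd symb \<Rightarrow> real" where
  "degree \<alpha> (Symb i ss) = (case i of None \<Rightarrow> 0 | Some _ \<Rightarrow> \<alpha> - 1) + (\<Sum>s\<in>#ss. degree \<alpha> s + 1)"

definition symb_one :: "'d symb" where
  "symb_one = Symb None {#}"

definition symb_I :: "'d symb \<Rightarrow> 'd symb" where
  "symb_I \<sigma> = Symb None {#\<sigma>#}"

primrec phi :: "'d rtree \<Rightarrow> 'd symb" where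
  "phi (Node i ts) = Symb i (image_mset phi ts)"

definition W_minus :: "real \<Rightarrow> 'd symb set" where
  "W_minus \<alpha> = {\<sigma>. degree \<alpha> \<sigma> < 0}"

text \<open>
  The basis of \<open>\<B>\<^sub>-\<close>.  The requirement of negative degree is implied by the others unless \<open>1/\<alpha>\<close> is
  an integer; in that case it discards the trees with \<open>1/\<alpha>\<close> nodes, which have degree \<open>0\<close>, so that
  \<open>phi\<close> always identifies the bases of \<open>\<B>\<^sub>-\<close> and \<open>\<langle>\<W>\<^sub>-\<rangle>\<close>.
\<close>

definition trees_minus :: "real \<Rightarrow> 'd rtree set" where
  "trees_minus \<alpha> = {\<tau>. None \<notin> set_tree \<tau> \<and> int (num_nodes \<tau>) \<le> \<lfloor>1 / \<alpha>\<rfloor> \<and> degree \<alpha> (phi \<tau>) < 0}"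


section \<open>Vertices of trees\<close>

text \<open>
  Trees and symbols have no underlying vertex set, so one is fixed here.  A vertex is addressed by the
  path leading to it from the root.  One step of a path is a pair \<open>(y, k)\<close>: it goes to the \<open>k\<close>-th
  copy (\<open>k < multiplicity\<close>) of the child \<open>y\<close>.  Thus \<open>sub x p\<close> is the subtree hanging at \<open>p\<close>, and
  \<open>butlast p\<close> is the parent of \<open>p \<noteq> []\<close>.  The parameter \<open>ch\<close> is \<open>kids\<close> or \<open>factors\<close>.
\<close>

type_synonym 'n addr = "('n \<times> nat) list"

definition sub :: "'n \<Rightarrow> 'n addr \<Rightarrow> 'n" where
  "sub x p = (if p = [] then x else fst (last p))"

inductive_set verts :: "('n \<Rightarrow> 'n multiset) \<Rightarrow> 'n \<Rightarrow> 'n addr set"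
  for ch :: "'n \<Rightarrow> 'n multiset" and x :: 'n where
  root: "[] \<in> verts ch x"
| step: "p \<in> verts ch x \<Longrightarrow> k < count (ch (sub x p)) y \<Longrightarrow> p @ [(y, k)] \<in> verts ch x"

definition is_child :: "'n addr \<Rightarrow> 'n addr \<Rightarrow> bool" where
  "is_child p q \<longleftrightarrow> q \<noteq> [] \<and> butlast q = p"

text \<open>
  \<open>grow con lab ch n v\<close> reads off a tree (\<open>con = Node\<close>) or symbol (\<open>con = Symb\<close>) from a finite rooted
  graph with root \<open>v\<close>, children \<open>ch\<close> and labels \<open>lab\<close>, up to depth \<open>n\<close>.  It is only used with \<open>n\<close> at
  least the height of the graph.
\<close>

primrec grow ::
  "('l \<Rightarrow> 'n multiset \<Rightarrow> 'n) \<Rightarrow> ('v \<Rightarrow> 'l) \<Rightarrow> ('v \<Rightarrow> 'v set) \<Rightarrow> nat \<Rightarrow> 'v \<Rightarrow> 'n" where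
  "grow con lab ch 0 v = con (lab v) {#}"
| "grow con lab ch (Suc n) v = con (lab v) (image_mset (grow con lab ch n) (mset_set (ch v)))"


section \<open>Dual algebra, pre-Lie product and translation maps\<close>

text \<open>\<open>\<Delta>\<^sub>\<star>\<close> on trees; the product over \<open>ts\<close> is \<open>\<Delta>\<^sub>\<star>(\<tau>\<^sub>1\<cdots>\<tau>\<^sub>n)\<close>.\<close>

primrec copr_tree :: "'l tree \<Rightarrow> ('l tree multiset \<times> 'l tree multiset \<Rightarrow>\<^sub>0 real)" where
  "copr_tree (Node i ts) =
     vec ({#Node i ts#}, {#}) + push (\<lambda>(a, b). (a, {#Node i b#})) (\<Prod>t\<in>#ts. copr_tree t)"

definition copr :: "'l tree multiset \<Rightarrow> ('l tree multiset \<times> 'l tree multiset \<Rightarrow>\<^sub>0 real)" where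
  "copr F = (\<Prod>t\<in>#F. copr_tree t)"

definition star :: "('l tree multiset \<Rightarrow> real) \<Rightarrow> ('l tree multiset \<Rightarrow> real) \<Rightarrow> ('l tree multiset \<Rightarrow> real)" where
  "star f g = (\<lambda>F. lin (\<lambda>(a, b). f a * g b) (copr F))"

definition dual_basis :: "'b \<Rightarrow> ('b \<Rightarrow> real)" where
  "dual_basis a = (\<lambda>b. if b = a then 1 else 0)"

definition tree_series :: "('l tree multiset \<Rightarrow> real) set" where
  "tree_series = {f. \<forall>F. f F \<noteq> 0 \<longrightarrow> (\<exists>\<tau>. F = {#\<tau>#})}"

text \<open>Edges are identified with their lower end points, i.e. with the vertices other than the root.\<close>

definition cut_trunk :: "'l tree \<Rightarrow> 'l tree addr \<Rightarrow> 'l tree" where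
  "cut_trunk \<tau> q = grow Node (\<lambda>p. root_label (sub \<tau> p))
     (\<lambda>p. {r \<in> verts kids \<tau>. is_child p r \<and> r \<noteq> q}) (card (verts kids \<tau>)) []"

definition num_cuts :: "'l tree \<Rightarrow> 'l tree \<Rightarrow> 'l tree \<Rightarrow> nat" where
  "num_cuts \<tau>1 \<tau>2 \<tau> = card {q \<in> verts kids \<tau>. q \<noteq> [] \<and> sub \<tau> q = \<tau>1 \<and> cut_trunk \<tau> q = \<tau>2}"

definition pre_lie :: "('l tree multiset \<Rightarrow> real) \<Rightarrow> ('l tree multiset \<Rightarrow> real) \<Rightarrow> ('l tree multiset \<Rightarrow> real)" where
  "pre_lie f g = (\<lambda>F. if \<exists>\<tau>. F = {#\<tau>#}
     then let \<tau> = (THE \<tau>. F = {#\<tau>#}) in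
       \<Sum>(\<tau>1, \<tau>2) \<in> {(\<tau>1, \<tau>2). num_cuts \<tau>1 \<tau>2 \<tau> \<noteq> 0}. real (num_cuts \<tau>1 \<tau>2 \<tau>) * f {#\<tau>1#} * g {#\<tau>2#}
     else 0)"

definition bullet :: "'d option \<Rightarrow> ('d forest \<Rightarrow> real)" where
  "bullet i = dual_basis {#Node i {#}#}"

text \<open>Continuity refers to the product topology on the function space \<open>'d forest \<Rightarrow> real\<close>.\<close>

definition is_translation :: "('d forest \<Rightarrow> real) \<Rightarrow> (('d forest \<Rightarrow> real) \<Rightarrow> ('d forest \<Rightarrow> real)) \<Rightarrow> bool" where
  "is_translation v M \<longleftrightarrow>
     (\<forall>a b f g. M (\<lambda>F. a * f F + b * g F) = (\<lambda>F. a * M f F + b * M g F)) \<and>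
     continuous_on UNIV M \<and>
     M (dual_basis {#}) = dual_basis {#} \<and>
     (\<forall>f g. M (star f g) = star (M f) (M g)) \<and>
     (\<forall>f\<in>tree_series. M f \<in> tree_series) \<and>
     (\<forall>f\<in>tree_series. \<forall>g\<in>tree_series. M (pre_lie f g) = pre_lie (M f) (M g)) \<and>
     M (bullet None) = (\<lambda>F. bullet None F + v F) \<and>
     (\<forall>i. M (bullet (Some i)) = bullet (Some i))"

definition translation :: "('d forest \<Rightarrow> real) \<Rightarrow> ('d forest \<Rightarrow> real) \<Rightarrow> ('d forest \<Rightarrow> real)" where
  "translation v = (THE M. is_translation v M)"


section \<open>Branched rough paths whose zeroth component is time\<close>

definition rough_paths :: "real \<Rightarrow> real \<Rightarrow> (real \<Rightarrow> real \<Rightarrow> ('d forest \<Rightarrow> real)) set" where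
  "rough_paths \<alpha> T = {X.
     (\<forall>s\<in>{0..T}. \<forall>t\<in>{0..T}. X s t \<in> characters) \<and>
     (\<forall>s\<in>{0..T}. \<forall>u\<in>{0..T}. \<forall>t\<in>{0..T}. X s t = star (X s u) (X u t)) \<and>
     (\<forall>F. bdd_above {\<bar>X s t F\<bar> / \<bar>t - s\<bar> powr (\<alpha> * real (forest_nodes F)) | s t.
                        s \<in> {0..T} \<and> t \<in> {0..T} \<and> s \<noteq> t}) \<and>
     (\<forall>s\<in>{0..T}. \<forall>t\<in>{0..T}. X s t {#Node None {#}#} = t - s) \<and>
     (\<forall>F. \<forall>s\<in>{0..T}. \<forall>t\<in>{0..T}. X s t {#Node None F#} = (LBINT u=ereal s..ereal t. X s u F))}"


section \<open>Extraction\<close>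

definition connected_verts :: "'n addr set \<Rightarrow> bool" where
  "connected_verts S \<longleftrightarrow>
     (\<forall>p\<in>S. \<forall>q\<in>S. (p, q) \<in> {(a, b). a \<in> S \<and> b \<in> S \<and> (is_child a b \<or> is_child b a)}\<^sup>*)"

definition subtrees :: "'l tree \<Rightarrow> 'l tree addr set set" where
  "subtrees \<tau> = {S. S \<subseteq> verts kids \<tau> \<and> S \<noteq> {} \<and> connected_verts S}"

definition subtree_tree :: "'l tree \<Rightarrow> 'l tree addr set \<Rightarrow> 'l tree" where
  "subtree_tree \<tau> S = grow Node (\<lambda>p. root_label (sub \<tau> p)) (\<lambda>p. {q \<in> S. is_child p q})
     (card S) (ARG_MIN length p. p \<in> S)"

text \<open>The vertices of the contracted tree are the members of \<open>C\<close> and the singletons of the vertices not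
  covered by \<open>C\<close>.\<close>

definition contract_tree :: "'d rtree \<Rightarrow> 'd rtree addr set set \<Rightarrow> 'd rtree" where
  "contract_tree \<tau> C =
     (let Q = C \<union> {{p} | p. p \<in> verts kids \<tau> - \<Union>C} in
      grow Node (\<lambda>c. if c \<in> C then None else root_label (sub \<tau> (the_elem c)))
        (\<lambda>c. {c' \<in> Q. c' \<noteq> c \<and> (\<exists>p\<in>c. \<exists>q\<in>c'. is_child p q)})
        (card (verts kids \<tau>)) (THE c. c \<in> Q \<and> [] \<in> c))"

definition delta :: "'d rtree \<Rightarrow> ('d forest \<times> 'd rtree \<Rightarrow>\<^sub>0 real)" where
  "delta \<tau> = (\<Sum>C | C \<subseteq> subtrees \<tau> \<and> pairwise disjnt C.
     vec (image_mset (subtree_tree \<tau>) (mset_set C), contract_tree \<tau> C))"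

definition pi_minus :: "real \<Rightarrow> 'd forest \<Rightarrow> ('d forest \<Rightarrow>\<^sub>0 real)" where
  "pi_minus \<alpha> F = (\<Prod>\<tau>\<in>#F. if \<tau> \<in> trees_minus \<alpha> then vec {#\<tau>#} else 0)"

definition delta_minus :: "real \<Rightarrow> 'd rtree \<Rightarrow> ('d forest \<times> 'd rtree \<Rightarrow>\<^sub>0 real)" where
  "delta_minus \<alpha> \<tau> = tensor_map (pi_minus \<alpha>) vec (delta \<tau>)"

text \<open>
  The basis element \<open>\<tau>\<^sub>1\<cdots>\<tau>\<^sub>n\<Xi>\<^sub>i\<close> (with \<open>\<Xi>\<^sub>0 = 1\<close>) of \<open>\<H> \<oplus> \<H>\<Xi>\<^sub>1 \<oplus> \<dots> \<oplus> \<H>\<Xi>\<^sub>d\<close> is the pair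
  \<open>({#\<tau>\<^sub>1,\<dots>,\<tau>\<^sub>n#}, i)\<close>.
\<close>

type_synonym 'd htilde = "'d forest \<times> 'd option"

definition htilde_of_tree :: "'d rtree \<Rightarrow> 'd htilde" where
  "htilde_of_tree \<tau> = (kids \<tau>, root_label \<tau>)"

definition tree_of_htilde :: "'d htilde \<Rightarrow> 'd rtree" where
  "tree_of_htilde h = Node (snd h) (fst h)"

definition delta_minus_htilde :: "real \<Rightarrow> ('d htilde \<Rightarrow>\<^sub>0 real) \<Rightarrow> ('d forest \<times> 'd htilde \<Rightarrow>\<^sub>0 real)" where
  "delta_minus_htilde \<alpha> h =
     push (map_prod id htilde_of_tree) (lin (delta_minus \<alpha>) (push tree_of_htilde h))"


section \<open>Negative renormalization\<close>

text \<open>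
  A symbol as a rooted tree: besides the inner vertices (one for each factor \<open>\<I>(\<cdot>)\<close>, and the root)
  there is a leaf for every occurrence of a noise.  \<open>I_edge p\<close> is the edge from the parent of \<open>p\<close>
  to \<open>p\<close>, \<open>Xi_edge p\<close> the edge from \<open>p\<close> to the leaf of the noise at \<open>p\<close>.
\<close>

datatype 'd gvert = Inner "'d symb addr" | Leaf "'d symb addr"

datatype 'd gedge = I_edge "'d symb addr" | Xi_edge "'d symb addr"

definition symb_verts :: "'d symb \<Rightarrow> 'd gvert set" where
  "symb_verts \<sigma> = Inner ` verts factors \<sigma> \<union> Leaf ` {p \<in> verts factors \<sigma>. noise (sub \<sigma> p) \<noteq> None}"

definition symb_edges :: "'d symb \<Rightarrow> 'd gedge set" where
  "symb_edges \<sigma> = I_edge ` (verts factors \<sigma> - {[]}) \<union>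
                  Xi_edge ` {p \<in> verts factors \<sigma>. noise (sub \<sigma> p) \<noteq> None}"

fun ends :: "'d gedge \<Rightarrow> 'd gvert set" where
  "ends (I_edge p) = {Inner (butlast p), Inner p}"
| "ends (Xi_edge p) = {Inner p, Leaf p}"

text \<open>Subgraphs without isolated vertices are given by their edge sets, and so are their connected
  components.\<close>

definition components :: "'d gedge set \<Rightarrow> 'd gedge set set" where
  "components A = A // {(e, f). e \<in> A \<and> f \<in> A \<and> ends e \<inter> ends f \<noteq> {}}\<^sup>*"

definition edge_verts :: "'d gedge set \<Rightarrow> 'd gvert set" where
  "edge_verts E = \<Union>(ends ` E)"

definition component_symb :: "'d symb \<Rightarrow> 'd gedge set \<Rightarrow> 'd symb" where
  "component_symb \<sigma> E = grow Symb (\<lambda>p. if Xi_edge p \<in> E then noise (sub \<sigma> p) else None)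
     (\<lambda>p. {q. is_child p q \<and> I_edge q \<in> E}) (card E) (ARG_MIN length p. Inner p \<in> edge_verts E)"

text \<open>The vertices of \<open>R\<^sub>A \<sigma>\<close> are the vertex sets of the components of \<open>A\<close> and the singletons of the
  vertices outside \<open>A\<close>; its edges are the edges not in \<open>A\<close>.\<close>

definition contract_symb :: "'d symb \<Rightarrow> 'd gedge set \<Rightarrow> 'd symb" where
  "contract_symb \<sigma> A =
     (let Q = edge_verts ` components A \<union> {{x} | x. x \<in> symb_verts \<sigma> - edge_verts A};
          E = symb_edges \<sigma> - A in
      grow Symb
        (\<lambda>c. if \<exists>p. Inner p \<in> c \<and> Xi_edge p \<in> E
              then noise (sub \<sigma> (THE p. Inner p \<in> c \<and> Xi_edge p \<in> E)) else None)
        (\<lambda>c. {c' \<in> Q. \<exists>q. I_edge q \<in> E \<and> Inner (butlast q) \<in> c \<and> Inner q \<in> c'})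
        (card (verts factors \<sigma>)) (THE c. c \<in> Q \<and> Inner [] \<in> c))"

definition Delta_minus_symb :: "real \<Rightarrow> 'd symb \<Rightarrow> ('d symb multiset \<times> 'd symb \<Rightarrow>\<^sub>0 real)" where
  "Delta_minus_symb \<alpha> \<sigma> =
     (\<Sum>A | A \<subseteq> symb_edges \<sigma> \<and> (\<forall>E\<in>components A. component_symb \<sigma> E \<in> W_minus \<alpha>).
        vec (image_mset (component_symb \<sigma>) (mset_set (components A)), contract_symb \<sigma> A))"

definition Delta_minus :: "real \<Rightarrow> ('d symb \<Rightarrow>\<^sub>0 real) \<Rightarrow> ('d symb multiset \<times> 'd symb \<Rightarrow>\<^sub>0 real)" where
  "Delta_minus \<alpha> = lin (Delta_minus_symb \<alpha>)"

definition proj_minus :: "real \<Rightarrow> 'd symb \<Rightarrow> ('d symb multiset \<Rightarrow>\<^sub>0 real)" where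
  "proj_minus \<alpha> \<sigma> =
     (if \<sigma> = symb_one then vec {#} else if \<sigma> \<in> W_minus \<alpha> then vec {#\<sigma>#} else 0)"

definition copr_minus :: "real \<Rightarrow> 'd symb multiset \<Rightarrow> ('d symb multiset \<times> 'd symb multiset \<Rightarrow>\<^sub>0 real)" where
  "copr_minus \<alpha> F = (\<Prod>\<sigma>\<in>#F. tensor_map vec (proj_minus \<alpha>) (Delta_minus_symb \<alpha> \<sigma>))"

text \<open>The basis of \<open>\<T>\<^sub>-\<close>.  Elements of \<open>\<T>\<^sub>-\<^sup>*\<close> are extended by \<open>0\<close> outside of it.\<close>

definition T_minus :: "real \<Rightarrow> 'd symb multiset set" where
  "T_minus \<alpha> = {F. set_mset F \<subseteq> W_minus \<alpha>}"

definition G_minus :: "real \<Rightarrow> ('d symb multiset \<Rightarrow> real) set" where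
  "G_minus \<alpha> = {l. l {#} = 1 \<and> (\<forall>F\<in>T_minus \<alpha>. \<forall>F'\<in>T_minus \<alpha>. l (F + F') = l F * l F') \<and>
                     (\<forall>F. F \<notin> T_minus \<alpha> \<longrightarrow> l F = 0)}"

definition conv_minus ::
  "real \<Rightarrow> ('d symb multiset \<Rightarrow> real) \<Rightarrow> ('d symb multiset \<Rightarrow> real) \<Rightarrow> ('d symb multiset \<Rightarrow> real)" where
  "conv_minus \<alpha> l l' =
     (\<lambda>F. if F \<in> T_minus \<alpha> then lin (\<lambda>(a, b). l a * l' b) (copr_minus \<alpha> F) else 0)"

definition counit_minus :: "'d symb multiset \<Rightarrow> real" where
  "counit_minus = dual_basis {#}"

definition B_minus :: "real \<Rightarrow> ('d rtree \<Rightarrow>\<^sub>0 real) set" where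
  "B_minus \<alpha> = {v. Poly_Mapping.keys v \<subseteq> trees_minus \<alpha>}"

definition B_minus_dual :: "real \<Rightarrow> ('d forest \<Rightarrow> real) set" where
  "B_minus_dual \<alpha> = {v. \<forall>F. v F \<noteq> 0 \<longrightarrow> (\<exists>\<tau>\<in>trees_minus \<alpha>. F = {#\<tau>#})}"

definition to_dual :: "('d rtree \<Rightarrow>\<^sub>0 real) \<Rightarrow> ('d forest \<Rightarrow> real)" where
  "to_dual v = (\<lambda>F. lin (\<lambda>\<tau>. dual_basis {#\<tau>#} F) v)"

definition assoc_char :: "real \<Rightarrow> ('d forest \<Rightarrow> real) \<Rightarrow> ('d symb multiset \<Rightarrow> real)" where
  "assoc_char \<alpha> v = (\<lambda>F. if F \<in> T_minus \<alpha> then (\<Prod>\<sigma>\<in>#F. v {#inv_into UNIV phi \<sigma>#}) else 0)"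

definition B_minus_group :: "real \<Rightarrow> ('d rtree \<Rightarrow>\<^sub>0 real) monoid" where
  "B_minus_group \<alpha> = \<lparr>carrier = B_minus \<alpha>, mult = (+), one = 0\<rparr>"

definition G_minus_group :: "real \<Rightarrow> ('d symb multiset \<Rightarrow> real) monoid" where
  "G_minus_group \<alpha> = \<lparr>carrier = G_minus \<alpha>, mult = conv_minus \<alpha>, one = counit_minus\<rparr>"

definition renorm_map :: "real \<Rightarrow> ('d symb multiset \<Rightarrow> real) \<Rightarrow> ('d symb \<Rightarrow>\<^sub>0 real) \<Rightarrow> ('d symb \<Rightarrow>\<^sub>0 real)" where
  "renorm_map \<alpha> l y = contract_left l (Delta_minus \<alpha> y)"


section \<open>Structure group\<close>

text \<open>
  The basis element \<open>\<J>(\<sigma>\<^sub>1)\<cdots>\<J>(\<sigma>\<^sub>n)\<close> of \<open>\<T>\<^sub>+\<close> is the multiset \<open>{#\<sigma>\<^sub>1,\<dots>,\<sigma>\<^sub>n#}\<close>.  In the product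
  below the first component \<open>{#\<rho>\<^sub>1,\<dots>,\<rho>\<^sub>m#}\<close> stands for \<open>\<I>(\<rho>\<^sub>1)\<cdots>\<I>(\<rho>\<^sub>m)\<close>; each factor is
  \<open>\<Delta>\<^sup>+\<I>(\<sigma>) = (\<I> \<otimes> id)\<Delta>\<^sup>+\<sigma> + 1 \<otimes> \<J>(\<sigma>)\<close>, and finally the product is multiplied by
  \<open>\<Delta>\<^sup>+\<Xi>\<^sub>i = \<Xi>\<^sub>i \<otimes> 1\<close>.
\<close>

primrec Delta_plus :: "'d symb \<Rightarrow> ('d symb \<times> 'd symb multiset \<Rightarrow>\<^sub>0 real)" where
  "Delta_plus (Symb i ss) = push (map_prod (Symb i) id)
     (\<Prod>p\<in>#image_mset (\<lambda>s. (s, Delta_plus s)) ss.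
        push (map_prod (\<lambda>\<rho>. {#\<rho>#}) id) (snd p) + vec ({#}, {#fst p#}))"

definition Gamma_of :: "('d symb multiset \<Rightarrow> real) \<Rightarrow> ('d symb \<Rightarrow>\<^sub>0 real) \<Rightarrow> ('d symb \<Rightarrow>\<^sub>0 real)" where
  "Gamma_of g y = contract_right g (lin Delta_plus y)"

definition structure_group :: "(('d symb \<Rightarrow>\<^sub>0 real) \<Rightarrow> ('d symb \<Rightarrow>\<^sub>0 real)) set" where
  "structure_group = Gamma_of ` characters"

definition char_of_Gamma :: "(('d symb \<Rightarrow>\<^sub>0 real) \<Rightarrow> ('d symb \<Rightarrow>\<^sub>0 real)) \<Rightarrow> ('d symb multiset \<Rightarrow> real)" where
  "char_of_Gamma G = (THE g. g \<in> characters \<and> G = Gamma_of g)"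

definition renorm_map_plus ::
  "real \<Rightarrow> ('d symb multiset \<Rightarrow> real) \<Rightarrow> 'd symb multiset \<Rightarrow> ('d symb multiset \<Rightarrow>\<^sub>0 real)" where
  "renorm_map_plus \<alpha> l F = (\<Prod>\<sigma>\<in>#F. push (\<lambda>\<rho>. {#\<rho>#}) (renorm_map \<alpha> l (vec \<sigma>)))"


section \<open>Distributions on the real line\<close>

definition smooth :: "(real \<Rightarrow> real) \<Rightarrow> bool" where
  "smooth f \<longleftrightarrow> (\<forall>n x. (deriv ^^ n) f differentiable (at x))"

definition test_function :: "real set \<Rightarrow> (real \<Rightarrow> real) \<Rightarrow> bool" where
  "test_function U f \<longleftrightarrow> smooth f \<and> compact (closure {x. f x \<noteq> 0}) \<and> closure {x. f x \<noteq> 0} \<subseteq> U"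

text \<open>Continuity is expressed by the usual estimate of \<open>D f\<close>, for \<open>f\<close> supported in a compact set \<open>K\<close>, by a
  \<open>C\<^sup>N\<close> norm.  The first condition makes distributions extensional.\<close>

definition distributions :: "((real \<Rightarrow> real) \<Rightarrow> real) set" where
  "distributions = {D.
     (\<forall>f. \<not> test_function UNIV f \<longrightarrow> D f = 0) \<and>
     (\<forall>f g a b. test_function UNIV f \<longrightarrow> test_function UNIV g \<longrightarrow>
        D (\<lambda>x. a * f x + b * g x) = a * D f + b * D g) \<and>
     (\<forall>K. compact K \<longrightarrow> (\<exists>C N. \<forall>f B. test_function K f \<longrightarrow>
        (\<forall>n\<le>N. \<forall>x. \<bar>(deriv ^^ n) f x\<bar> \<le> B) \<longrightarrow> \<bar>D f\<bar> \<le> C * B))}"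

typedef distribution = distributions
  morphisms apply_distr Abs_distr
  by (rule exI[of _ "\<lambda>_. 0"]) (auto simp: distributions_def intro: exI[of _ "0::real"])

lemma distributions_lincomb:
  assumes "D \<in> distributions" "E \<in> distributions"
  shows "(\<lambda>f. a * D f + b * E f) \<in> distributions"
proof -
  have "\<exists>C N. \<forall>f B. test_function K f \<longrightarrow> (\<forall>n\<le>N. \<forall>x. \<bar>(deriv ^^ n) f x\<bar> \<le> B) \<longrightarrow>
          \<bar>a * D f + b * E f\<bar> \<le> C * B" if K: "compact K" for K
  proof -
    obtain C1 N1 where 1: "\<And>f B. test_function K f \<Longrightarrow> (\<forall>n\<le>N1. \<forall>x. \<bar>(deriv ^^ n) f x\<bar> \<le> B) \<Longrightarrow> \<bar>D f\<bar> \<le> C1 * B"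
      using assms(1) K unfolding distributions_def by blast
    obtain C2 N2 where 2: "\<And>f B. test_function K f \<Longrightarrow> (\<forall>n\<le>N2. \<forall>x. \<bar>(deriv ^^ n) f x\<bar> \<le> B) \<Longrightarrow> \<bar>E f\<bar> \<le> C2 * B"
      using assms(2) K unfolding distributions_def by blast
    have "\<bar>a * D f + b * E f\<bar> \<le> (\<bar>a\<bar> * C1 + \<bar>b\<bar> * C2) * B"
      if f: "test_function K f" "\<forall>n\<le>max N1 N2. \<forall>x. \<bar>(deriv ^^ n) f x\<bar> \<le> B" for f B
    proof -
      have "\<bar>a * D f + b * E f\<bar> \<le> \<bar>a\<bar> * \<bar>D f\<bar> + \<bar>b\<bar> * \<bar>E f\<bar>"
        by (metis abs_mult abs_triangle_ineq)
      also have "\<dots> \<le> \<bar>a\<bar> * (C1 * B) + \<bar>b\<bar> * (C2 * B)"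
        using 1[of f B] 2[of f B] f by (intro add_mono mult_left_mono) auto
      finally show ?thesis by (simp add: algebra_simps)
    qed
    then show ?thesis by blast
  qed
  then show ?thesis
    using assms unfolding distributions_def by (auto simp: algebra_simps)
qed

instantiation distribution :: real_vector
begin

definition zero_distribution where "0 = Abs_distr (\<lambda>_. 0)"
definition plus_distribution where "D + E = Abs_distr (\<lambda>f. apply_distr D f + apply_distr E f)"
definition uminus_distribution where "- D = Abs_distr (\<lambda>f. - apply_distr D f)"
definition minus_distribution where "D - E = Abs_distr (\<lambda>f. apply_distr D f - apply_distr E f)"
definition scaleR_distribution where "r *\<^sub>R D = Abs_distr (\<lambda>f. r * apply_distr D f)"

lemma apply_distr_simps:
  "apply_distr 0 = (\<lambda>_. 0)"
  "apply_distr (D + E) = (\<lambda>f. apply_distr D f + apply_distr E f)"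
  "apply_distr (- D) = (\<lambda>f. - apply_distr D f)"
  "apply_distr (D - E) = (\<lambda>f. apply_distr D f - apply_distr E f)"
  "apply_distr (r *\<^sub>R D) = (\<lambda>f. r * apply_distr D f)"
  using distributions_lincomb[OF apply_distr apply_distr, of 0 D 0 E]
    distributions_lincomb[OF apply_distr apply_distr, of 1 D 1 E]
    distributions_lincomb[OF apply_distr apply_distr, of "-1" D 0 E]
    distributions_lincomb[OF apply_distr apply_distr, of 1 D "-1" E]
    distributions_lincomb[OF apply_distr apply_distr, of r D 0 E]
  by (simp_all add: zero_distribution_def plus_distribution_def uminus_distribution_def
      minus_distribution_def scaleR_distribution_def Abs_distr_inverse)

instance
  by standard (simp_all add: apply_distr_inject[symmetric] apply_distr_simps fun_eq_iff algebra_simps)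

end

definition represents :: "(real \<Rightarrow> real) \<Rightarrow> distribution \<Rightarrow> bool" where
  "represents f D \<longleftrightarrow> (\<forall>\<psi>. test_function UNIV \<psi> \<longrightarrow> apply_distr D \<psi> = (LINT x|lborel. f x * \<psi> x))"


section \<open>Models\<close>

type_synonym 'd model =
  "(real \<Rightarrow> ('d symb \<Rightarrow>\<^sub>0 real) \<Rightarrow> distribution) \<times>
   (real \<Rightarrow> real \<Rightarrow> ('d symb \<Rightarrow>\<^sub>0 real) \<Rightarrow> ('d symb \<Rightarrow>\<^sub>0 real))"

definition homogeneous :: "real \<Rightarrow> real \<Rightarrow> ('d symb \<Rightarrow>\<^sub>0 real) \<Rightarrow> bool" where
  "homogeneous \<alpha> \<beta> y \<longleftrightarrow> (\<forall>\<sigma>\<in>Poly_Mapping.keys y. degree \<alpha> \<sigma> = \<beta>)"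

text \<open>Test functions supported in \<open>[-1,1]\<close> with \<open>C\<^sup>1\<close> norm at most \<open>1\<close>.\<close>

definition unit_test_functions :: "(real \<Rightarrow> real) set" where
  "unit_test_functions = {f. test_function {-1..1} f \<and> (\<forall>x. \<bar>f x\<bar> \<le> 1 \<and> \<bar>deriv f x\<bar> \<le> 1)}"

definition is_model :: "real \<Rightarrow> 'd model \<Rightarrow> bool" where
  "is_model \<alpha> = (\<lambda>(P, G).
     (\<forall>t. linear (P t)) \<and>
     (\<forall>s t. G s t \<in> structure_group) \<and>
     (\<forall>t. G t t = id) \<and>
     (\<forall>s t u. G s t \<circ> G t u = G s u) \<and>
     (\<forall>s t. P s \<circ> G s t = P t) \<and>
     (\<forall>\<beta> y K. homogeneous \<alpha> \<beta> y \<longrightarrow> compact K \<longrightarrow>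
        (\<exists>C. \<forall>t\<in>K. \<forall>r\<in>{0<..1}. \<forall>f\<in>unit_test_functions.
           \<bar>apply_distr (P t y) (\<lambda>x. inverse r * f ((x - t) / r))\<bar> \<le> C * r powr \<beta>)) \<and>
     (\<forall>\<beta> y K. homogeneous \<alpha> \<beta> y \<longrightarrow> compact K \<longrightarrow>
        (\<exists>C. \<forall>s\<in>K. \<forall>t\<in>K. \<forall>\<rho>. degree \<alpha> \<rho> < \<beta> \<longrightarrow>
           \<bar>Poly_Mapping.lookup (G s t y) \<rho>\<bar> \<le> C * \<bar>t - s\<bar> powr (\<beta> - degree \<alpha> \<rho>))))"

text \<open>
  The class \<open>\<M>\<^bsub>[0,T]\<^esub>\<close>, with the identity \<open>(\<Pi>\<^sub>t\<I>y)' = \<Pi>\<^sub>ty\<close> imposed on the open set \<open>U\<close>.  For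
  \<open>U = UNIV\<close> the class is empty: \<open>\<Pi>\<^sub>t1 = 1\<close> and the bound on \<open>\<Pi>\<^sub>t\<I>(1)\<close> then force \<open>\<Pi>\<^sub>t\<I>(1) = (\<cdot> - t)\<close> for all \<open>t\<close>, whereas
  \<open>\<Gamma>\<^bsub>st\<^esub> = id\<close> for \<open>s, t \<le> 0\<close> makes \<open>\<Pi>\<^sub>s\<close> and \<open>\<Pi>\<^sub>t\<close> agree.  For \<open>U = {0<..<T}\<close> there is no such
  conflict: time is stopped outside of \<open>[0,T]\<close>.
\<close>

definition models :: "real \<Rightarrow> real \<Rightarrow> real set \<Rightarrow> 'd model set" where
  "models \<alpha> T U = {(P, G). is_model \<alpha> (P, G) \<and>
     (\<forall>t. represents (\<lambda>_. 1) (P t (vec symb_one))) \<and>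
     (\<forall>s t. s \<le> 0 \<and> t \<le> 0 \<or> T \<le> s \<and> T \<le> t \<longrightarrow> G s t = id) \<and>
     (\<forall>t y \<psi>. test_function U \<psi> \<longrightarrow>
        - apply_distr (P t (push symb_I y)) (deriv \<psi>) = apply_distr (P t y) \<psi>)}"

text \<open>\<open>(\<Pi>\<^sub>s\<I>\<phi>(\<tau>))(t) = \<langle>X\<^bsub>s,t\<^esub>, \<tau>\<rangle>\<close>; point evaluation is that of the continuous function representing
  the distribution.\<close>

definition matches :: "real \<Rightarrow> (real \<Rightarrow> real \<Rightarrow> ('d forest \<Rightarrow> real)) \<Rightarrow> 'd model \<Rightarrow> bool" where
  "matches T X P \<longleftrightarrow> (\<forall>b. \<forall>s\<in>{0..T}. \<exists>f. continuous_on UNIV f \<and>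
     represents f (fst P s (push symb_I (push phi b))) \<and>
     (\<forall>t\<in>{0..T}. f t = lin (\<lambda>\<tau>. X s t {#\<tau>#}) b))"

definition agree_on :: "real \<Rightarrow> 'd model \<Rightarrow> 'd model \<Rightarrow> bool" where
  "agree_on T P Q \<longleftrightarrow> snd P = snd Q \<and>
     (\<forall>t y \<psi>. test_function {0<..<T} \<psi> \<longrightarrow> apply_distr (fst P t y) \<psi> = apply_distr (fst Q t y) \<psi>)"

text \<open>The correspondence \<open>X \<leftrightarrow> P\<close>: \<open>P\<close> is the only model of the class matching \<open>X\<close>.  Only the values
  of \<open>\<Pi>\<^sub>t\<close> on test functions supported in \<open>(0,T)\<close> can be determined by \<open>X\<close>.\<close>

definition corresponds ::
  "real \<Rightarrow> real \<Rightarrow> real set \<Rightarrow> (real \<Rightarrow> real \<Rightarrow> ('d forest \<Rightarrow> real)) \<Rightarrow> 'd model \<Rightarrow> bool" where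
  "corresponds \<alpha> T U X P \<longleftrightarrow> X \<in> rough_paths \<alpha> T \<and> P \<in> models \<alpha> T U \<and> matches T X P \<and>
     (\<forall>Q\<in>models \<alpha> T U. matches T X Q \<longrightarrow> agree_on T Q P)"

definition renorm_model :: "real \<Rightarrow> ('d symb multiset \<Rightarrow> real) \<Rightarrow> 'd model \<Rightarrow> 'd model" where
  "renorm_model \<alpha> l = (\<lambda>(P, G).
     (\<lambda>s y. P s (renorm_map \<alpha> l y),
      \<lambda>t s. Gamma_of (\<lambda>F. lin (char_of_Gamma (G t s)) (renorm_map_plus \<alpha> l F))))"

end

theory Submission
  imports Defs "HOL-Real_Asymp.Real_Asymp"
begin

text \<open>
  Under \<open>\<phi>\<close> the symbols are the trees, and \<open>\<Delta>\<^sup>-\<close> is \<open>\<delta>\<^sup>-\<close>: a symbol has negative degree only if all of its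
  vertices carry a noise, so that an admissible subgraph is determined by the subtrees that it covers.

  Let \<open>\<delta>\<^sub>v\<close> be the contraction of \<open>\<delta>\<close> with \<open>v\<close>, multiplicatively extended to forests.  Whether the root is extracted
  or not distinguishes the two terms of \<open>\<delta>\<^sub>v [F]\<^sub>i = [\<delta>\<^sub>v F]\<^sub>i + \<Sum> v(s) [\<delta>\<^sub>v b]\<^sub>0\<close>, in which the sum is over the
  admissible cuts of \<open>[F]\<^sub>i\<close> into branches \<open>b\<close> and trunk \<open>s\<close>.  By this recursion and the coassociativity of
  \<open>\<Delta>\<^sub>\<star>\<close>, \<open>\<delta>\<^sub>v\<close> commutes with \<open>\<Delta>\<^sub>\<star>\<close> and with \<open>\<Delta>\<^sup>+\<close>, and \<open>\<delta>\<^sub>v \<delta>\<^sub>w = \<delta>\<close> of \<open>v + w\<close>, because contracted vertices have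
  the label \<open>0\<close>, which \<open>v\<close> does not see.  Therefore the transpose of \<open>\<delta>\<^sub>v\<close> is the translation \<open>M\<^sub>v\<close>, which is unique
  because the one-node trees generate a dense subspace; and the renormalised \<open>\<Gamma>\<close> is the conjugate of \<open>\<Gamma>\<close> by \<open>M\<^sub>l\<close>.
  Contracting a tree of negative degree increases the degree, which preserves the analytic bounds.  The renormalised
  model is the only one for the translated path because the renormalisation by \<open>- v\<close> is inverse to that by \<open>v\<close>.
\<close>

text \<open>Families of subtrees, subgraphs of symbols and cuts are defined globally, by vertex and
  edge sets, whereas the algebraic identities are proved by recursion on trees. The bridge is
  \<open>extraction_sum_rec\<close>. The obstacle is that a subtree through the root runs into
  several branches, so that a family of subtrees does not split into families on the branches;
  recording which covered vertices are joined to their parents makes the choices on the branches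
  independent. A second obstacle is analytic. Extraction lowers the number of nodes, so the exponent
  \<alpha> |\<tau>| in the definition of a rough path is too weak for the translated path. The
  exponent in which the label 0 counts 1 does not decrease under substitution. It is obtained from
  the model, because the path is the coefficient of 1 in \<Gamma>\<I>; for this reason the
  translated path is studied together with a matching model. The pre-Lie product is handled through
  \<open>star\<close>: on single trees the two products of tree series agree, so compatibility with
  one gives compatibility with the other.\<close>

section \<open>Linear extension on free vector spaces and free commutative algebras\<close>

lemma lookup_scaleR [simp]:
  "Poly_Mapping.lookup (r *\<^sub>R x) a = r *\<^sub>R Poly_Mapping.lookup (x :: 'a \<Rightarrow>\<^sub>0 'b::real_vector) a"
proof -
  have "finite {i. r *\<^sub>R Poly_Mapping.lookup x i \<noteq> 0}"
    by (rule finite_subset[OF _ finite_keys[of x]]) (auto simp: in_keys_iff)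
  then show ?thesis
    by (simp add: scaleR_poly_mapping_def)
qed

text \<open>An update at a fresh key is the addition of a single term; in the form with sums the
  induction steps are closed by additivity alone.\<close>

lemma poly_mapping_single_induct [case_names zero single_add]:
  assumes "P 0" "\<And>a c x. P x \<Longrightarrow> P (Poly_Mapping.single a c + x)"
  shows "P (x :: 'a \<Rightarrow>\<^sub>0 'b::comm_monoid_add)"
proof (induction x rule: update_induct)
  case (update f a b)
  have "Poly_Mapping.update a b f = Poly_Mapping.single a b + f"
    using update by (intro poly_mapping_eqI)
      (auto simp: lookup_update lookup_add lookup_single when_def not_in_keys_iff_lookup_eq_zero)
  then show ?case using update assms(2) by simp
qed (fact assms)

text \<open>Linear maps into free algebras, and into their tensor products, become instances of the
  general statements on \<open>lin\<close> with values in a real algebra.\<close>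

instance poly_mapping :: (monoid_add, real_algebra) real_algebra
proof
  fix r :: real and x y :: "'a \<Rightarrow>\<^sub>0 'b"
  have *: "r *\<^sub>R Poly_Mapping.single a c = Poly_Mapping.single a (r *\<^sub>R c)" for a :: 'a and c :: 'b
    by (rule poly_mapping_eqI) (simp add: lookup_single when_def)
  have 1: "r *\<^sub>R Poly_Mapping.single a c * y = r *\<^sub>R (Poly_Mapping.single a c * y)" for a c
    by (induction y rule: poly_mapping_single_induct)
      (simp_all add: distrib_left scaleR_add_right * mult_single)
  show "r *\<^sub>R x * y = r *\<^sub>R (x * y)"
    by (induction x rule: poly_mapping_single_induct) (simp_all add: distrib_right scaleR_add_right 1)
  have 2: "Poly_Mapping.single a c * r *\<^sub>R y = r *\<^sub>R (Poly_Mapping.single a c * y)" for a c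
    by (induction y rule: poly_mapping_single_induct)
      (simp_all add: distrib_left scaleR_add_right * mult_single)
  show "x * r *\<^sub>R y = r *\<^sub>R (x * y)"
    by (induction x rule: poly_mapping_single_induct) (simp_all add: distrib_right scaleR_add_right 2)
qed

instance poly_mapping :: (monoid_add, real_algebra_1) real_algebra_1 ..

lemma lin_superset:
  assumes "finite A" "Poly_Mapping.keys x \<subseteq> A"
  shows "lin f x = (\<Sum>a\<in>A. Poly_Mapping.lookup x a *\<^sub>R f a)"
  unfolding lin_def by (rule sum.mono_neutral_left) (use assms in \<open>auto simp: in_keys_iff\<close>)

lemma lin_add: "lin f (x + y) = lin f x + lin f y"
proof -
  let ?A = "Poly_Mapping.keys x \<union> Poly_Mapping.keys y"
  show ?thesis
    using keys_add[of x y]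
    by (simp add: lin_superset[of ?A] lookup_add scaleR_add_left sum.distrib)
qed

lemma lin_zero [simp]: "lin f 0 = 0"
  by (simp add: lin_def)

lemma lin_scaleR: "lin f (c *\<^sub>R x) = c *\<^sub>R lin f x"
proof -
  have "Poly_Mapping.keys (c *\<^sub>R x) \<subseteq> Poly_Mapping.keys x"
    by (auto simp: in_keys_iff)
  then show ?thesis
    by (simp add: lin_superset[of "Poly_Mapping.keys x"] scaleR_sum_right)
qed

lemma linear_lin: "linear (lin f)"
  by (intro linearI lin_add lin_scaleR)

lemma lin_sum: "lin f (sum g A) = (\<Sum>a\<in>A. lin f (g a))"
  by (rule linear_sum[OF linear_lin])

lemma lin_vec [simp]: "lin f (vec a) = f a"
  by (simp add: lin_def vec_def)

lemma lin_single: "lin f (Poly_Mapping.single a c) = c *\<^sub>R f a"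
  by (cases "c = 0") (simp_all add: lin_def)

lemma lin_vec_self [simp]: "lin vec x = x"
proof (rule poly_mapping_eqI)
  fix k
  show "Poly_Mapping.lookup (lin vec x) k = Poly_Mapping.lookup x k"
    by (auto simp: lin_def lookup_sum vec_def lookup_single when_def in_keys_iff
        if_distrib[of "\<lambda>c. _ * c"] cong: if_cong)
qed

lemma linear_eq_lin:
  assumes "linear h"
  shows "h x = lin (\<lambda>a. h (vec a)) x"
proof -
  have "h (lin vec x) = lin (\<lambda>a. h (vec a)) x"
    unfolding lin_def by (simp add: linear_sum[OF assms] linear_scale[OF assms])
  then show ?thesis by simp
qed

lemma linear_lin_eq: "linear h \<Longrightarrow> h (lin f x) = lin (\<lambda>a. h (f a)) x"
  by (simp add: lin_def linear_sum linear_scale)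

lemma lin_lin: "lin f (lin g x) = lin (\<lambda>a. lin f (g a)) x"
  by (rule linear_lin_eq[OF linear_lin])

lemma lin_cong: "(\<And>a. a \<in> Poly_Mapping.keys x \<Longrightarrow> f a = g a) \<Longrightarrow> lin f x = lin g x"
  by (simp add: lin_def)

lemma lin_add_fun: "lin (\<lambda>a. f a + g a) x = lin f x + lin g x"
  by (simp add: lin_def scaleR_add_right sum.distrib)

lemma lin_scaleR_fun: "lin (\<lambda>a. c *\<^sub>R f a) x = c *\<^sub>R lin f x"
  by (simp add: lin_def scaleR_sum_right mult.commute)

lemma lin_zero_fun [simp]: "lin (\<lambda>a. 0) x = 0"
  by (simp add: lin_def)

lemma lin_mult_left: "lin (\<lambda>a. c * f a) x = c * lin f x" for c :: "'v::real_algebra"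
  by (simp add: lin_def sum_distrib_left)

lemma lin_mult_right: "lin (\<lambda>a. f a * c) x = lin f x * c" for c :: "'v::real_algebra"
  by (simp add: lin_def sum_distrib_right)

lemma lin_swap: "lin (\<lambda>a. lin (\<lambda>b. f a b) y) x = lin (\<lambda>b. lin (\<lambda>a. f a b) x) y"
  unfolding lin_def scaleR_sum_right by (subst sum.swap) (simp add: mult.commute)

lemma lin_push [simp]: "lin f (push g x) = lin (\<lambda>a. f (g a)) x"
  by (simp add: push_def lin_lin)

lemma push_push: "push f (push g x) = push (\<lambda>a. f (g a)) x"
  by (simp add: push_def lin_lin)

lemma push_lin: "push f (lin g x) = lin (\<lambda>a. push f (g a)) x"
  by (simp add: push_def lin_lin)

lemma push_vec [simp]: "push f (vec a) = vec (f a)"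
  by (simp add: push_def)

lemma push_add: "push f (x + y) = push f x + push f y"
  by (simp add: push_def lin_add)

lemma push_zero [simp]: "push f 0 = 0"
  by (simp add: push_def)

lemma push_scaleR: "push f (c *\<^sub>R x) = c *\<^sub>R push f x"
  by (simp add: push_def lin_scaleR)

lemma push_sum: "push f (sum g A) = (\<Sum>a\<in>A. push f (g a))"
  by (simp add: push_def lin_sum)

lemma push_id [simp]: "push (\<lambda>a. a) x = x"
  by (simp add: push_def)

lemma keys_lin: "Poly_Mapping.keys (lin f x :: 'b \<Rightarrow>\<^sub>0 real) \<subseteq> (\<Union>a\<in>Poly_Mapping.keys x. Poly_Mapping.keys (f a))"
proof
  fix b assume "b \<in> Poly_Mapping.keys (lin f x)"
  then have "(\<Sum>a\<in>Poly_Mapping.keys x. Poly_Mapping.lookup x a * Poly_Mapping.lookup (f a) b) \<noteq> 0"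
    by (simp add: lin_def in_keys_iff lookup_sum)
  then obtain a where "a \<in> Poly_Mapping.keys x" "Poly_Mapping.lookup x a * Poly_Mapping.lookup (f a) b \<noteq> 0"
    by (rule sum.not_neutral_contains_not_neutral)
  then show "b \<in> (\<Union>a\<in>Poly_Mapping.keys x. Poly_Mapping.keys (f a))"
    by (auto simp: in_keys_iff)
qed

lemma keys_vec [simp]: "Poly_Mapping.keys (vec a) = {a}"
  by (simp add: vec_def)

lemma lookup_vec: "Poly_Mapping.lookup (vec a) b = (if b = a then 1 else 0)"
  by (auto simp: vec_def lookup_single when_def)

lemma keys_push: "Poly_Mapping.keys (push f x) \<subseteq> f ` Poly_Mapping.keys x"
  using keys_lin[of "\<lambda>a. vec (f a)" x] by (auto simp: push_def)

lemma vec_plus: "vec (a + b) = vec a * vec b"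
  by (simp add: vec_def mult_single)

lemma vec_zero: "vec 0 = 1"
  by (simp add: vec_def)

lemma lookup_eq_lin: "Poly_Mapping.lookup x a = lin (\<lambda>b. if b = a then 1 else 0) x"
  by (auto simp: lin_def in_keys_iff if_distrib cong: if_cong)

lemma lookup_lin: "Poly_Mapping.lookup (lin f x) b = lin (\<lambda>a. Poly_Mapping.lookup (f a) b) x"
  by (simp add: lin_def lookup_sum)

lemma lookup_push_inj:
  assumes "inj f"
  shows "Poly_Mapping.lookup (push f x) (f a) = Poly_Mapping.lookup x a"
  using assms by (simp add: lookup_eq_lin inj_eq)

text \<open>Three different functions also cover maps that are multiplicative only jointly with a
  parameter, such as sending \<open>(a1, a2)\<close> to \<open>(a1, a2, b)\<close> where
  \<open>b\<close> is itself split into a sum.\<close>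

lemma lin_times_bilinear:
  fixes f g h :: "'a::monoid_add \<Rightarrow> 'v::real_algebra"
  assumes "\<And>a b. h (a + b) = f a * g b"
  shows "lin h (x * y) = lin f x * lin g y"
proof -
  have 1: "lin h (Poly_Mapping.single a c * y) = lin f (Poly_Mapping.single a c) * lin g y" for a c
    by (induction y rule: poly_mapping_single_induct)
      (simp_all add: lin_add lin_single mult_single assms distrib_left)
  show ?thesis
    by (induction x rule: poly_mapping_single_induct) (simp_all add: lin_add distrib_right 1)
qed

text \<open>A map that turns the union of forests into a product extends to an algebra morphism.
  Together with \<open>lin_prod_mset\<close> this reduces identities on forests to identities on
  trees.\<close>

lemma lin_times:
  fixes f :: "'a::monoid_add \<Rightarrow> 'v::real_algebra"
  assumes "\<And>a b. f (a + b) = f a * f b"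
  shows "lin f (x * y) = lin f x * lin f y"
  by (rule lin_times_bilinear) (rule assms)

lemma lin_one:
  fixes f :: "'a::monoid_add \<Rightarrow> 'v::real_algebra_1"
  assumes "f 0 = 1"
  shows "lin f 1 = 1"
  using assms by (simp flip: vec_zero)

lemma lin_prod_mset:
  fixes f :: "'a::comm_monoid_add \<Rightarrow> 'v::{real_algebra_1,comm_ring_1}"
  assumes "f 0 = 1" "\<And>a b. f (a + b) = f a * f b"
  shows "lin f (\<Prod>t\<in>#M. g t) = (\<Prod>t\<in>#M. lin f (g t))"
  by (induction M) (simp_all add: lin_one lin_times assms)

lemma push_times:
  assumes "\<And>a b. f (a + b) = f a + f b"
  shows "push f (x * y) = push f x * push f y"
  unfolding push_def by (rule lin_times, subst assms, rule vec_plus)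

lemma push_prod_mset:
  assumes "f 0 = 0" "\<And>a b. f (a + b) = f a + f b"
  shows "push f (\<Prod>t\<in>#M. g t) = (\<Prod>t\<in>#M. push f (g t))"
  unfolding push_def by (rule lin_prod_mset, simp only: assms vec_zero, subst assms(2), rule vec_plus)

lemma keys_times_subset:
  "Poly_Mapping.keys (x * y) \<subseteq> {a + b | a b. a \<in> Poly_Mapping.keys x \<and> b \<in> Poly_Mapping.keys (y :: _ \<Rightarrow>\<^sub>0 real)}"
  using keys_mult[of x y] by auto

lemma tensor_lin: "lin f (tensor x y) = lin (\<lambda>a. lin (\<lambda>b. f (a, b)) y) x"
  by (simp add: tensor_def lin_lin)

lemma tensor_vec [simp]: "tensor (vec a) (vec b) = vec (a, b)"
  by (simp add: tensor_def)

lemma contract_left_push: "contract_left g (push f x) = lin (\<lambda>a. g (fst (f a)) *\<^sub>R vec (snd (f a))) x"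
  by (simp add: contract_left_def case_prod_unfold)

lemma lin_unit: "lin f 1 = f 0"
  by (metis lin_vec vec_zero)

section \<open>The coproduct and its coassociativity\<close>

lemma copr_empty [simp]: "copr {#} = 1"
  by (simp add: copr_def)

lemma copr_union: "copr (F + G) = copr F * copr G"
  by (simp add: copr_def)

lemma copr_single [simp]: "copr {#\<tau>#} = copr_tree \<tau>"
  by (simp add: copr_def)

text \<open>A pair consists of the branches that are cut off and the trunk.\<close>

definition pruned :: "'l tree \<Rightarrow> ('l tree multiset \<times> 'l tree \<Rightarrow>\<^sub>0 real)" where
  "pruned \<tau> = push (\<lambda>(a, b). (a, Node (root_label \<tau>) b)) (copr (kids \<tau>))"

lemma pruned_Node: "pruned (Node i ts) = push (\<lambda>(a, b). (a, Node i b)) (copr ts)"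
  by (simp add: pruned_def)

lemma copr_tree_pruned: "copr_tree \<tau> = vec ({#\<tau>#}, {#}) + push (\<lambda>(a, s). (a, {#s#})) (pruned \<tau>)"
  by (cases \<tau>) (simp add: pruned_Node push_push case_prod_unfold copr_def copr_tree.simps)

declare copr_tree.simps [simp del]

lemma lin_copr_tree: "lin f (copr_tree \<tau>) = f ({#\<tau>#}, {#}) + lin (\<lambda>(a, s). f (a, {#s#})) (pruned \<tau>)"
  by (simp add: copr_tree_pruned lin_add case_prod_unfold)

lemma tree_induct [case_names Node]:
  assumes "\<And>i ts. (\<And>t. t \<in># ts \<Longrightarrow> P t) \<Longrightarrow> P (Node i ts)"
  shows "P (\<tau> :: 'l tree)"
  by (induction \<tau>) (simp add: assms)

text \<open>Both iterated coproducts are algebra morphisms into the triple tensor product, so single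
  trees suffice. On \<open>Node i ts\<close> both sides reduce to the iterated coproduct of
  \<open>ts\<close>, where the induction hypothesis applies; the terms with empty third factor are
  the coproduct of the tree itself, padded by \<open>{#}\<close>.\<close>

lemma copr_coassoc:
  fixes F :: "'l tree multiset"
  shows
  "lin (\<lambda>(a, b). push (\<lambda>(a1, a2). (a1, a2, b)) (copr a)) (copr F) =
   lin (\<lambda>(a, b). push (\<lambda>(b1, b2). (a, b1, b2)) (copr b)) (copr F)"
proof -
  define l where "l = (\<lambda>(a :: 'l tree multiset, b). push (\<lambda>(a1, a2). (a1, a2, b :: 'l tree multiset)) (copr a))"
  define r where "r = (\<lambda>(a, b :: 'l tree multiset). push (\<lambda>(b1, b2). (a :: 'l tree multiset, b1, b2)) (copr b))"
  have l0: "l 0 = 1" and r0: "r 0 = 1"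
    by (simp_all add: l_def r_def zero_prod_def flip: vec_zero)
  have l_add: "l (x + y) = l x * l y" and r_add: "r (x + y) = r x * r y" for x y
  proof -
    have "push (\<lambda>(a1, a2). (a1, a2, b + b')) (x * y) =
        push (\<lambda>(a1, a2). (a1, a2, b)) x * push (\<lambda>(a1, a2). (a1, a2, b')) y"
      "push (\<lambda>(a1, a2). (b + b', a1, a2)) (x * y) =
        push (\<lambda>(a1, a2). (b, a1, a2)) x * push (\<lambda>(a1, a2). (b', a1, a2)) y"
      for b b' :: "'l tree multiset" and x y :: "'l tree multiset \<times> 'l tree multiset \<Rightarrow>\<^sub>0 real"
      unfolding push_def by (rule lin_times_bilinear, auto simp flip: vec_plus)+
    then show "l (x + y) = l x * l y" "r (x + y) = r x * r y"
      by (simp_all add: l_def r_def case_prod_unfold copr_union)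
  qed
  have mult: "lin l (copr F) = lin r (copr F)" if "\<And>t. t \<in># F \<Longrightarrow> lin l (copr_tree t) = lin r (copr_tree t)" for F
    using that
  proof (induction F)
    case (add t F)
    then have "lin l (copr_tree t) * lin l (copr F) = lin r (copr_tree t) * lin r (copr F)"
      by simp
    then show ?case
      by (simp add: copr_union[of "{#t#}" F, simplified] lin_times l_add r_add)
  qed (simp add: lin_one l0 r0)
  have "lin l (copr_tree \<tau>) = lin r (copr_tree \<tau>)" for \<tau> :: "'l tree"
  proof (induction \<tau> rule: tree_induct)
    case (Node i ts)
    have IH: "lin l (copr ts) = lin r (copr ts)"
      by (rule mult) (rule Node)
    have "lin l (copr_tree (Node i ts)) =
        push (\<lambda>(a1, a2). (a1, a2, {#})) (copr_tree (Node i ts)) +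
        push (\<lambda>(a, b, c). (a, b, {#Node i c#})) (lin l (copr ts))"
      by (simp add: lin_copr_tree pruned_Node l_def case_prod_unfold push_lin push_push)
    also have "\<dots> = lin r (copr_tree (Node i ts))"
      unfolding IH
      by (simp add: lin_copr_tree pruned_Node r_def case_prod_unfold push_lin push_push copr_tree_pruned
          push_add lin_add_fun) (simp add: push_def lin_add lin_lin lin_unit zero_prod_def lin_copr_tree pruned_Node
          lin_add_fun case_prod_unfold)
    finally show ?case .
  qed
  then have "lin l (copr F) = lin r (copr F)"
    using mult by blast
  then show ?thesis by (simp add: l_def r_def)
qed

section \<open>Vertices as addresses, and copies of branches\<close>

lemma sub_Nil [simp]: "sub x [] = x"
  by (simp add: sub_def)

lemma sub_Cons [simp]: "sub x (e # p) = sub (fst e) p"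
  by (simp add: sub_def)

lemma verts_Nil [simp]: "[] \<in> verts ch x"
  by (rule verts.root)

text \<open>\<open>verts\<close> extends addresses at the end, while recursion on trees splits off
  the first step; this equivalence turns vertices of a branch into vertices of the tree and
  back.\<close>

lemma verts_Cons [simp]:
  "e # p \<in> verts ch x \<longleftrightarrow> snd e < count (ch x) (fst e) \<and> p \<in> verts ch (fst e)"
proof
  assume e: "snd e < count (ch x) (fst e) \<and> p \<in> verts ch (fst e)"
  then have "p \<in> verts ch (fst e)" by simp
  then show "e # p \<in> verts ch x"
  proof induction
    case root
    then show ?case using verts.step[OF verts.root[of ch x], of "snd e" "fst e"] e by simp
  next
    case (step p k y)
    then show ?case using verts.step[of "e # p" ch x k y] by simp
  qed
next
  have "\<forall>e p. v = e # p \<longrightarrow> snd e < count (ch x) (fst e) \<and> p \<in> verts ch (fst e)" if "v \<in> verts ch x" for v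
    using that
  proof induction
    case (step p k y)
    show ?case
    proof (cases p)
      case Nil
      then show ?thesis using step by simp
    next
      case (Cons e q)
      then show ?thesis using step verts.step[of q ch "fst e" k y] by auto
    qed
  qed simp
  then show "e # p \<in> verts ch x \<Longrightarrow> snd e < count (ch x) (fst e) \<and> p \<in> verts ch (fst e)"
    by blast
qed

lemma verts_butlast: "p \<in> verts ch x \<Longrightarrow> butlast p \<in> verts ch x"
  by (induction rule: verts.induct) auto

text \<open>The occurrences in a multiset, numbered as in the steps of an address. Equal branches
  are kept apart, so that sums and choices over the branches run over a set; \<open>fst e\<close> is
  the branch itself.\<close>

definition copies :: "'n multiset \<Rightarrow> ('n \<times> nat) set" where
  "copies M = {(y, k). k < count M y}"

lemma copies_iff [simp]: "e \<in> copies M \<longleftrightarrow> snd e < count M (fst e)"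
  by (auto simp: copies_def)

lemma copies_Sigma: "copies M = (SIGMA y:set_mset M. {..<count M y})"
  by (auto simp: count_greater_zero_iff[symmetric] simp del: count_greater_zero_iff)

lemma finite_copies [simp]: "finite (copies M)"
  by (simp add: copies_Sigma)

lemma image_fst_copies: "image_mset fst (mset_set (copies M)) = M"
proof (rule multiset_eqI)
  fix y
  have "count (image_mset fst (mset_set (copies M))) y = card {e \<in> copies M. y = fst e}"
    by (simp add: count_image_mset_eq_card_vimage) (metis (no_types, lifting))
  also have "{e \<in> copies M. y = fst e} = Pair y ` {..<count M y}"
    by auto
  also have "card \<dots> = count M y"
    by (simp add: card_image inj_on_def)
  finally show "count (image_mset fst (mset_set (copies M))) y = count M y" .
qed

lemma sum_copies: "(\<Sum>e\<in>copies M. f (fst e)) = (\<Sum>y\<in>#M. f y)"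
  by (subst (2) image_fst_copies[symmetric]) (simp add: sum_unfold_sum_mset multiset.map_comp comp_def)

lemma prod_copies: "(\<Prod>e\<in>copies M. f (fst e)) = (\<Prod>y\<in>#M. f y)"
  by (subst (2) image_fst_copies[symmetric]) (simp add: prod_unfold_prod_mset multiset.map_comp comp_def)

lemma verts_Node:
  "verts kids (Node i ts) = insert [] (\<Union>e\<in>copies ts. (#) e ` verts kids (fst e))"
proof -
  have "p \<in> verts kids (Node i ts) \<longleftrightarrow> p \<in> insert [] (\<Union>e\<in>copies ts. (#) e ` verts kids (fst e))" for p
    by (cases p) auto
  then show ?thesis by blast
qed

lemma finite_verts [simp]: "finite (verts kids (\<tau> :: 'l tree))"
proof (induction \<tau> rule: tree_induct)
  case (Node i ts)
  have "finite (verts kids (fst e))" if "e \<in> copies ts" for e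
    using that by (intro Node) (simp add: count_greater_zero_iff[symmetric] del: count_greater_zero_iff)
  then show ?case by (simp add: verts_Node)
qed

section \<open>Reading trees off finite rooted graphs\<close>

lemma in_mset_set_D: "c \<in># mset_set A \<Longrightarrow> c \<in> A"
  by (metis count_mset_set(2,3) not_in_iff)

text \<open>A measure that drops along children bounds the height below \<open>v\<close>, so two
  depths above it read off the same tree. The set \<open>R\<close> is closed under children, and the
  measure has to be controlled on it alone.\<close>

lemma grow_stable:
  fixes \<mu> :: "'v \<Rightarrow> nat"
  assumes "\<And>v c. v \<in> R \<Longrightarrow> c \<in> ch v \<Longrightarrow> c \<in> R \<and> \<mu> c < \<mu> v" "v \<in> R" "\<mu> v \<le> n" "\<mu> v \<le> m"
  shows "grow con lab ch n v = grow con lab ch m v"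
  using assms(2-)
proof (induction n arbitrary: m v)
  case 0
  then have "ch v = {}" using assms(1) by force
  then show ?case by (cases m) simp_all
next
  case (Suc n)
  show ?case
  proof (cases m)
    case 0
    then have "ch v = {}" using assms(1) Suc by force
    then show ?thesis using 0 by simp
  next
    case m: (Suc m')
    have "grow con lab ch n c = grow con lab ch m' c" if "c \<in># mset_set (ch v)" for c
      using assms(1)[of v c] in_mset_set_D[OF that] Suc.prems m by (intro Suc.IH) auto
    then show ?thesis unfolding m by (simp cong: image_mset_cong)
  qed
qed

lemma grow_unfold:
  fixes \<mu> :: "'v \<Rightarrow> nat"
  assumes "\<And>v c. v \<in> R \<Longrightarrow> c \<in> ch v \<Longrightarrow> c \<in> R \<and> \<mu> c < \<mu> v" "v \<in> R" "\<mu> v \<le> n"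
  shows "grow con lab ch n v = con (lab v) (image_mset (grow con lab ch n) (mset_set (ch v)))"
  using grow_stable[OF assms(1,2,3), where m = "Suc n"] assms(3) by simp

text \<open>The map \<open>h\<close> embeds one rooted graph into another, children onto children,
  and \<open>g\<close> translates the trees that are read off. Both sides are truncated at the same
  depth, so no measure enters. It serves for passing to a branch, for replacing classes of vertices
  by representatives, and for passing from trees to symbols.\<close>

lemma grow_transfer:
  assumes "\<And>v c. v \<in> R \<Longrightarrow> c \<in> ch v \<Longrightarrow> c \<in> R"
    and "\<And>v. v \<in> R \<Longrightarrow> inj_on h (ch v)" "\<And>v. v \<in> R \<Longrightarrow> ch' (h v) = h ` ch v"
    and "\<And>v M. v \<in> R \<Longrightarrow> con' (lab' (h v)) (image_mset g M) = g (con (lab v) M)"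
    and "v \<in> R"
  shows "grow con' lab' ch' n (h v) = g (grow con lab ch n v)"
  using assms(5)
proof (induction n arbitrary: v)
  case 0
  then show ?case using assms(4)[of v "{#}"] by simp
next
  case (Suc n)
  have "image_mset (grow con' lab' ch' n) (mset_set (ch' (h v))) =
      image_mset g (image_mset (grow con lab ch n) (mset_set (ch v)))"
    using Suc assms(1-3)[of v]
    by (auto simp flip: image_mset_mset_set simp: multiset.map_comp intro!: image_mset_cong
        dest!: in_mset_set_D)
  then show ?case using assms(4)[OF Suc.prems] by simp
qed

lemma mset_set_UN_Cons:
  assumes "finite I" "\<And>e. e \<in> I \<Longrightarrow> finite (A e)"
  shows "mset_set (\<Union>e\<in>I. (#) e ` A e) = (\<Sum>e\<in>I. image_mset ((#) e) (mset_set (A e)))"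
  using assms
proof (induction I)
  case (insert e I)
  have "mset_set ((#) e ` A e \<union> (\<Union>e\<in>I. (#) e ` A e)) = mset_set ((#) e ` A e) + mset_set (\<Union>e\<in>I. (#) e ` A e)"
    by (rule mset_set_Union) (use insert in auto)
  then show ?case using insert by (simp add: image_mset_mset_set)
qed simp

lemma image_mset_sum: "finite I \<Longrightarrow> image_mset f (\<Sum>e\<in>I. A e) = (\<Sum>e\<in>I. image_mset f (A e))"
  by (induction I rule: finite_induct) simp_all

lemma vec_sum_prod: "vec (\<Sum>e\<in>I. f e) = (\<Prod>e\<in>I. vec (f e))" for f :: "'a \<Rightarrow> 'b::comm_monoid_add"
  by (induction I rule: infinite_finite_induct) (simp_all add: vec_plus vec_zero)


lemma is_child_Cons: "is_child (e # p) q \<longleftrightarrow> (\<exists>q'. q = e # q' \<and> is_child p q')"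
  by (cases q) (auto simp: is_child_def)

lemma is_child_Nil: "is_child [] q \<longleftrightarrow> (\<exists>e. q = [e])"
  by (cases q) (auto simp: is_child_def split: if_splits)

lemma length_child: "is_child p q \<Longrightarrow> length q = Suc (length p)"
  by (auto simp: is_child_def)

lemma take_verts: "p \<in> verts ch x \<Longrightarrow> take k p \<in> verts ch x"
proof (induction rule: verts.induct)
  case (step p k' y)
  then show ?case by (cases "k \<le> length p") (auto intro: verts.step)
qed simp

text \<open>The prefixes of an address are pairwise distinct vertices. Hence
  \<open>card (verts kids \<tau>) - length p\<close> decreases strictly along children, and the
  depth \<open>card (verts kids \<tau>)\<close> suffices everywhere.\<close>

lemma length_verts_less:
  fixes \<tau> :: "'l tree"
  assumes "p \<in> verts kids \<tau>"
  shows "length p < card (verts kids \<tau>)"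
proof -
  have "inj_on (\<lambda>k. take k p) {..length p}"
    by (auto simp: inj_on_def dest: arg_cong[of _ _ length])
  then have "card ((\<lambda>k. take k p) ` {..length p}) = Suc (length p)"
    by (simp add: card_image)
  moreover have "card ((\<lambda>k. take k p) ` {..length p}) \<le> card (verts kids \<tau>)"
    using assms by (intro card_mono) (auto intro: take_verts)
  ultimately show ?thesis by simp
qed

lemma card_verts_child:
  assumes "e \<in> copies ts"
  shows "card (verts kids (fst e)) \<le> card (verts kids (Node i ts))"
proof -
  have "card ((#) e ` verts kids (fst e)) \<le> card (verts kids (Node i ts))"
    using assms by (intro card_mono) (auto simp del: copies_iff simp: verts_Node)
  then show ?thesis by (simp add: card_image)
qed

section \<open>Extraction by joined vertices\<close>

text \<open>
  A family of disjoint subtrees is encoded by the set \<open>V\<close> of the vertices covered by it and the set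
  \<open>L\<close> of those covered vertices that belong to the same member as their parent.  This decouples the
  branches at a vertex.  In \<open>joinings\<close> the root may be in \<open>L\<close>, which says that its member continues
  to a parent of the root outside of the tree.
\<close>

definition joinings :: "'l tree \<Rightarrow> ('l tree addr set \<times> 'l tree addr set) set" where
  "joinings \<tau> = {(V, L). V \<subseteq> verts kids \<tau> \<and> L \<subseteq> V \<and> (\<forall>q\<in>L. q \<noteq> [] \<longrightarrow> butlast q \<in> V)}"

definition extractions :: "'l tree \<Rightarrow> ('l tree addr set \<times> 'l tree addr set) set" where
  "extractions \<tau> = {(V, L) \<in> joinings \<tau>. [] \<notin> L}"

text \<open>Climbs from a vertex along joined edges to the top of its member. A vertex outside of
  \<open>L\<close>, in particular an uncovered one, is its own top, so the tops represent the
  vertices of the contracted tree.\<close>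

function top_of :: "'n addr set \<Rightarrow> 'n addr \<Rightarrow> 'n addr" where
  "top_of L p = (if p \<noteq> [] \<and> p \<in> L then top_of L (butlast p) else p)"
  by auto
termination by (relation "Wellfounded.measure (length \<circ> snd)") auto

declare top_of.simps [simp del]

text \<open>Follows joined edges only: started at the top of a member, it reads off that
  member.\<close>

definition piece :: "'l tree \<Rightarrow> 'l tree addr set \<Rightarrow> 'l tree addr \<Rightarrow> 'l tree" where
  "piece \<tau> L = grow Node (\<lambda>p. root_label (sub \<tau> p)) (\<lambda>p. {q \<in> L. is_child p q}) (card (verts kids \<tau>))"

text \<open>Each vertex of the contracted tree is represented by its top, and \<open>q\<close> hangs
  at the top of the member of its old parent. A covered vertex gets the label 0 even if its member
  is a single node.\<close>

definition contracted :: "'d rtree \<Rightarrow> 'd rtree addr set \<Rightarrow> 'd rtree addr set \<Rightarrow> 'd rtree addr \<Rightarrow> 'd rtree" where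
  "contracted \<tau> V L = grow Node (\<lambda>p. if p \<in> V then None else root_label (sub \<tau> p))
     (\<lambda>p. {q \<in> verts kids \<tau> - L. q \<noteq> [] \<and> top_of L (butlast q) = p}) (card (verts kids \<tau>))"

definition below :: "'n \<times> nat \<Rightarrow> 'n addr set \<Rightarrow> 'n addr set" where
  "below e S = {p. e # p \<in> S}"

lemma below_iff [simp]: "p \<in> below e S \<longleftrightarrow> e # p \<in> S"
  by (simp add: below_def)

lemma length_top_of: "length (top_of L p) \<le> length p"
  by (induction L p rule: top_of.induct) (subst top_of.simps, auto)

lemma top_of_Nil [simp]: "top_of L [] = []"
  by (simp add: top_of.simps)

text \<open>The climb leaves the branch \<open>e\<close> exactly when it reaches the root of the
  branch and this root is joined to the root of the tree. The induction appends at the end because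
  \<open>top_of\<close> recurses on \<open>butlast\<close>.\<close>

lemma top_of_Cons:
  "top_of L (e # p) = (if top_of (below e L) p = [] \<and> [e] \<in> L then [] else e # top_of (below e L) p)"
proof (induction p rule: rev_induct)
  case Nil
  then show ?case by (subst top_of.simps) simp
next
  case (snoc x p)
  then show ?case
    by (subst (1) top_of.simps, subst (2 3) top_of.simps) simp
qed

lemma joinings_below:
  assumes "(V, L) \<in> joinings (Node i ts)" "e \<in> copies ts"
  shows "(below e V, below e L) \<in> joinings (fst e)"
  using assms by (fastforce simp: joinings_def)

lemma piece_unfold:
  assumes "(V, L) \<in> joinings \<tau>" "p \<in> verts kids \<tau>"
  shows "piece \<tau> L p = Node (root_label (sub \<tau> p)) (image_mset (piece \<tau> L) (mset_set {q \<in> L. is_child p q}))"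
  unfolding piece_def
proof (rule grow_unfold[where R = "verts kids \<tau>" and \<mu> = "\<lambda>p. card (verts kids \<tau>) - length p"])
  fix v c assume "v \<in> verts kids \<tau>" "c \<in> {q \<in> L. is_child v q}"
  then show "c \<in> verts kids \<tau> \<and> card (verts kids \<tau>) - length c < card (verts kids \<tau>) - length v"
    using length_verts_less[of c \<tau>] length_child[of v c] assms by (auto simp: joinings_def)
qed (use assms in auto)

lemma piece_Cons:
  assumes "(V, L) \<in> joinings (Node i ts)" "e \<in> copies ts" "p \<in> verts kids (fst e)"
  shows "piece (Node i ts) L (e # p) = piece (fst e) (below e L) p"
proof -
  note jb = joinings_below[OF assms(1,2)]
  have "piece (Node i ts) L (e # p) = grow Node (\<lambda>p. root_label (sub (fst e) p))
      (\<lambda>p. {q \<in> below e L. is_child p q}) (card (verts kids (Node i ts))) p"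
    unfolding piece_def
    by (rule grow_transfer[where R = "verts kids (fst e)" and g = "\<lambda>x. x"])
      (use jb assms(3) in \<open>auto simp: joinings_def is_child_Cons image_iff\<close>)
  also have "\<dots> = piece (fst e) (below e L) p"
    unfolding piece_def
  proof (rule grow_stable[where R = "verts kids (fst e)" and \<mu> = "\<lambda>p. card (verts kids (fst e)) - length p"])
    fix v c assume "v \<in> verts kids (fst e)" "c \<in> {q \<in> below e L. is_child v q}"
    moreover from this have "c \<in> verts kids (fst e)"
      using jb unfolding joinings_def by blast
    ultimately show "c \<in> verts kids (fst e) \<and> card (verts kids (fst e)) - length c < card (verts kids (fst e)) - length v"
      using length_verts_less[of c "fst e"] length_child[of v c] by auto
  qed (use assms(3) card_verts_child[OF assms(2), of i] in auto)
  finally show ?thesis .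
qed

lemma contracted_unfold:
  assumes "(V, L) \<in> joinings \<tau>" "p \<in> verts kids \<tau>"
  shows "contracted \<tau> V L p = Node (if p \<in> V then None else root_label (sub \<tau> p))
    (image_mset (contracted \<tau> V L) (mset_set {q \<in> verts kids \<tau> - L. q \<noteq> [] \<and> top_of L (butlast q) = p}))"
  unfolding contracted_def
proof (rule grow_unfold[where R = "verts kids \<tau>" and \<mu> = "\<lambda>p. card (verts kids \<tau>) - length p"])
  fix v c assume "v \<in> verts kids \<tau>" "c \<in> {q \<in> verts kids \<tau> - L. q \<noteq> [] \<and> top_of L (butlast q) = v}"
  then show "c \<in> verts kids \<tau> \<and> card (verts kids \<tau>) - length c < card (verts kids \<tau>) - length v"
    using length_top_of[of L "butlast c"] length_verts_less[of c \<tau>] by (cases c) auto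
qed (use assms in auto)

text \<open>The premise \<open>e # p \<notin> L\<close> makes \<open>e # p\<close> a top. For a
  joined \<open>[e]\<close> the two sides differ: in the whole tree the climbs continue to
  \<open>[]\<close>, so that nothing hangs at \<open>[e]\<close>, whereas in the branch
  \<open>[]\<close> keeps its children.\<close>

lemma contracted_Cons:
  assumes "(V, L) \<in> joinings (Node i ts)" "e \<in> copies ts" "p \<in> verts kids (fst e)" "e # p \<notin> L"
  shows "contracted (Node i ts) V L (e # p) = contracted (fst e) (below e V) (below e L) p"
proof -
  define R where "R = {p \<in> verts kids (fst e). e # p \<notin> L}"
  have ch: "{q \<in> verts kids (Node i ts) - L. q \<noteq> [] \<and> top_of L (butlast q) = e # p} =
      (#) e ` {q \<in> verts kids (fst e) - below e L. q \<noteq> [] \<and> top_of (below e L) (butlast q) = p}"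
    (is "?A = ?B") if "p \<in> R" for p
  proof -
    have "q \<in> ?A \<longleftrightarrow> q \<in> ?B" for q
      by (cases q) (use that assms(2) in \<open>auto simp: R_def top_of_Cons image_iff split: if_splits\<close>)
    then show ?thesis by blast
  qed
  have "contracted (Node i ts) V L (e # p) = grow Node
      (\<lambda>p. if p \<in> below e V then None else root_label (sub (fst e) p))
      (\<lambda>p. {q \<in> verts kids (fst e) - below e L. q \<noteq> [] \<and> top_of (below e L) (butlast q) = p})
      (card (verts kids (Node i ts))) p"
    unfolding contracted_def
    by (rule grow_transfer[where R = R and g = "\<lambda>x. x"])
      (use assms(3,4) ch in \<open>auto simp: R_def\<close>)
  also have "\<dots> = contracted (fst e) (below e V) (below e L) p"
    unfolding contracted_def
  proof (rule grow_stable[where R = R and \<mu> = "\<lambda>p. card (verts kids (fst e)) - length p"])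
    fix v c assume "v \<in> R"
      "c \<in> {q \<in> verts kids (fst e) - below e L. q \<noteq> [] \<and> top_of (below e L) (butlast q) = v}"
    then show "c \<in> R \<and> card (verts kids (fst e)) - length c < card (verts kids (fst e)) - length v"
      using length_top_of[of "below e L" "butlast c"] length_verts_less[of c "fst e"]
      by (cases c) (auto simp: R_def)
  qed (use assms card_verts_child[OF assms(2), of i] in \<open>auto simp: R_def\<close>)
  finally show ?thesis .
qed

lemma image_mset_mset_set_if:
  assumes "finite A"
  shows "image_mset f (mset_set {x \<in> A. P x}) = (\<Sum>x\<in>A. if P x then {#f x#} else {#})"
  using assms
proof (induction A)
  case (insert a A)
  have "{x \<in> insert a A. P x} = (if P a then insert a {x \<in> A. P x} else {x \<in> A. P x})"
    by auto
  then show ?case using insert by simp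
qed simp

lemma piece_Nil:
  assumes "(V, L) \<in> joinings (Node i ts)"
  shows "piece (Node i ts) L [] =
    Node i (\<Sum>e\<in>copies ts. if [e] \<in> L then {#piece (fst e) (below e L) []#} else {#})"
proof -
  have *: "{q \<in> L. is_child [] q} = (\<lambda>e. [e]) ` {e \<in> copies ts. [e] \<in> L}"
    using assms by (fastforce simp: joinings_def is_child_Nil)
  have "image_mset (piece (Node i ts) L) (mset_set {q \<in> L. is_child [] q}) =
      image_mset (\<lambda>e. piece (Node i ts) L [e]) (mset_set {e \<in> copies ts. [e] \<in> L})"
    unfolding * by (simp add: image_mset_mset_set[symmetric] inj_on_def multiset.map_comp comp_def)
  also have "\<dots> = (\<Sum>e\<in>copies ts. if [e] \<in> L then {#piece (fst e) (below e L) []#} else {#})"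
    unfolding image_mset_mset_set_if[OF finite_copies]
    by (rule sum.cong) (auto simp: piece_Cons[OF assms])
  finally show ?thesis
    by (subst piece_unfold[OF assms]) simp_all
qed

text \<open>A joined root of a branch is absorbed by the root and hands on the children that it has
  after contraction; a branch that is not joined stays one child, contracted by itself.\<close>

lemma contracted_Nil:
  assumes "(V, L) \<in> joinings (Node i ts)"
  shows "contracted (Node i ts) V L [] = Node (if [] \<in> V then None else i)
    (\<Sum>e\<in>copies ts. if [e] \<in> L then kids (contracted (fst e) (below e V) (below e L) [])
                      else {#contracted (fst e) (below e V) (below e L) []#})"
proof -
  define A where "A = (\<lambda>e. if [e] \<in> L
    then {q \<in> verts kids (fst e) - below e L. q \<noteq> [] \<and> top_of (below e L) (butlast q) = []} else {[]})"
  have "q \<in> verts kids (Node i ts) - L \<and> q \<noteq> [] \<and> top_of L (butlast q) = [] \<longleftrightarrow>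
      q \<in> (\<Union>e\<in>copies ts. (#) e ` A e)" for q
    by (cases q) (auto simp: A_def top_of_Cons image_iff split: if_splits)
  then have *: "{q \<in> verts kids (Node i ts) - L. q \<noteq> [] \<and> top_of L (butlast q) = []} =
      (\<Union>e\<in>copies ts. (#) e ` A e)" by blast
  have fin: "finite (A e)" for e by (simp add: A_def)
  have "image_mset (contracted (Node i ts) V L) (image_mset ((#) e) (mset_set (A e))) =
      (if [e] \<in> L then kids (contracted (fst e) (below e V) (below e L) [])
       else {#contracted (fst e) (below e V) (below e L) []#})" if "e \<in> copies ts" for e
  proof (cases "[e] \<in> L")
    case True
    have "image_mset (contracted (Node i ts) V L) (image_mset ((#) e) (mset_set (A e))) =
        image_mset (contracted (fst e) (below e V) (below e L)) (mset_set (A e))"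
      using True fin unfolding multiset.map_comp comp_def
      by (intro image_mset_cong contracted_Cons[OF assms that]) (auto simp: A_def)
    then show ?thesis
      using True by (simp add: contracted_unfold[OF joinings_below[OF assms that]] A_def)
  next
    case False
    then show ?thesis
      by (simp add: A_def contracted_Cons[OF assms that])
  qed
  then have "image_mset (contracted (Node i ts) V L)
      (mset_set {q \<in> verts kids (Node i ts) - L. q \<noteq> [] \<and> top_of L (butlast q) = []}) =
      (\<Sum>e\<in>copies ts. if [e] \<in> L then kids (contracted (fst e) (below e V) (below e L) [])
                      else {#contracted (fst e) (below e V) (below e L) []#})"
    unfolding * by (subst mset_set_UN_Cons) (auto simp: fin image_mset_sum intro!: sum.cong)
  then show ?thesis
    by (subst contracted_unfold[OF assms]) simp_all
qed

lemma finite_joinings [simp]: "finite (joinings \<tau>)"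
  by (rule finite_subset[of _ "Pow (verts kids \<tau>) \<times> Pow (verts kids \<tau>)"]) (auto simp: joinings_def)

lemma finite_extractions [simp]: "finite (extractions \<tau>)"
  by (rule finite_subset[OF _ finite_joinings[of \<tau>]]) (auto simp: extractions_def)

lemma sum_Pair: "(\<Sum>e\<in>A. (f e, g e)) = (\<Sum>e\<in>A. f e, \<Sum>e\<in>A. g e)"
  by (induction A rule: infinite_finite_induct) (simp_all add: zero_prod_def)

lemma pieces_Node:
  assumes "(V, L) \<in> joinings (Node i ts)"
  shows "image_mset (piece (Node i ts) L) (mset_set (V - L - {[]})) =
    (\<Sum>e\<in>copies ts. image_mset (piece (fst e) (below e L)) (mset_set (below e V - below e L)))"
proof -
  have sub: "below e V \<subseteq> verts kids (fst e)" if "e \<in> copies ts" for e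
    using joinings_below[OF assms that] by (auto simp: joinings_def)
  then have fin: "finite (below e V - below e L)" if "e \<in> copies ts" for e
    using that finite_subset[OF sub] by auto
  have "q \<in> V - L - {[]} \<longleftrightarrow> q \<in> (\<Union>e\<in>copies ts. (#) e ` (below e V - below e L))" for q
    using assms by (cases q) (auto simp: joinings_def image_iff)
  then have "V - L - {[]} = (\<Union>e\<in>copies ts. (#) e ` (below e V - below e L))" by blast
  then have *: "mset_set (V - L - {[]}) =
      (\<Sum>e\<in>copies ts. image_mset ((#) e) (mset_set (below e V - below e L)))"
    using fin by (simp add: mset_set_UN_Cons del: copies_iff)
  show ?thesis
    unfolding * image_mset_sum[OF finite_copies] multiset.map_comp comp_def
    using sub by (intro sum.cong image_mset_cong piece_Cons[OF assms] refl) (auto dest!: in_mset_set_D simp del: copies_iff)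
qed

text \<open>The root is no child of any vertex and every climb stops at it, so
  \<open>[] \<in> L\<close> is a mere mark for the edge that leads out of the tree.\<close>

lemma join_root_irrelevant:
  "piece \<tau> (insert [] L) = piece \<tau> L" "contracted \<tau> V (insert [] L) = contracted \<tau> V L"
proof -
  have "{q \<in> insert [] L. is_child p q} = {q \<in> L. is_child p q}" for p
    by (auto simp: is_child_def)
  then show "piece \<tau> (insert [] L) = piece \<tau> L"
    by (simp add: piece_def)
  have top: "top_of (insert [] L) p = top_of L p" for p
    by (induction L p rule: top_of.induct) (subst (1 2) top_of.simps, simp)
  have "{q \<in> verts kids \<tau> - insert [] L. q \<noteq> [] \<and> top_of (insert [] L) (butlast q) = p} =
      {q \<in> verts kids \<tau> - L. q \<noteq> [] \<and> top_of L (butlast q) = p}" for p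
    by (auto simp: top)
  then show "contracted \<tau> V (insert [] L) = contracted \<tau> V L"
    by (simp add: contracted_def)
qed

text \<open>This is \<delta>, with the contracted tree written as a forest of one tree: the values
  at several branches can then be multiplied in the algebra of pairs of forests.\<close>

definition extraction_sum :: "'d rtree \<Rightarrow> ('d forest \<times> 'd forest \<Rightarrow>\<^sub>0 real)" where
  "extraction_sum \<tau> = (\<Sum>(V, L)\<in>extractions \<tau>.
     vec (image_mset (piece \<tau> L) (mset_set (V - L)), {#contracted \<tau> V L []#}))"

text \<open>The extractions that cover the root, with the member at the root separated from the
  others. Of the contracted tree only the children of its root are kept, the label being 0 in any
  case; they are what a parent takes over if the root is joined to it.\<close>

definition rooted_sum :: "'d rtree \<Rightarrow> ('d forest \<times> 'd forest \<times> 'd forest \<Rightarrow>\<^sub>0 real)" where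
  "rooted_sum \<tau> = (\<Sum>(V, L)\<in>{(V, L) \<in> extractions \<tau>. [] \<in> V}.
     vec ({#piece \<tau> L []#}, image_mset (piece \<tau> L) (mset_set (V - L - {[]})), kids (contracted \<tau> V L [])))"

text \<open>The contribution of a branch below a covered root: a joined branch passes its part of
  the root's member and its contracted children upwards, any other branch adds nothing to that
  member and stays one tree.\<close>

definition joining_sum :: "'d rtree \<Rightarrow> ('d forest \<times> 'd forest \<times> 'd forest \<Rightarrow>\<^sub>0 real)" where
  "joining_sum \<tau> = (\<Sum>(V, L)\<in>joinings \<tau>.
     vec (if [] \<in> L then {#piece \<tau> L []#} else {#}, image_mset (piece \<tau> L) (mset_set (V - L)),
       if [] \<in> L then kids (contracted \<tau> V L []) else {#contracted \<tau> V L []#}))"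

lemma joining_sum_eq:
  "joining_sum \<tau> = rooted_sum \<tau> + push (\<lambda>(F, H). ({#}, F, H)) (extraction_sum \<tau>)"
proof -
  let ?g = "\<lambda>(V, L). vec (if [] \<in> L then {#piece \<tau> L []#} else {#}, image_mset (piece \<tau> L) (mset_set (V - L)),
       if [] \<in> L then kids (contracted \<tau> V L []) else {#contracted \<tau> V L []#})"
  let ?R = "{(V, L) \<in> joinings \<tau>. [] \<in> L}"
  have split: "joinings \<tau> = ?R \<union> extractions \<tau>" "?R \<inter> extractions \<tau> = {}"
    by (auto simp: extractions_def)
  have fin: "finite ?R"
    by (rule finite_subset[OF _ finite_joinings[of \<tau>]]) auto
  have "sum ?g (joinings \<tau>) = sum ?g ?R + sum ?g (extractions \<tau>)"
    by (subst split(1), rule sum.union_disjoint) (use fin split(2) in auto)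
  \<comment> \<open>Dropping the mark \<open>[]\<close> from \<open>L\<close> turns the joinings
    with a joined root into the extractions that cover the root.\<close>
  also have "sum ?g ?R = rooted_sum \<tau>"
    unfolding rooted_sum_def
  proof (rule sum.reindex_bij_witness[where i = "\<lambda>(V, L). (V, insert [] L)" and j = "\<lambda>(V, L). (V, L - {[]})"])
    fix c assume "c \<in> ?R"
    then obtain V L where c: "c = (V, L)" "[] \<in> L" "(V, L) \<in> joinings \<tau>" by auto
    then have "V - L = V - (L - {[]}) - {[]}" by auto
    then show "(case case c of (V, L) \<Rightarrow> (V, L - {[]}) of (V, L) \<Rightarrow>
        vec ({#piece \<tau> L []#}, image_mset (piece \<tau> L) (mset_set (V - L - {[]})), kids (contracted \<tau> V L []))) = ?g c"
      using join_root_irrelevant(1)[of \<tau> "L - {[]}"] join_root_irrelevant(2)[of \<tau> V "L - {[]}"] c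
      by (simp add: insert_absorb)
  qed (auto simp: extractions_def joinings_def)
  also have "sum ?g (extractions \<tau>) = push (\<lambda>(F, H). ({#}, F, H)) (extraction_sum \<tau>)"
    unfolding extraction_sum_def push_sum by (rule sum.cong) (auto simp: extractions_def)
  finally show ?thesis by (simp add: joining_sum_def)
qed

text \<open>An extraction amounts to the decision \<open>r\<close> whether the root is covered, and
  an independent choice on each copy of each branch. If the root is covered, all joinings are
  possible on a branch; otherwise no branch may be joined to it, which is the last
  assumption.\<close>

lemma bij_betw_below:
  fixes ts :: "'a tree multiset"
  assumes "\<And>t c. t \<in># ts \<Longrightarrow> c \<in> S t \<Longrightarrow> c \<in> joinings t"
    and "A = {(V, L) \<in> extractions (Node i ts). ([] \<in> V \<longleftrightarrow> r) \<and> (\<forall>e\<in>copies ts. (below e V, below e L) \<in> S (fst e))}"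
    and "\<not> r \<Longrightarrow> (\<And>t c. t \<in># ts \<Longrightarrow> c \<in> S t \<Longrightarrow> c \<in> extractions t)"
  shows "bij_betw (\<lambda>(V, L). restrict (\<lambda>e. (below e V, below e L)) (copies ts)) A (PiE (copies ts) (\<lambda>e. S (fst e)))"
proof -
  \<comment> \<open>\<open>VV\<close> and \<open>LL\<close> glue a choice on the branches to sets of
    vertices of the tree; this is the inverse map.\<close>
  define VV where "VV = (\<lambda>g :: 'a tree \<times> nat \<Rightarrow> 'a tree addr set \<times> 'a tree addr set.
    (if r then {[]} else {}) \<union> (\<Union>e\<in>copies ts. (#) e ` fst (g e)))"
  define LL where "LL = (\<lambda>g :: 'a tree \<times> nat \<Rightarrow> 'a tree addr set \<times> 'a tree addr set.
    \<Union>e\<in>copies ts. (#) e ` snd (g e))"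
  define \<Phi> where "\<Phi> = (\<lambda>(V, L). restrict (\<lambda>e :: 'a tree \<times> nat. (below e V, below e L)) (copies ts))"
  have Vin: "[] \<in> VV g \<longleftrightarrow> r" "e # p \<in> VV g \<longleftrightarrow> e \<in> copies ts \<and> p \<in> fst (g e)"
    "[] \<notin> LL g" "e # p \<in> LL g \<longleftrightarrow> e \<in> copies ts \<and> p \<in> snd (g e)" for g e p
    by (auto simp: VV_def LL_def simp del: copies_iff)
  have bel: "below e (VV g) = fst (g e)" "below e (LL g) = snd (g e)" if "e \<in> copies ts" for g e
    using Vin that unfolding below_def by blast+
  have in_ts: "fst e \<in># ts" if "e \<in> copies ts" for e
    using that by (simp add: count_greater_zero_iff[symmetric] del: count_greater_zero_iff)
  have 1: "(VV (\<Phi> c), LL (\<Phi> c)) = c" if cA: "c \<in> A" for c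
  proof -
    obtain V L where c: "c = (V, L)" "(V, L) \<in> joinings (Node i ts)" "[] \<notin> L" "[] \<in> V \<longleftrightarrow> r"
      using cA unfolding assms(2) extractions_def by blast
    have sub: "V \<subseteq> verts kids (Node i ts)" "L \<subseteq> V" using c(2) by (auto simp: joinings_def)
    have cop: "e \<in> copies ts" if "e # p \<in> V" for e p
      using sub that by auto
    have "q \<in> VV (\<Phi> c) \<longleftrightarrow> q \<in> V" for q
      using c cop by (cases q) (auto simp: Vin \<Phi>_def simp del: copies_iff)
    moreover have "q \<in> LL (\<Phi> c) \<longleftrightarrow> q \<in> L" for q
      using c cop sub by (cases q) (auto simp: Vin \<Phi>_def simp del: copies_iff)
    ultimately show ?thesis
      unfolding c by blast
  qed
  have 2: "\<Phi> (VV g, LL g) = g" if "g \<in> PiE (copies ts) (\<lambda>e. S (fst e))" for g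
  proof
    fix e show "\<Phi> (VV g, LL g) e = g e"
      using that by (cases "e \<in> copies ts") (auto simp: \<Phi>_def bel PiE_arb[OF that] simp del: copies_iff)
  qed
  have 3: "\<Phi> c \<in> PiE (copies ts) (\<lambda>e. S (fst e))" if "c \<in> A" for c
    using that by (auto simp: assms(2) \<Phi>_def simp del: copies_iff)
  have 4: "(VV g, LL g) \<in> A" if g: "g \<in> PiE (copies ts) (\<lambda>e. S (fst e))" for g
  proof -
    have j: "g e \<in> joinings (fst e)" "g e \<in> S (fst e)" if "e \<in> copies ts" for e
      using assms(1)[OF in_ts[OF that]] PiE_mem[OF g that] by blast+
    have noroot: "[] \<notin> snd (g e)" if "e \<in> copies ts" "\<not> r" for e
      using assms(3)[OF that(2) in_ts[OF that(1)] j(2)[OF that(1)]]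
      by (auto simp: extractions_def split: prod.splits)
    have jj: "fst (g e) \<subseteq> verts kids (fst e)" "snd (g e) \<subseteq> fst (g e)"
      "\<And>q. q \<in> snd (g e) \<Longrightarrow> q \<noteq> [] \<Longrightarrow> butlast q \<in> fst (g e)" if "e \<in> copies ts" for e
      using j(1)[OF that] by (auto simp: joinings_def split: prod.splits)
    have "q \<in> verts kids (Node i ts)" if "q \<in> VV g" for q
    proof (cases q)
      case (Cons e p)
      then have e: "e \<in> copies ts" "p \<in> fst (g e)" using Vin(2) that by blast+
      then show ?thesis using jj(1)[OF e(1)] Cons by auto
    qed simp
    moreover have "q \<in> VV g" if "q \<in> LL g" for q
    proof (cases q)
      case (Cons e p)
      then show ?thesis using that Vin(2,4) jj(2) by blast
    qed (use that Vin(3) in blast)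
    moreover have "butlast q \<in> VV g" if q: "q \<in> LL g" "q \<noteq> []" for q
    proof (cases q)
      case (Cons e p)
      then have e: "e \<in> copies ts" "p \<in> snd (g e)" using q Vin(4) by blast+
      show ?thesis
      proof (cases "p = []")
        case True
        then have r using noroot e by blast
        then show ?thesis using True Cons Vin(1) by simp
      next
        case False
        then show ?thesis using jj(3)[OF e(1) e(2)] Cons Vin(2)[of e "butlast p" g] e(1) by simp
      qed
    qed (use q in simp)
    ultimately have "(VV g, LL g) \<in> extractions (Node i ts)"
      unfolding extractions_def joinings_def using Vin(3)[of g] by blast
    then show ?thesis
      using j(2) bel Vin(1) by (auto simp: assms(2) simp del: copies_iff)
  qed
  have "bij_betw \<Phi> A (PiE (copies ts) (\<lambda>e. S (fst e)))"
    by (rule bij_betw_byWitness[where f' = "\<lambda>g. (VV g, LL g)"]) (use 1 2 3 4 in blast)+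
  then show ?thesis by (simp add: \<Phi>_def)
qed

lemma prod_joinings:
  fixes f :: "'a \<Rightarrow> 'b \<Rightarrow> 'c::comm_monoid_add"
  assumes "\<And>t. finite (S t)"
  shows "(\<Prod>t\<in>#ts. \<Sum>c\<in>S t. vec (f t c)) =
    (\<Sum>g\<in>PiE (copies ts) (\<lambda>e. S (fst e)). vec (\<Sum>e\<in>copies ts. f (fst e) (g e)))"
proof -
  have "(\<Prod>t\<in>#ts. \<Sum>c\<in>S t. vec (f t c)) = (\<Prod>e\<in>copies ts. \<Sum>c\<in>S (fst e). vec (f (fst e) c))"
    by (simp add: prod_copies[of "\<lambda>t. \<Sum>c\<in>S t. vec (f t c)"])
  also have "\<dots> = (\<Sum>g\<in>PiE (copies ts) (\<lambda>e. S (fst e)). \<Prod>e\<in>copies ts. vec (f (fst e) (g e)))"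
    by (rule prod_sum_PiE) (simp_all add: assms)
  finally show ?thesis by (simp add: vec_sum_prod)
qed

lemma rooted_sum_Node:
  fixes ts :: "'d rtree multiset"
  shows
  "rooted_sum (Node i ts) =
    push (\<lambda>(S, F, H). ({#Node i S#}, F, H)) (\<Prod>t\<in>#ts. joining_sum t)"
proof -
  define f where "f = (\<lambda>(\<tau> :: 'd rtree) (V, L). (if [] \<in> L then {#piece \<tau> L []#} else {#},
    image_mset (piece \<tau> L) (mset_set (V - L)),
    if [] \<in> L then kids (contracted \<tau> V L []) else {#contracted \<tau> V L []#}))"
  have js: "joining_sum t = (\<Sum>c\<in>joinings t. vec (f t c))" for t :: "'d rtree"
    by (simp add: joining_sum_def f_def case_prod_unfold)
  let ?A = "{(V, L) \<in> extractions (Node i ts). [] \<in> V}"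
  have bij: "bij_betw (\<lambda>(V, L). restrict (\<lambda>e. (below e V, below e L)) (copies ts)) ?A
      (PiE (copies ts) (\<lambda>e. joinings (fst e)))"
  proof (rule bij_betw_below[where r = True])
    have "(below e V, below e L) \<in> joinings (fst e)"
      if "(V, L) \<in> extractions (Node i ts)" "e \<in> copies ts" for e V L
      using that by (intro joinings_below) (auto simp: extractions_def)
    then show "?A = {(V, L) \<in> extractions (Node i ts). ([] \<in> V \<longleftrightarrow> True) \<and>
        (\<forall>e\<in>copies ts. (below e V, below e L) \<in> joinings (fst e))}"
      by (auto simp del: copies_iff)
  qed auto
  have "rooted_sum (Node i ts) = (\<Sum>(V, L)\<in>?A. push (\<lambda>(S, F, H). ({#Node i S#}, F, H))
      (vec (\<Sum>e\<in>copies ts. f (fst e) (below e V, below e L))))"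
    unfolding rooted_sum_def
  proof (rule sum.cong)
    fix c assume "c \<in> ?A"
    then obtain V L where c: "c = (V, L)" "(V, L) \<in> joinings (Node i ts)" "[] \<in> V"
      by (auto simp: extractions_def)
    have eq: "(\<Sum>e\<in>copies ts. f (fst e) (below e V, below e L)) =
        (\<Sum>e\<in>copies ts. if [e] \<in> L then {#piece (fst e) (below e L) []#} else {#},
         image_mset (piece (Node i ts) L) (mset_set (V - L - {[]})),
         \<Sum>e\<in>copies ts. if [e] \<in> L then kids (contracted (fst e) (below e V) (below e L) [])
                      else {#contracted (fst e) (below e V) (below e L) []#})"
      by (simp add: f_def sum_Pair pieces_Node[OF c(2)])
    show "(case c of (V, L) \<Rightarrow> vec ({#piece (Node i ts) L []#},
        image_mset (piece (Node i ts) L) (mset_set (V - L - {[]})), kids (contracted (Node i ts) V L []))) =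
      (case c of (V, L) \<Rightarrow> push (\<lambda>(S, F, H). ({#Node i S#}, F, H))
        (vec (\<Sum>e\<in>copies ts. f (fst e) (below e V, below e L))))"
      unfolding c(1) by (simp add: eq piece_Nil[OF c(2)] contracted_Nil[OF c(2)])
  qed simp
  also have "\<dots> = (\<Sum>c\<in>?A. push (\<lambda>(S, F, H). ({#Node i S#}, F, H)) (vec (\<Sum>e\<in>copies ts. f (fst e)
      ((\<lambda>(V, L). restrict (\<lambda>e. (below e V, below e L)) (copies ts)) c e))))"
    by (rule sum.cong) (auto simp del: push_vec copies_iff intro!: arg_cong[where f = "push _"] arg_cong[where f = vec] sum.cong)
  also have "\<dots> = push (\<lambda>(S, F, H). ({#Node i S#}, F, H)) (\<Prod>t\<in>#ts. joining_sum t)"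
    unfolding js prod_joinings[OF finite_joinings] push_sum
    by (rule sum.reindex_bij_betw[OF bij])
  finally show ?thesis .
qed

lemma extraction_sum_Node:
  fixes ts :: "'d rtree multiset"
  shows
  "extraction_sum (Node i ts) =
    push (\<lambda>(F, H). (F, {#Node i H#})) (\<Prod>t\<in>#ts. extraction_sum t) +
    push (\<lambda>(S, F, H). (S + F, {#Node None H#})) (rooted_sum (Node i ts))"
proof -
  define f where "f = (\<lambda>(\<tau> :: 'd rtree) (V, L). (image_mset (piece \<tau> L) (mset_set (V - L)), {#contracted \<tau> V L []#}))"
  have es: "extraction_sum t = (\<Sum>c\<in>extractions t. vec (f t c))" for t :: "'d rtree"
    by (simp add: extraction_sum_def f_def case_prod_unfold)
  let ?A = "{(V, L) \<in> extractions (Node i ts). [] \<in> V}"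
  let ?B = "{(V, L) \<in> extractions (Node i ts). [] \<notin> V}"
  have split: "extractions (Node i ts) = ?B \<union> ?A" "?B \<inter> ?A = {}"
    by auto
  have fin: "finite ?A" "finite ?B"
    by (rule finite_subset[OF _ finite_extractions[of "Node i ts"]], auto)+
  have bij: "bij_betw (\<lambda>(V, L). restrict (\<lambda>e. (below e V, below e L)) (copies ts)) ?B
      (PiE (copies ts) (\<lambda>e. extractions (fst e)))"
  proof (rule bij_betw_below[where r = False])
    have "(below e V, below e L) \<in> extractions (fst e)"
      if "(V, L) \<in> extractions (Node i ts)" "[] \<notin> V" "e \<in> copies ts" for e V L
      using that joinings_below[of V L i ts e] by (fastforce simp: extractions_def joinings_def)
    then show "?B = {(V, L) \<in> extractions (Node i ts). ([] \<in> V \<longleftrightarrow> False) \<and>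
        (\<forall>e\<in>copies ts. (below e V, below e L) \<in> extractions (fst e))}"
      by (auto simp del: copies_iff)
  qed (auto simp: extractions_def)
  have "(\<Sum>c\<in>?B. vec (f (Node i ts) c)) = (\<Sum>(V, L)\<in>?B. push (\<lambda>(F, H). (F, {#Node i H#}))
      (vec (\<Sum>e\<in>copies ts. f (fst e) (below e V, below e L))))"
  proof (rule sum.cong)
    fix c assume "c \<in> ?B"
    then obtain V L where c: "c = (V, L)" "(V, L) \<in> joinings (Node i ts)" "[] \<notin> V" "[] \<notin> L"
      by (auto simp: extractions_def)
    have noroot: "[e] \<notin> L" for e
      using c by (auto simp: joinings_def)
    have VL: "V - L - {[]} = V - L" using c by auto
    show "vec (f (Node i ts) c) = (case c of (V, L) \<Rightarrow> push (\<lambda>(F, H). (F, {#Node i H#}))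
        (vec (\<Sum>e\<in>copies ts. f (fst e) (below e V, below e L))))"
      unfolding c(1)
      by (simp add: f_def sum_Pair contracted_Nil[OF c(2)] c noroot pieces_Node[OF c(2), unfolded VL])
  qed simp
  also have "\<dots> = (\<Sum>c\<in>?B. push (\<lambda>(F, H). (F, {#Node i H#})) (vec (\<Sum>e\<in>copies ts. f (fst e)
      ((\<lambda>(V, L). restrict (\<lambda>e. (below e V, below e L)) (copies ts)) c e))))"
    by (rule sum.cong) (auto simp del: push_vec copies_iff intro!: arg_cong[where f = "push _"] arg_cong[where f = vec] sum.cong)
  also have "\<dots> = push (\<lambda>(F, H). (F, {#Node i H#})) (\<Prod>t\<in>#ts. extraction_sum t)"
    unfolding es prod_joinings[OF finite_extractions] push_sum
    by (rule sum.reindex_bij_betw[OF bij])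
  finally have B: "(\<Sum>c\<in>?B. vec (f (Node i ts) c)) = push (\<lambda>(F, H). (F, {#Node i H#})) (\<Prod>t\<in>#ts. extraction_sum t)" .
  have A: "(\<Sum>c\<in>?A. vec (f (Node i ts) c)) = push (\<lambda>(S, F, H). (S + F, {#Node None H#})) (rooted_sum (Node i ts))"
    unfolding rooted_sum_def push_sum
  proof (rule sum.cong)
    fix c assume "c \<in> ?A"
    then obtain V L where c: "c = (V, L)" "(V, L) \<in> joinings (Node i ts)" "[] \<in> V" "[] \<notin> L"
      by (auto simp: extractions_def)
    have "finite V" using c(2) finite_subset[OF _ finite_verts[of "Node i ts"]] by (auto simp: joinings_def)
    then have "mset_set (V - L) = {#[]#} + mset_set (V - L - {[]})"
      using c(3,4) by (subst mset_set.remove[of _ "[]"]) auto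
    then show "vec (f (Node i ts) c) = push (\<lambda>(S, F, H). (S + F, {#Node None H#}))
        (case c of (V, L) \<Rightarrow> vec ({#piece (Node i ts) L []#},
          image_mset (piece (Node i ts) L) (mset_set (V - L - {[]})), kids (contracted (Node i ts) V L [])))"
      unfolding c(1) by (simp add: f_def contracted_Nil[OF c(2)] c(3))
  qed simp
  show ?thesis
    unfolding es[of "Node i ts"] A[symmetric] B[symmetric]
    by (subst split(1), rule sum.union_disjoint) (use fin split(2) in auto)
qed

text \<open>A member that contains the root is the trunk of an admissible cut, and the branches that
  are cut off are extracted independently. In the induction a branch \<open>t\<close> of the root
  contributes the image of its coproduct: the term \<open>t\<close> \<otimes> 1 is the branch that
  is not joined, the cuts with a nonempty trunk are the joined ones.\<close>

lemma rooted_sum_pruned: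
  fixes \<tau> :: "'d rtree"
  shows
  "rooted_sum \<tau> = lin (\<lambda>(b, s). push (\<lambda>(F, H). ({#s#}, F, H)) (\<Prod>t\<in>#b. extraction_sum t)) (pruned \<tau>)"
proof (induction \<tau> rule: tree_induct)
  case (Node i ts)
  define m where "m = (\<lambda>(a :: 'd forest, b :: 'd forest). push (\<lambda>(F, H). (b, F, H)) (\<Prod>t\<in>#a. extraction_sum t))"
  have m_add: "m (x + y) = m x * m y" for x y
  proof -
    have "push (\<lambda>(F, H). (b + b', F, H)) (x * y) = push (\<lambda>(F, H). (b, F, H)) x * push (\<lambda>(F, H). (b', F, H)) y"
      for b b' :: "'d forest" and x y :: "'d forest \<times> 'd forest \<Rightarrow>\<^sub>0 real"
      unfolding push_def by (rule lin_times_bilinear) (auto simp flip: vec_plus)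
    then show ?thesis by (simp add: m_def case_prod_unfold)
  qed
  have m_zero: "m 0 = 1"
    by (simp add: m_def zero_prod_def flip: vec_zero)
  have "lin m (copr_tree t) = joining_sum t" if "t \<in># ts" for t
    using Node[OF that]
    by (simp add: lin_copr_tree joining_sum_eq m_def case_prod_unfold)
  then have "(\<Prod>t\<in>#ts. joining_sum t) = lin m (copr ts)"
    by (simp add: copr_def lin_prod_mset[OF m_zero m_add] cong: image_mset_cong)
  then show ?case
    by (simp add: rooted_sum_Node push_lin pruned_Node m_def case_prod_unfold push_push)
qed

text \<open>The recursion of the overview before contraction with a functional: the trunk
  \<open>s\<close> is still recorded among the extracted trees.\<close>

theorem extraction_sum_rec:
  "extraction_sum \<tau> =
    push (\<lambda>(F, H). (F, {#Node (root_label \<tau>) H#})) (\<Prod>t\<in>#kids \<tau>. extraction_sum t) +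
    lin (\<lambda>(b, s). push (\<lambda>(F, H). (add_mset s F, {#Node None H#})) (\<Prod>t\<in>#b. extraction_sum t)) (pruned \<tau>)"
  by (cases \<tau>) (simp add: extraction_sum_Node rooted_sum_pruned push_lin push_push case_prod_unfold)

section \<open>Families of disjoint subtrees as extractions\<close>

definition member :: "'n addr set \<Rightarrow> 'n addr set \<Rightarrow> 'n addr \<Rightarrow> 'n addr set" where
  "member V L p = {x \<in> V. top_of L x = p}"

lemma top_of_step: "x \<in> L \<Longrightarrow> x \<noteq> [] \<Longrightarrow> top_of L x = top_of L (butlast x)"
  by (subst top_of.simps) simp

lemma top_of_fix [simp]: "x \<notin> L \<Longrightarrow> top_of L x = x"
  by (subst top_of.simps) simp

lemma top_of_notin: "[] \<notin> L \<Longrightarrow> top_of L x \<notin> L"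
  by (induction L x rule: top_of.induct) (subst top_of.simps, auto)

lemma length_top_of_less: "top_of L x \<noteq> x \<Longrightarrow> length (top_of L x) < length x"
  by (subst top_of.simps, subst (asm) top_of.simps)
    (auto split: if_splits intro: le_less_trans[OF length_top_of])

lemma top_of_closed:
  assumes "\<And>q. q \<in> L \<Longrightarrow> q \<noteq> [] \<Longrightarrow> q \<in> S \<Longrightarrow> butlast q \<in> S" "x \<in> S"
  shows "top_of L x \<in> S"
  using assms
proof (induction L x rule: top_of.induct)
  case (1 L p)
  then show ?case by (subst top_of.simps) auto
qed

lemma arg_min_unique:
  fixes f :: "'a \<Rightarrow> nat"
  assumes "P x" "\<And>y. P y \<Longrightarrow> y \<noteq> x \<Longrightarrow> f x < f y"
  shows "arg_min f P = x"
proof (rule ccontr)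
  assume "arg_min f P \<noteq> x"
  moreover have "P (arg_min f P)" "f (arg_min f P) \<le> f x"
    using arg_min_nat_lemma[of P x f] assms(1) by auto
  ultimately show False using assms(2)[of "arg_min f P"] by simp
qed

context
  fixes \<tau> :: "'l tree" and V L :: "'l tree addr set"
  assumes VL: "(V, L) \<in> extractions \<tau>"
begin

lemma extraction_props:
  shows "V \<subseteq> verts kids \<tau>" "L \<subseteq> V" "[] \<notin> L" "\<And>q. q \<in> L \<Longrightarrow> butlast q \<in> V" "finite V" "finite L"
    "(V, L) \<in> joinings \<tau>"
proof -
  show "V \<subseteq> verts kids \<tau>" "L \<subseteq> V" "[] \<notin> L" "\<And>q. q \<in> L \<Longrightarrow> butlast q \<in> V" "(V, L) \<in> joinings \<tau>"
    using VL by (auto simp: extractions_def joinings_def)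
  then show "finite V" "finite L"
    by (auto intro: finite_subset[OF _ finite_verts])
qed

lemma top_of_in: "x \<in> V \<Longrightarrow> top_of L x \<in> V - L"
  using top_of_closed[of L V x] extraction_props(4) top_of_notin[OF extraction_props(3)] by auto

lemma member_self: "p \<in> V - L \<Longrightarrow> p \<in> member V L p"
  by (simp add: member_def)

text \<open>Recovers \<open>L\<close> from the partition into members. For the converse, a top
  shared with the parent is strictly shorter than \<open>q\<close>, so \<open>q\<close> is not its
  own top.\<close>

lemma joined_iff:
  assumes "q \<in> V" "q \<noteq> []"
  shows "q \<in> L \<longleftrightarrow> (\<exists>p\<in>V - L. q \<in> member V L p \<and> butlast q \<in> member V L p)"
proof
  assume "q \<in> L"
  then show "\<exists>p\<in>V - L. q \<in> member V L p \<and> butlast q \<in> member V L p"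
    using assms extraction_props(4)[of q] top_of_in[of q] top_of_step[of q L]
    by (intro bexI[of _ "top_of L q"]) (auto simp: member_def)
next
  assume "\<exists>p\<in>V - L. q \<in> member V L p \<and> butlast q \<in> member V L p"
  then have "top_of L (butlast q) = top_of L q" by (auto simp: member_def)
  then have "length (top_of L q) < length q"
    using length_top_of[of L "butlast q"] assms by (cases q rule: rev_cases) auto
  then show "q \<in> L" by (cases "q \<in> L") auto
qed

text \<open>Within a member every edge of the tree is joined, so reading off its vertex set gives
  the same as following the joined edges.\<close>

lemma member_children:
  assumes "x \<in> member V L p"
  shows "{q \<in> member V L p. is_child x q} = {q \<in> L. is_child x q}"
proof -
  have "q \<in> member V L p \<longleftrightarrow> q \<in> L" if "is_child x q" for q
  proof -
    have q: "q \<noteq> []" "butlast q = x" using that by (auto simp: is_child_def)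
    have "p \<in> V - L" using assms top_of_in by (auto simp: member_def)
    then show ?thesis
      using joined_iff[of q] q assms extraction_props(2) top_of_step[of q L] by (auto simp: member_def)
  qed
  then show ?thesis by auto
qed

lemma length_member: "x \<in> member V L p \<Longrightarrow> x \<noteq> p \<Longrightarrow> length p < length x"
  using length_top_of_less[of L x] by (auto simp: member_def)

lemma connected_member:
  "connected_verts (member V L p)"
proof -
  let ?R = "{(a, b). a \<in> member V L p \<and> b \<in> member V L p \<and> (is_child a b \<or> is_child b a)}"
  have sym: "sym (?R\<^sup>*)"
    by (rule sym_rtrancl) (auto simp: sym_def)
  have to_top: "(x, p) \<in> ?R\<^sup>*" if "x \<in> member V L p" for x
    using that
  proof (induction "length x" arbitrary: x rule: less_induct)
    case less
    show ?case
    proof (cases "x = p")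
      case False
      then have x: "x \<in> L" using less.prems top_of_fix[of x L] by (cases "x \<in> L") (auto simp: member_def)
      then have x: "x \<in> L" "x \<noteq> []" using extraction_props(3) by auto
      then have "butlast x \<in> member V L p"
        using less.prems extraction_props(4)[of x] top_of_step[of x L] by (auto simp: member_def)
      moreover from this have "(x, butlast x) \<in> ?R"
        using x less.prems by (auto simp: is_child_def)
      ultimately show ?thesis
        using less.hyps[of "butlast x"] x by (auto intro: converse_rtrancl_into_rtrancl)
    qed simp
  qed
  then show ?thesis
    unfolding connected_verts_def using symD[OF sym] by (meson rtrancl_trans)
qed

lemma subtree_tree_member:
  assumes "p \<in> V - L"
  shows "subtree_tree \<tau> (member V L p) = piece \<tau> L p"
proof -
  let ?S = "member V L p"
  let ?ch = "\<lambda>x. {q \<in> ?S. is_child x q}"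
  have root: "(ARG_MIN length x. x \<in> ?S) = p"
    by (rule arg_min_unique) (use member_self[OF assms] length_member in auto)
  have S: "?S \<subseteq> V" by (auto simp: member_def)
  then have fin: "finite ?S" using extraction_props(5) finite_subset by blast
  have card: "card ?S \<le> card (verts kids \<tau>)"
    using S extraction_props(1) by (intro card_mono) auto
  have "subtree_tree \<tau> ?S = grow Node (\<lambda>p. root_label (sub \<tau> p)) ?ch (card ?S) p"
    by (simp add: subtree_tree_def root)
  \<comment> \<open>The depth on the left is \<open>card ?S\<close>, so the measure has to be
    bounded in terms of the member; counting the deeper vertices inside it achieves this.\<close>
  also have "\<dots> = grow Node (\<lambda>p. root_label (sub \<tau> p)) ?ch (card (verts kids \<tau>)) p"
  proof (rule grow_stable[where R = ?S and \<mu> = "\<lambda>x. card {q \<in> ?S. length x < length q}"])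
    fix v c assume v: "v \<in> ?S" "c \<in> ?ch v"
    then have c: "c \<in> ?S" "length v < length c" using length_child[of v c] by simp_all
    have "card {q \<in> ?S. length c < length q} < card {q \<in> ?S. length v < length q}"
      by (rule psubset_card_mono) (use c fin in \<open>simp, fastforce\<close>)
    then show "c \<in> ?S \<and> card {q \<in> ?S. length c < length q} < card {q \<in> ?S. length v < length q}"
      using c(1) by simp
  next
    have "card {q \<in> ?S. length p < length q} \<le> card ?S"
      using fin by (intro card_mono) auto
    then show "card {q \<in> ?S. length p < length q} \<le> card ?S"
      "card {q \<in> ?S. length p < length q} \<le> card (verts kids \<tau>)" using card by auto
  qed (fact member_self[OF assms])
  also have "\<dots> = piece \<tau> L p"
    unfolding piece_def
    by (rule sym, rule grow_transfer[where R = ?S and h = "\<lambda>x. x" and g = "\<lambda>x. x"])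
      (use member_self[OF assms] member_children in auto)
  finally show ?thesis .
qed

lemma inj_on_member: "inj_on (member V L) (V - L)"
proof (rule inj_onI)
  fix p q assume pq: "p \<in> V - L" "q \<in> V - L" "member V L p = member V L q"
  then have "p \<in> member V L q" using member_self[of p] by simp
  then show "p = q" using pq by (simp add: member_def)
qed

lemma member_subtree: "p \<in> V - L \<Longrightarrow> member V L p \<in> subtrees \<tau>"
  using extraction_props(1) connected_member member_self by (auto simp: subtrees_def member_def)

lemma Union_members: "\<Union>(member V L ` (V - L)) = V"
  using top_of_in by (auto simp: member_def)

lemma disjoint_members: "pairwise disjnt (member V L ` (V - L))"
  by (auto simp: pairwise_def disjnt_def member_def)

end

text \<open>The map \<open>h\<close> matches the tops with the classes used by
  \<open>contract_tree\<close>, and \<open>x\<close> lies in the class of \<open>p\<close> exactly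
  if \<open>p\<close> is its top. The lower end of an edge between different classes is a top,
  because a joined vertex has the same top as its parent.\<close>

lemma contract_tree_members:
  fixes \<tau> :: "'d rtree"
  assumes VL: "(V, L) \<in> extractions \<tau>"
  shows "contract_tree \<tau> (member V L ` (V - L)) = contracted \<tau> V L []"
proof -
  note props = extraction_props[OF VL]
  let ?C = "member V L ` (V - L)"
  let ?T = "verts kids \<tau> - L"
  define Q where "Q = ?C \<union> {{p} | p. p \<in> verts kids \<tau> - V}"
  define h where "h = (\<lambda>p. if p \<in> V then member V L p else {p})"
  have h_self: "p \<in> h p" if "p \<in> ?T" for p
    using that member_self[OF VL, of p] by (auto simp: h_def)
  have Q: "Q = h ` ?T"
    using props(1,2) by (auto simp: Q_def h_def image_iff)
  have top: "top_of L x \<in> ?T" if "x \<in> verts kids \<tau>" for x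
  proof (cases "x \<in> V")
    case False
    moreover from False have "x \<notin> L" using props(2) by auto
    ultimately show ?thesis using that by simp
  qed (use top_of_in[OF VL, of x] props(1) in auto)
  have mem: "x \<in> h p \<longleftrightarrow> p = top_of L x" if "x \<in> verts kids \<tau>" "p \<in> ?T" for x p
  proof (cases "x \<in> V")
    case True
    then show ?thesis using that top_of_in[OF VL True] by (auto simp: h_def member_def)
  next
    case False
    moreover from False have "x \<notin> L" using props(2) by auto
    ultimately show ?thesis by (auto simp: h_def member_def)
  qed
  have hsub: "h p \<subseteq> verts kids \<tau>" if "p \<in> ?T" for p
    using that props(1) by (auto simp: h_def member_def)
  have inj: "p = q" if "h p = h q" "p \<in> ?T" "q \<in> ?T" for p q
  proof -
    have "p \<in> h q" using h_self[OF that(2)] that(1) by simp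
    then have "q = top_of L p" using mem[of p q] that(2,3) by blast
    then show ?thesis using that(2) by simp
  qed
  have top_T: "top_of L p = p" if "p \<in> ?T" for p
    using that by simp
  have root: "(THE c. c \<in> Q \<and> [] \<in> c) = h []"
  proof (rule the_equality)
    have "[] \<in> ?T" using props(3) by simp
    then show "h [] \<in> Q \<and> [] \<in> h []" using h_self Q by blast
    show "c = h []" if "c \<in> Q \<and> [] \<in> c" for c
      using that mem[of "[]"] by (auto simp: Q)
  qed
  have inC: "h p \<in> ?C \<longleftrightarrow> p \<in> V" if "p \<in> ?T" for p
  proof
    assume "h p \<in> ?C"
    then obtain u where u: "u \<in> V - L" "h p = member V L u" by blast
    then have "h p = h u" "u \<in> ?T" using props(1) by (auto simp: h_def)
    then show "p \<in> V" using inj that u(1) by blast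
  qed (use that in \<open>simp add: h_def\<close>)
  have ch: "{c' \<in> Q. c' \<noteq> h v \<and> (\<exists>p\<in>h v. \<exists>q\<in>c'. is_child p q)} =
      h ` {q \<in> ?T. q \<noteq> [] \<and> top_of L (butlast q) = v}" (is "?A = ?B") if v: "v \<in> ?T" for v
  proof
    show "?A \<subseteq> ?B"
    proof
      fix c assume "c \<in> ?A"
      then obtain u p q where c: "c = h u" "u \<in> ?T" "h u \<noteq> h v" "p \<in> h v" "q \<in> h u" "is_child p q"
        by (auto simp: Q)
      have pq: "q \<noteq> []" "butlast q = p" using c(6) by (auto simp: is_child_def)
      have vs: "p \<in> verts kids \<tau>" "q \<in> verts kids \<tau>" using c(2,4,5) v hsub by blast+
      have "u = top_of L q" "v = top_of L p" using mem vs c v by blast+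
      moreover have "q \<notin> L" using top_of_step[of q L] pq calculation c(3) by auto
      ultimately show "c \<in> ?B" using c pq vs by auto
    qed
    show "?B \<subseteq> ?A"
    proof
      fix c assume "c \<in> ?B"
      then obtain q where q: "c = h q" "q \<in> ?T" "q \<noteq> []" "top_of L (butlast q) = v" by auto
      have "butlast q \<in> h v" using mem[of "butlast q" v] q v verts_butlast[of q kids \<tau>] by auto
      moreover have "length v < length q"
        using length_top_of[of L "butlast q"] q(3,4) by (cases q rule: rev_cases) simp_all
      then have "q \<noteq> v" by auto
      then have "h q \<noteq> h v" using inj q v by blast
      moreover have "is_child (butlast q) q" using q by (simp add: is_child_def)
      ultimately show "c \<in> ?A" using h_self[OF q(2)] q Q by auto
    qed
  qed
  have "contract_tree \<tau> ?C = grow Node (\<lambda>c. if c \<in> ?C then None else root_label (sub \<tau> (the_elem c)))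
        (\<lambda>c. {c' \<in> Q. c' \<noteq> c \<and> (\<exists>p\<in>c. \<exists>q\<in>c'. is_child p q)}) (card (verts kids \<tau>)) (h [])"
    unfolding contract_tree_def Let_def Union_members[OF VL] Q_def[symmetric] root ..
  also have "\<dots> = contracted \<tau> V L []"
    unfolding contracted_def
  proof (rule grow_transfer[where R = ?T and g = "\<lambda>x. x"])
    fix v M assume v: "v \<in> ?T"
    show "inj_on h {q \<in> ?T. q \<noteq> [] \<and> top_of L (butlast q) = v}"
      using inj by (auto simp: inj_on_def)
    show "Node (if h v \<in> ?C then None else root_label (sub \<tau> (the_elem (h v)))) (image_mset (\<lambda>x. x) M) =
        Node (if v \<in> V then None else root_label (sub \<tau> v)) M"
      using inC[OF v] by (simp add: h_def)
  qed (use ch props(3) in auto)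
  finally show ?thesis .
qed

lemma disjoint_family_unique: "pairwise disjnt C \<Longrightarrow> S \<in> C \<Longrightarrow> S' \<in> C \<Longrightarrow> x \<in> S \<Longrightarrow> x \<in> S' \<Longrightarrow> S = S'"
  by (auto simp: pairwise_def disjnt_def)

text \<open>Disjointness keeps each climb inside the set where it starts, and connectedness gives
  all vertices of a set the same top, so that the members are exactly the sets of the
  family.\<close>

lemma members_of_family:
  fixes \<tau> :: "'l tree"
  assumes C: "C \<subseteq> subtrees \<tau>" "pairwise disjnt C"
    and V: "V = \<Union>C" and L: "L = {q \<in> V. q \<noteq> [] \<and> (\<exists>S\<in>C. q \<in> S \<and> butlast q \<in> S)}"
  shows "(V, L) \<in> extractions \<tau>" "member V L ` (V - L) = C"
proof -
  show ex: "(V, L) \<in> extractions \<tau>"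
    using C(1) V L by (auto simp: extractions_def joinings_def subtrees_def)
  note uniq = disjoint_family_unique[OF C(2)]
  have closed: "top_of L x \<in> S" if "S \<in> C" "x \<in> S" for x S
  proof (rule top_of_closed)
    show "butlast q \<in> S" if "q \<in> L" "q \<in> S" for q
      using that uniq[OF \<open>S \<in> C\<close>] L by blast
  qed (fact that)
  have same: "top_of L x = top_of L y" if "S \<in> C" "x \<in> S" "y \<in> S" for x y S
  proof -
    have adj: "top_of L a = top_of L b" if "a \<in> S" "b \<in> S" "is_child a b" for a b
    proof -
      have b: "b \<noteq> []" "butlast b = a" using that(3) by (auto simp: is_child_def)
      then have "b \<in> L" using that \<open>S \<in> C\<close> unfolding L V by blast
      then show ?thesis using top_of_step[of b L] b by simp
    qed
    have "(x, y) \<in> {(a, b). a \<in> S \<and> b \<in> S \<and> (is_child a b \<or> is_child b a)}\<^sup>*"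
      using C(1) that by (auto simp: subtrees_def connected_verts_def)
    then show ?thesis
      by (induction rule: rtrancl_induct) (use adj in force)+
  qed
  have eq: "member V L (top_of L x) = S" if "S \<in> C" "x \<in> S" for x S
  proof -
    have "y \<in> S" if y: "y \<in> V" "top_of L y = top_of L x" for y
    proof -
      obtain S' where S': "S' \<in> C" "y \<in> S'" using y V by blast
      then have "S = S'"
        using closed[OF S'] closed[OF \<open>S \<in> C\<close> \<open>x \<in> S\<close>] uniq[OF \<open>S \<in> C\<close> S'(1)] y(2) by simp
      then show ?thesis using S'(2) by simp
    qed
    then have "member V L (top_of L x) \<subseteq> S" by (auto simp: member_def)
    moreover have "S \<subseteq> member V L (top_of L x)"
      using same[OF that(1) _ that(2)] that(1) V unfolding member_def by blast
    ultimately show ?thesis by blast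
  qed
  show "member V L ` (V - L) = C"
  proof
    show "member V L ` (V - L) \<subseteq> C"
    proof
      fix S assume "S \<in> member V L ` (V - L)"
      then obtain p where p: "p \<in> V - L" "S = member V L p" by auto
      then obtain S' where "S' \<in> C" "p \<in> S'" using V by auto
      then show "S \<in> C" using eq[of S' p] p by simp
    qed
    show "C \<subseteq> member V L ` (V - L)"
    proof
      fix S assume S: "S \<in> C"
      then obtain x where x: "x \<in> S" using C(1) by (auto simp: subtrees_def)
      then have "top_of L x \<in> V - L" using top_of_in[OF ex, of x] S V by auto
      then show "S \<in> member V L ` (V - L)" using eq[OF S x] by blast
    qed
  qed
qed

theorem delta_extractions:
  "delta \<tau> = (\<Sum>(V, L)\<in>extractions \<tau>.
     vec (image_mset (piece \<tau> L) (mset_set (V - L)), contracted \<tau> V L []))"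
  unfolding delta_def
proof (rule sum.reindex_bij_witness[where i = "\<lambda>(V, L). member V L ` (V - L)" and
    j = "\<lambda>C. (\<Union>C, {q \<in> \<Union>C. q \<noteq> [] \<and> (\<exists>S\<in>C. q \<in> S \<and> butlast q \<in> S)})"])
  fix C assume "C \<in> {C. C \<subseteq> subtrees \<tau> \<and> pairwise disjnt C}"
  then have C: "C \<subseteq> subtrees \<tau>" "pairwise disjnt C" by auto
  define V L where V: "V = \<Union>C" and L: "L = {q \<in> V. q \<noteq> [] \<and> (\<exists>S\<in>C. q \<in> S \<and> butlast q \<in> S)}"
  note * = members_of_family[OF C V L]
  note fold = V[symmetric] L[symmetric]
  show "(case (\<Union>C, {q \<in> \<Union>C. q \<noteq> [] \<and> (\<exists>S\<in>C. q \<in> S \<and> butlast q \<in> S)}) of (V, L) \<Rightarrow> member V L ` (V - L)) = C"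
    unfolding fold using *(2) by simp
  show "(\<Union>C, {q \<in> \<Union>C. q \<noteq> [] \<and> (\<exists>S\<in>C. q \<in> S \<and> butlast q \<in> S)}) \<in> extractions \<tau>"
    unfolding fold using *(1) by simp
  have "image_mset (subtree_tree \<tau>) (mset_set (member V L ` (V - L))) =
      image_mset (piece \<tau> L) (mset_set (V - L))"
    using extraction_props(5)[OF *(1)]
    by (auto simp: image_mset_mset_set[OF inj_on_member[OF *(1)], symmetric] multiset.map_comp
        intro!: image_mset_cong subtree_tree_member[OF *(1)])
  then show "(case (\<Union>C, {q \<in> \<Union>C. q \<noteq> [] \<and> (\<exists>S\<in>C. q \<in> S \<and> butlast q \<in> S)}) of (V, L) \<Rightarrow>
      vec (image_mset (piece \<tau> L) (mset_set (V - L)), contracted \<tau> V L [])) =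
    vec (image_mset (subtree_tree \<tau>) (mset_set C), contract_tree \<tau> C)"
    unfolding fold using *(2) contract_tree_members[OF *(1)] by simp
next
  fix c assume c: "c \<in> extractions \<tau>"
  obtain V L where VL: "c = (V, L)" by fastforce
  have ex: "(V, L) \<in> extractions \<tau>" using c VL by simp
  have "{q \<in> V. q \<noteq> [] \<and> (\<exists>S\<in>member V L ` (V - L). q \<in> S \<and> butlast q \<in> S)} = L"
    using joined_iff[OF ex] extraction_props[OF ex] by auto
  then show "(\<Union>(case c of (V, L) \<Rightarrow> member V L ` (V - L)),
      {q \<in> \<Union>(case c of (V, L) \<Rightarrow> member V L ` (V - L)). q \<noteq> [] \<and>
        (\<exists>S\<in>(case c of (V, L) \<Rightarrow> member V L ` (V - L)). q \<in> S \<and> butlast q \<in> S)}) = c"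
    unfolding VL by (simp add: Union_members[OF ex])
  show "(case c of (V, L) \<Rightarrow> member V L ` (V - L)) \<in> {C. C \<subseteq> subtrees \<tau> \<and> pairwise disjnt C}"
    unfolding VL using member_subtree[OF ex] disjoint_members[OF ex] by auto
qed

corollary extraction_sum_delta: "extraction_sum \<tau> = push (\<lambda>(F, t). (F, {#t#})) (delta \<tau>)"
  by (simp add: extraction_sum_def delta_extractions push_sum case_prod_unfold)

section \<open>Symbols as trees\<close>

primrec psi :: "'d symb \<Rightarrow> 'd rtree" where
  "psi (Symb i ss) = Node i (image_mset psi ss)"

lemma psi_phi [simp]: "psi (phi \<tau>) = \<tau>"
  by (induction \<tau>) (simp add: multiset.map_comp comp_def cong: multiset.map_cong)

lemma phi_psi [simp]: "phi (psi \<sigma>) = \<sigma>"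
  by (induction \<sigma>) (simp add: multiset.map_comp comp_def cong: multiset.map_cong)

lemma inj_phi: "inj phi"
  by (metis injI psi_phi)

lemma phi_eq_iff [simp]: "phi x = phi y \<longleftrightarrow> x = y"
  by (metis psi_phi)

lemma inv_phi: "inv_into UNIV phi = psi"
  by (metis ext inv_f_f inj_phi phi_psi)

lemma noise_phi [simp]: "noise (phi \<tau>) = root_label \<tau>"
  by (cases \<tau>) simp

lemma factors_phi [simp]: "factors (phi \<tau>) = image_mset phi (kids \<tau>)"
  by (cases \<tau>) simp

lemma count_image_phi [simp]: "count (image_mset phi M) (phi y) = count M y"
  by (induction M) auto

text \<open>The degree of \<I>(phi \<tau>). By the shift it is a sum over the nodes, 1 for the label
  0 and \<alpha> for a noise, and hence additive under cuts.\<close>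

definition weight :: "real \<Rightarrow> 'd rtree \<Rightarrow> real" where
  "weight \<alpha> \<tau> = degree \<alpha> (phi \<tau>) + 1"

lemma weight_Node:
  "weight \<alpha> (Node i ts) = (if i = None then 1 else \<alpha>) + (\<Sum>t\<in>#ts. weight \<alpha> t)"
  by (auto simp: weight_def multiset.map_comp comp_def split: option.splits)

lemma sum_mset_nonneg:
  fixes f :: "'a \<Rightarrow> real"
  shows "(\<And>x. x \<in># M \<Longrightarrow> 0 \<le> f x) \<Longrightarrow> 0 \<le> (\<Sum>x\<in>#M. f x)"
  by (induction M) (auto intro: add_nonneg_nonneg)

lemma weight_nonneg: "0 \<le> \<alpha> \<Longrightarrow> 0 \<le> weight \<alpha> \<tau>"
proof (induction \<tau> rule: tree_induct)
  case (Node i ts)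
  then have "0 \<le> (\<Sum>t\<in>#ts. weight \<alpha> t)"
    by (intro sum_mset_nonneg) auto
  then show ?case using Node by (simp add: weight_Node)
qed

lemma weight_pos: "0 < \<alpha> \<Longrightarrow> 0 < weight \<alpha> \<tau>"
proof (cases \<tau>)
  case (Node i ts)
  assume "0 < \<alpha>"
  moreover from this have "0 \<le> (\<Sum>t\<in>#ts. weight \<alpha> t)"
    by (intro sum_mset_nonneg) (auto intro: weight_nonneg)
  ultimately show ?thesis by (simp add: Node weight_Node)
qed

lemma weight_noise_only: "None \<notin> set_tree \<tau> \<Longrightarrow> weight \<alpha> \<tau> = \<alpha> * num_nodes \<tau>"
proof (induction \<tau> rule: tree_induct)
  case (Node i ts)
  have "(\<Sum>t\<in>#ts. weight \<alpha> t) = (\<Sum>t\<in>#ts. \<alpha> * num_nodes t)"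
    using Node by (intro arg_cong[where f = sum_mset] image_mset_cong) auto
  also have "\<dots> = \<alpha> * (\<Sum>t\<in>#ts. num_nodes t)"
    by (induction ts) (simp_all add: algebra_simps)
  finally show ?case using Node.prems by (auto simp: weight_Node algebra_simps)
qed

lemma sum_mset_member_le:
  fixes f :: "'a \<Rightarrow> real"
  assumes "t \<in># M" "\<And>x. x \<in># M \<Longrightarrow> 0 \<le> f x"
  shows "f t \<le> (\<Sum>x\<in>#M. f x)"
proof -
  obtain N where N: "M = add_mset t N" using assms(1) by (metis multi_member_split)
  then have "0 \<le> (\<Sum>x\<in>#N. f x)" using assms(2) by (intro sum_mset_nonneg) auto
  then show ?thesis by (simp add: N)
qed

text \<open>A single node with label 0 already weighs 1 and all weights are nonnegative; so negative
  degree forces all labels to be noises.\<close>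

lemma weight_ge_1:
  assumes "0 \<le> \<alpha>" "None \<in> set_tree \<tau>"
  shows "1 \<le> weight \<alpha> \<tau>"
  using assms(2)
proof (induction \<tau> rule: tree_induct)
  case (Node i ts)
  show ?case
  proof (cases "i = None")
    case True
    have "0 \<le> (\<Sum>t\<in>#ts. weight \<alpha> t)"
      using assms(1) by (intro sum_mset_nonneg) (auto intro: weight_nonneg)
    then show ?thesis by (simp add: weight_Node True)
  next
    case False
    then obtain t where t: "t \<in># ts" "None \<in> set_tree t" using Node.prems by auto
    then have "1 \<le> (\<Sum>t\<in>#ts. weight \<alpha> t)"
      using Node.IH[OF t] sum_mset_member_le[OF t(1), of "weight \<alpha>"] assms(1) weight_nonneg by force
    then show ?thesis using assms(1) by (simp add: weight_Node False)
  qed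
qed

text \<open>A weight below 1 excludes the label 0, so the weight is \<alpha> times the number of
  nodes, and the bound on the number of nodes follows.\<close>

lemma trees_minus_iff:
  assumes "0 < \<alpha>"
  shows "\<tau> \<in> trees_minus \<alpha> \<longleftrightarrow> weight \<alpha> \<tau> < 1"
proof
  assume "weight \<alpha> \<tau> < 1"
  then have none: "None \<notin> set_tree \<tau>"
    using weight_ge_1[of \<alpha> \<tau>] assms by auto
  then have "\<alpha> * num_nodes \<tau> < 1"
    using \<open>weight \<alpha> \<tau> < 1\<close> by (simp add: weight_noise_only)
  then have "real (num_nodes \<tau>) \<le> 1 / \<alpha>"
    using assms by (simp add: field_simps)
  then have "int (num_nodes \<tau>) \<le> \<lfloor>1 / \<alpha>\<rfloor>"
    by (simp add: le_floor_iff)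
  then show "\<tau> \<in> trees_minus \<alpha>"
    using none \<open>weight \<alpha> \<tau> < 1\<close> by (simp add: trees_minus_def weight_def)
qed (simp add: trees_minus_def weight_def)

lemma trees_minus_None: "\<tau> \<in> trees_minus \<alpha> \<Longrightarrow> None \<notin> set_tree \<tau>"
  by (simp add: trees_minus_def)

lemma phi_W_minus: "0 < \<alpha> \<Longrightarrow> phi \<tau> \<in> W_minus \<alpha> \<longleftrightarrow> \<tau> \<in> trees_minus \<alpha>"
  by (simp add: trees_minus_iff W_minus_def weight_def)

section \<open>Addresses and edges of symbols in terms of trees\<close>

definition phi_addr :: "'d rtree addr \<Rightarrow> 'd symb addr" where
  "phi_addr = map (map_prod phi id)"

definition psi_addr :: "'d symb addr \<Rightarrow> 'd rtree addr" where
  "psi_addr = map (map_prod psi id)"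

lemma psi_phi_addr [simp]: "psi_addr (phi_addr p) = p"
  by (simp add: phi_addr_def psi_addr_def comp_def map_prod_def case_prod_unfold)

lemma phi_psi_addr [simp]: "phi_addr (psi_addr p) = p"
  by (simp add: phi_addr_def psi_addr_def comp_def map_prod_def case_prod_unfold)

lemma phi_addr_eq_iff [simp]: "phi_addr p = phi_addr q \<longleftrightarrow> p = q"
  by (metis psi_phi_addr)

lemma inj_phi_addr: "inj_on phi_addr S"
  by (simp add: inj_on_def)

lemma phi_addr_Nil [simp]: "phi_addr p = [] \<longleftrightarrow> p = []" "phi_addr [] = []"
  by (simp_all add: phi_addr_def)

lemma length_phi_addr [simp]: "length (phi_addr p) = length p"
  by (simp add: phi_addr_def)

lemma butlast_phi_addr: "butlast (phi_addr p) = phi_addr (butlast p)"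
  by (simp add: phi_addr_def map_butlast)

lemma sub_phi [simp]: "sub (phi \<tau>) (phi_addr p) = phi (sub \<tau> p)"
  by (simp add: sub_def phi_addr_def last_map)

lemma is_child_phi_addr [simp]: "is_child (phi_addr p) (phi_addr q) \<longleftrightarrow> is_child p q"
  by (simp add: is_child_def butlast_phi_addr)

lemma phi_addr_verts [simp]: "phi_addr p \<in> verts factors (phi \<tau>) \<longleftrightarrow> p \<in> verts kids \<tau>"
proof (induction p arbitrary: \<tau>)
  case (Cons e p)
  have "phi_addr (e # p) = (phi (fst e), snd e) # phi_addr p"
    by (cases e) (simp add: phi_addr_def)
  then show ?case using Cons by simp
qed simp

lemma verts_phi: "verts factors (phi \<tau>) = phi_addr ` verts kids \<tau>"
proof
  show "verts factors (phi \<tau>) \<subseteq> phi_addr ` verts kids \<tau>"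
  proof
    fix q assume "q \<in> verts factors (phi \<tau>)"
    then have "psi_addr q \<in> verts kids \<tau>" using phi_addr_verts[of "psi_addr q" \<tau>] by simp
    then show "q \<in> phi_addr ` verts kids \<tau>" by (rule rev_image_eqI) simp
  qed
qed auto

definition labelled :: "'d rtree \<Rightarrow> 'd rtree addr set" where
  "labelled \<tau> = {p \<in> verts kids \<tau>. root_label (sub \<tau> p) \<noteq> None}"

lemma symb_edges_iff [simp]:
  "I_edge (phi_addr q) \<in> symb_edges (phi \<tau>) \<longleftrightarrow> q \<in> verts kids \<tau> \<and> q \<noteq> []"
  "Xi_edge (phi_addr x) \<in> symb_edges (phi \<tau>) \<longleftrightarrow> x \<in> labelled \<tau>"
  by (auto simp: symb_edges_def labelled_def)

lemma gedge_cases: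
  obtains x where "e = Xi_edge (phi_addr x)" | q where "e = I_edge (phi_addr q)"
  by (cases e) (metis phi_psi_addr)+

lemma all_phi_addr: "(\<And>p. P (phi_addr p)) \<Longrightarrow> P q"
  by (metis phi_psi_addr)

section \<open>Components of subgraphs of a symbol, and their contraction\<close>

text \<open>A component of a subgraph may contain a vertex but not the edge of its noise, and its
  symbol then has no noise there. The labels of a piece are therefore left free.\<close>

definition piece_lab :: "('l tree addr \<Rightarrow> 'l) \<Rightarrow> 'l tree \<Rightarrow> 'l tree addr set \<Rightarrow> 'l tree addr \<Rightarrow> 'l tree" where
  "piece_lab lab \<tau> L = grow Node lab (\<lambda>p. {q \<in> L. is_child p q}) (card (verts kids \<tau>))"

lemma piece_lab_unfold:
  assumes "L \<subseteq> verts kids \<tau>" "p \<in> verts kids \<tau>"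
  shows "piece_lab lab \<tau> L p = Node (lab p) (image_mset (piece_lab lab \<tau> L) (mset_set {q \<in> L. is_child p q}))"
  unfolding piece_lab_def
proof (rule grow_unfold[where R = "verts kids \<tau>" and \<mu> = "\<lambda>p. card (verts kids \<tau>) - length p"])
  fix v c assume "v \<in> verts kids \<tau>" "c \<in> {q \<in> L. is_child v q}"
  then show "c \<in> verts kids \<tau> \<and> card (verts kids \<tau>) - length c < card (verts kids \<tau>) - length v"
    using length_verts_less[of c \<tau>] length_child[of v c] assms by auto
qed (use assms in auto)

text \<open>Climbing from \<open>x\<close> only enlarges the tree that is read off, so the label at
  \<open>x\<close> survives to the top. This makes a single missing noise visible in the
  component.\<close>

lemma piece_lab_label:
  assumes VL: "(V, L) \<in> extractions \<tau>" and x: "x \<in> V"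
  shows "lab x \<in> set_tree (piece_lab lab \<tau> L (top_of L x))"
proof -
  note props = extraction_props[OF VL]
  have L: "L \<subseteq> verts kids \<tau>" using props(1,2) by auto
  have "set_tree (piece_lab lab \<tau> L x) \<subseteq> set_tree (piece_lab lab \<tau> L (top_of L x))" if "x \<in> V" for x
    using that
  proof (induction "length x" arbitrary: x rule: less_induct)
    case less
    show ?case
    proof (cases "x \<in> L")
      case True
      then have x: "x \<noteq> []" "butlast x \<in> V" using props by auto
      have "finite {q \<in> L. is_child (butlast x) q}" using props(6) by simp
      then have "x \<in># mset_set {q \<in> L. is_child (butlast x) q}"
        using True x by (auto simp: is_child_def)
      then have "set_tree (piece_lab lab \<tau> L x) \<subseteq> set_tree (piece_lab lab \<tau> L (butlast x))"
        using x props(1) by (subst (2) piece_lab_unfold[OF L]) auto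
      also have "\<dots> \<subseteq> set_tree (piece_lab lab \<tau> L (top_of L (butlast x)))"
        using x by (intro less.hyps) auto
      finally show ?thesis using top_of_step[OF True x(1)] by simp
    qed simp
  qed
  moreover have "lab x \<in> set_tree (piece_lab lab \<tau> L x)"
    using x props(1) by (subst piece_lab_unfold[OF L]) auto
  ultimately show ?thesis using x by blast
qed

lemma piece_lab_cong:
  assumes VL: "(V, L) \<in> extractions \<tau>" and "p \<in> V - L" "\<And>x. x \<in> member V L p \<Longrightarrow> lab x = lab' x"
  shows "piece_lab lab \<tau> L p = piece_lab lab' \<tau> L p"
  unfolding piece_lab_def
  by (rule grow_transfer[where R = "member V L p" and h = "\<lambda>x. x" and g = "\<lambda>x. x"])
    (use member_self[OF VL assms(2)] member_children[OF VL, symmetric] assms(3) in auto)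

lemma piece_piece_lab: "piece \<tau> = piece_lab (\<lambda>p. root_label (sub \<tau> p)) \<tau>"
  by (simp add: piece_def piece_lab_def fun_eq_iff)

definition edge_set :: "'d rtree addr set \<Rightarrow> 'd rtree addr set \<Rightarrow> 'd gedge set" where
  "edge_set X L = Xi_edge ` phi_addr ` X \<union> I_edge ` phi_addr ` L"

lemma edge_set_iff [simp]:
  "Xi_edge (phi_addr x) \<in> edge_set X L \<longleftrightarrow> x \<in> X" "I_edge (phi_addr q) \<in> edge_set X L \<longleftrightarrow> q \<in> L"
  by (auto simp: edge_set_def)

fun edge_pos :: "'d gedge \<Rightarrow> 'd rtree addr" where
  "edge_pos (I_edge q) = psi_addr q"
| "edge_pos (Xi_edge q) = psi_addr q"

fun vert_pos :: "'d gvert \<Rightarrow> 'd rtree addr" where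
  "vert_pos (Inner q) = psi_addr q"
| "vert_pos (Leaf q) = psi_addr q"

lemma edge_set_cases:
  assumes "e \<in> edge_set X L"
  obtains x where "e = Xi_edge (phi_addr x)" "x \<in> X" | q where "e = I_edge (phi_addr q)" "q \<in> L"
  using assms by (auto simp: edge_set_def)

context
  fixes \<tau> :: "'d rtree" and X L V :: "'d rtree addr set"
  assumes X: "X \<subseteq> verts kids \<tau>" and L: "L \<subseteq> verts kids \<tau> - {[]}" and V: "V = X \<union> L \<union> butlast ` L"
begin

text \<open>\<open>V\<close> collects the inner vertices touched by an edge. A subgraph without
  isolated vertices thus gives an extraction, in which the set \<open>X\<close> of the vertices with
  their noise edge may be smaller than \<open>V\<close>.\<close>

lemma edge_extraction: "(V, L) \<in> extractions \<tau>"
  using X L verts_butlast[of _ kids \<tau>] by (auto simp: extractions_def joinings_def V)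

definition "component_at p = {e \<in> edge_set X L. top_of L (edge_pos e) = p}"

lemma component_at_iff [simp]:
  "Xi_edge (phi_addr x) \<in> component_at p \<longleftrightarrow> x \<in> X \<and> top_of L x = p"
  "I_edge (phi_addr q) \<in> component_at p \<longleftrightarrow> q \<in> L \<and> top_of L q = p"
  by (auto simp: component_at_def)

lemma top_of_butlast: "q \<in> L \<Longrightarrow> top_of L (butlast q) = top_of L q"
proof -
  assume q: "q \<in> L"
  then have "q \<noteq> []" using L by blast
  then show ?thesis using top_of_step[OF q] by simp
qed

lemma top_of_vert_pos: "e \<in> edge_set X L \<Longrightarrow> v \<in> ends e \<Longrightarrow> top_of L (vert_pos v) = top_of L (edge_pos e)"
  by (erule edge_set_cases) (auto simp: butlast_phi_addr top_of_butlast)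

lemma ends_Inner: "e \<in> edge_set X L \<Longrightarrow> Inner (phi_addr x) \<in> ends e \<Longrightarrow> x \<in> V \<and> top_of L (edge_pos e) = top_of L x"
  by (erule edge_set_cases) (auto simp: butlast_phi_addr top_of_butlast V)

lemma incident_edge: "x \<in> V \<Longrightarrow> \<exists>e\<in>edge_set X L. Inner (phi_addr x) \<in> ends e"
  unfolding V
proof (elim UnE imageE)
  show "x \<in> X \<Longrightarrow> ?thesis" by (rule bexI[of _ "Xi_edge (phi_addr x)"]) auto
  show "x \<in> L \<Longrightarrow> ?thesis" by (rule bexI[of _ "I_edge (phi_addr x)"]) auto
  show "x = butlast q \<Longrightarrow> q \<in> L \<Longrightarrow> ?thesis" for q
    by (rule bexI[of _ "I_edge (phi_addr q)"]) (auto simp: butlast_phi_addr)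
qed

lemma edge_pos_incident: "e \<in> edge_set X L \<Longrightarrow> edge_pos e \<in> V \<and> Inner (phi_addr (edge_pos e)) \<in> ends e"
  by (erule edge_set_cases) (auto simp: V)

text \<open>Edges that share an end have the same top, so a component lies over one top. Conversely,
  each edge is linked to any given edge at its top through the inner edges of the climb.\<close>

lemma components_edge_set: "components (edge_set X L) = component_at ` (V - L)"
proof -
  let ?A = "edge_set X L"
  define r where "r = {(e, f). e \<in> ?A \<and> f \<in> ?A \<and> ends e \<inter> ends f \<noteq> {}}"
  have sym: "sym (r\<^sup>*)"
    by (rule sym_rtrancl) (auto simp: sym_def r_def)
  have same: "f \<in> ?A \<and> top_of L (edge_pos e) = top_of L (edge_pos f)" if "(e, f) \<in> r\<^sup>*" "e \<in> ?A" for e f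
    using that(1)
  proof (induction rule: rtrancl_induct)
    case (step f g)
    then obtain v where "f \<in> ?A" "g \<in> ?A" "v \<in> ends f" "v \<in> ends g" by (auto simp: r_def)
    then show ?case using step.IH top_of_vert_pos by metis
  qed (use that in simp)
  have meet: "(e, f) \<in> r" if "e \<in> ?A" "f \<in> ?A" "v \<in> ends e" "v \<in> ends f" for e f v
    using that by (auto simp: r_def)
  have to_top: "(e, f) \<in> r\<^sup>*"
    if "x \<in> V" "e \<in> ?A" "Inner (phi_addr x) \<in> ends e" "f \<in> ?A" "Inner (phi_addr (top_of L x)) \<in> ends f" for x e f
    using that(1-3,5)
  proof (induction "length x" arbitrary: x e rule: less_induct)
    case less
    show ?case
    proof (cases "x \<in> L")
      case True
      then have x: "x \<noteq> []" "butlast x \<in> V" using L by (auto simp: V)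
      let ?g = "I_edge (phi_addr x)"
      have "(e, ?g) \<in> r" by (rule meet[of _ _ "Inner (phi_addr x)"]) (use less.prems True in simp_all)
      moreover have "(?g, f) \<in> r\<^sup>*"
        by (rule less.hyps[of "butlast x"])
          (use x True less.prems in \<open>simp_all add: butlast_phi_addr top_of_butlast\<close>)
      ultimately show ?thesis by (rule converse_rtrancl_into_rtrancl)
    next
      case False
      then have "Inner (phi_addr x) \<in> ends f" using less.prems(4) by simp
      then have "(e, f) \<in> r" by (rule meet[OF less.prems(2) that(4) less.prems(3)])
      then show ?thesis by (rule r_into_rtrancl)
    qed
  qed
  have cls: "r\<^sup>* `` {e} = component_at (top_of L (edge_pos e))" if e: "e \<in> ?A" for e
  proof
    show "r\<^sup>* `` {e} \<subseteq> component_at (top_of L (edge_pos e))"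
      using same[OF _ e] by (auto simp: component_at_def)
    show "component_at (top_of L (edge_pos e)) \<subseteq> r\<^sup>* `` {e}"
    proof
      fix f assume f: "f \<in> component_at (top_of L (edge_pos e))"
      then have f': "f \<in> ?A" "top_of L (edge_pos f) = top_of L (edge_pos e)" by (auto simp: component_at_def)
      have "top_of L (edge_pos e) \<in> V"
        using top_of_in[OF edge_extraction] edge_pos_incident[OF e] by blast
      then obtain g where g: "g \<in> ?A" "Inner (phi_addr (top_of L (edge_pos e))) \<in> ends g"
        using incident_edge by blast
      have "(e, g) \<in> r\<^sup>*" using to_top[of "edge_pos e" e g] edge_pos_incident[OF e] e g by blast
      moreover have "(f, g) \<in> r\<^sup>*"
        using to_top[of "edge_pos f" f g] edge_pos_incident[OF f'(1)] f' g by simp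
      ultimately show "f \<in> r\<^sup>* `` {e}" using symD[OF sym] by (meson Image_singleton_iff rtrancl_trans)
    qed
  qed
  have "components ?A = (\<lambda>e. component_at (top_of L (edge_pos e))) ` ?A"
    unfolding components_def quotient_def r_def[symmetric] using cls by auto
  also have "\<dots> = component_at ` (\<lambda>e. top_of L (edge_pos e)) ` ?A"
    by (simp add: image_image)
  also have "(\<lambda>e. top_of L (edge_pos e)) ` ?A = V - L"
  proof
    show "(\<lambda>e. top_of L (edge_pos e)) ` ?A \<subseteq> V - L"
      using edge_pos_incident top_of_in[OF edge_extraction] by blast
    show "V - L \<subseteq> (\<lambda>e. top_of L (edge_pos e)) ` ?A"
    proof
      fix p assume p: "p \<in> V - L"
      then obtain e where "e \<in> ?A" "Inner (phi_addr p) \<in> ends e" using incident_edge by blast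
      then show "p \<in> (\<lambda>e. top_of L (edge_pos e)) ` ?A"
        using ends_Inner[of e p] p by (intro image_eqI[of _ _ e]) auto
    qed
  qed
  finally show ?thesis .
qed

lemma component_at_incident: "p \<in> V - L \<Longrightarrow> \<exists>e. e \<in> component_at p"
  using incident_edge[of p] ends_Inner[of _ p] by (fastforce simp: component_at_def)

lemma inj_on_component_at: "inj_on component_at (V - L)"
proof (rule inj_onI)
  fix p q assume pq: "p \<in> V - L" "q \<in> V - L" "component_at p = component_at q"
  obtain e where "e \<in> component_at p" using component_at_incident[OF pq(1)] by blast
  then show "p = q" using pq(3) by (auto simp: component_at_def)
qed

lemma edge_verts_component_at:
  assumes "p \<in> V - L"
  shows "Inner (phi_addr x) \<in> edge_verts (component_at p) \<longleftrightarrow> x \<in> member V L p"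
proof
  assume "Inner (phi_addr x) \<in> edge_verts (component_at p)"
  then obtain e where "e \<in> edge_set X L" "top_of L (edge_pos e) = p" "Inner (phi_addr x) \<in> ends e"
    by (auto simp: edge_verts_def component_at_def)
  then show "x \<in> member V L p" using ends_Inner[of e x] by (auto simp: member_def)
next
  assume "x \<in> member V L p"
  then have x: "x \<in> V" "top_of L x = p" by (auto simp: member_def)
  then obtain e where "e \<in> edge_set X L" "Inner (phi_addr x) \<in> ends e" using incident_edge by blast
  then show "Inner (phi_addr x) \<in> edge_verts (component_at p)"
    using ends_Inner[of e x] x by (auto simp: edge_verts_def component_at_def)
qed

lemma finite_edge_set: "finite (edge_set X L)"
  using finite_subset[OF X] finite_subset[OF L] by (simp add: edge_set_def)

lemma component_symb_at:
  assumes p: "p \<in> V - L"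
  shows "component_symb (phi \<tau>) (component_at p) =
    phi (piece_lab (\<lambda>x. if x \<in> X then root_label (sub \<tau> x) else None) \<tau> L p)"
proof -
  note props = extraction_props[OF edge_extraction]
  let ?E = "component_at p"
  let ?S = "member V L p"
  have root: "(ARG_MIN length q. Inner q \<in> edge_verts ?E) = phi_addr p"
  proof (rule arg_min_unique)
    show "Inner (phi_addr p) \<in> edge_verts ?E"
      using member_self[OF edge_extraction p] by (simp add: edge_verts_component_at[OF p])
    show "length (phi_addr p) < length y" if "Inner y \<in> edge_verts ?E" "y \<noteq> phi_addr p" for y
      using that length_member[OF edge_extraction, of "psi_addr y" p]
        edge_verts_component_at[OF p, of "psi_addr y"]
      by (metis length_phi_addr phi_psi_addr)
  qed
  let ?lab = "\<lambda>x. if x \<in> X then root_label (sub \<tau> x) else None"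
  let ?ch = "\<lambda>v. {q \<in> L. is_child v q}"
  have finE: "finite ?E" using finite_edge_set by (simp add: component_at_def)
  have finS: "finite ?S" using props(5) by (simp add: member_def)
  have "component_symb (phi \<tau>) ?E = phi (grow Node ?lab ?ch (card ?E) p)"
    unfolding component_symb_def root
  proof (rule grow_transfer[where R = ?S])
    fix v assume v: "v \<in> ?S"
    have top: "top_of L q = p" if "q \<in> L" "is_child v q" for q
      using that top_of_butlast[of q] v by (auto simp: is_child_def member_def)
    show "{q. is_child (phi_addr v) q \<and> I_edge q \<in> ?E} = phi_addr ` ?ch v" (is "?A = ?B")
    proof -
      have "phi_addr q \<in> ?A \<longleftrightarrow> phi_addr q \<in> ?B" for q
        using top[of q] by (auto simp: image_iff)
      then have "q \<in> ?A \<longleftrightarrow> q \<in> ?B" for q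
        using all_phi_addr[of "\<lambda>q. q \<in> ?A \<longleftrightarrow> q \<in> ?B" q] by blast
      then show ?thesis by blast
    qed
    show "Symb (if Xi_edge (phi_addr v) \<in> ?E then noise (sub (phi \<tau>) (phi_addr v)) else None) (image_mset phi M) =
        phi (Node (?lab v) M)" for M
      using v by (auto simp: member_def)
  qed (use member_self[OF edge_extraction p] member_children[OF edge_extraction] inj_phi_addr in auto)
  also have "grow Node ?lab ?ch (card ?E) p = piece_lab ?lab \<tau> L p"
    unfolding piece_lab_def
  proof (rule grow_stable[where R = ?S and \<mu> = "\<lambda>x. card {q \<in> ?S. length x < length q}"])
    fix v c assume v: "v \<in> ?S" "c \<in> ?ch v"
    then have c: "c \<in> ?S" "length v < length c"
      using member_children[OF edge_extraction v(1)] length_child[of v c] by auto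
    have "card {q \<in> ?S. length c < length q} < card {q \<in> ?S. length v < length q}"
      by (rule psubset_card_mono) (use c finS in \<open>simp, fastforce\<close>)
    then show "c \<in> ?S \<and> card {q \<in> ?S. length c < length q} < card {q \<in> ?S. length v < length q}"
      using c(1) by simp
  next
    have "card {q \<in> ?S. length p < length q} \<le> card ?S"
      using finS by (intro card_mono) auto
    also have "card ?S \<le> card (verts kids \<tau>)"
      using props(1) by (intro card_mono) (auto simp: member_def)
    finally show "card {q \<in> ?S. length p < length q} \<le> card (verts kids \<tau>)" .
    \<comment> \<open>The vertices of the member below its top have distinct inner edges in the
      component, so the depth \<open>card ?E\<close> of \<open>component_symb\<close>
      suffices.\<close>
    have "I_edge (phi_addr q) \<in> ?E" if "q \<in> ?S" "length p < length q" for q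
      using that by (cases "q \<in> L") (auto simp: member_def)
    then have "(\<lambda>q. I_edge (phi_addr q)) ` {q \<in> ?S. length p < length q} \<subseteq> ?E" by auto
    then show "card {q \<in> ?S. length p < length q} \<le> card ?E"
      by (rule card_inj_on_le[rotated]) (auto simp: finE inj_on_def)
  qed (fact member_self[OF edge_extraction p])
  finally show ?thesis .
qed

text \<open>A vertex of \<open>V\<close> outside \<open>X\<close> would put the label 0 into its
  component, whose degree could then not be negative.\<close>

lemma pieces_in_W_minus:
  assumes \<alpha>: "0 < \<alpha>" and W: "\<forall>E\<in>components (edge_set X L). component_symb (phi \<tau>) E \<in> W_minus \<alpha>"
  shows "X = V" "\<forall>p\<in>V - L. piece \<tau> L p \<in> trees_minus \<alpha>"
proof -
  let ?lab = "\<lambda>x. if x \<in> X then root_label (sub \<tau> x) else None"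
  have tm: "piece_lab ?lab \<tau> L p \<in> trees_minus \<alpha>" if "p \<in> V - L" for p
    using W that by (simp add: components_edge_set component_symb_at phi_W_minus[OF \<alpha>])
  show "X = V"
  proof (rule ccontr)
    assume "X \<noteq> V"
    then obtain x where x: "x \<in> V" "x \<notin> X" by (auto simp: V)
    have "None \<in> set_tree (piece_lab ?lab \<tau> L (top_of L x))"
      using piece_lab_label[OF edge_extraction x(1), of ?lab] x(2) by simp
    then show False
      using trees_minus_None[OF tm[OF top_of_in[OF edge_extraction x(1)]]] by blast
  qed
  then show "\<forall>p\<in>V - L. piece \<tau> L p \<in> trees_minus \<alpha>"
    using tm piece_lab_cong[OF edge_extraction, of _ ?lab "\<lambda>x. root_label (sub \<tau> x)"]
    by (auto simp: piece_piece_lab member_def)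
qed

lemma component_symb_full: "X = V \<Longrightarrow> p \<in> V - L \<Longrightarrow> component_symb (phi \<tau>) (component_at p) = phi (piece \<tau> L p)"
proof -
  assume XV: "X = V" and p: "p \<in> V - L"
  have "piece_lab (\<lambda>x. if x \<in> X then root_label (sub \<tau> x) else None) \<tau> L p =
      piece_lab (\<lambda>x. root_label (sub \<tau> x)) \<tau> L p"
    by (rule piece_lab_cong[OF edge_extraction p]) (simp add: XV member_def)
  then show ?thesis by (simp only: component_symb_at[OF p] piece_piece_lab)
qed

lemma contract_symb_full:
  assumes XV: "X = V"
  shows "contract_symb (phi \<tau>) (edge_set X L) = phi (contracted \<tau> V L [])"
proof -
  note props = extraction_props[OF edge_extraction]
  let ?A = "edge_set X L"
  let ?T = "verts kids \<tau> - L"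
  let ?E = "symb_edges (phi \<tau>) - ?A"
  define Q where "Q = edge_verts ` components ?A \<union> {{x} | x. x \<in> symb_verts (phi \<tau>) - edge_verts ?A}"
  define h where "h = (\<lambda>v. if v \<in> V then edge_verts (component_at v) else {Inner (phi_addr v)})"
  have LV: "x \<notin> L" if "x \<notin> V" for x using that props(2) by auto
  have top: "top_of L x \<in> ?T" if "x \<in> verts kids \<tau>" for x
  proof (cases "x \<in> V")
    case False
    then show ?thesis using that LV by simp
  qed (use top_of_in[OF edge_extraction, of x] props(1) in auto)
  have mem: "Inner (phi_addr x) \<in> h w \<longleftrightarrow> w = top_of L x" if "x \<in> verts kids \<tau>" "w \<in> ?T" for x w
  proof (cases "w \<in> V")
    case True
    then have "Inner (phi_addr x) \<in> h w \<longleftrightarrow> x \<in> V \<and> top_of L x = w"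
      using that by (simp add: h_def edge_verts_component_at member_def)
    then show ?thesis using True LV[of x] by (cases "x \<in> V") auto
  next
    case False
    then have "Inner (phi_addr x) \<in> h w \<longleftrightarrow> x = w" by (simp add: h_def)
    moreover have "top_of L x \<in> V" if "x \<in> V" using top_of_in[OF edge_extraction that] by blast
    ultimately show ?thesis using False LV[of x] by (cases "x \<in> V") auto
  qed
  have self: "Inner (phi_addr w) \<in> h w" if "w \<in> ?T" for w
    using mem[of w w] that by simp
  have vert: "x \<in> verts kids \<tau>" if "Inner (phi_addr x) \<in> h w" "w \<in> ?T" for x w
    using that props(1) by (auto simp: h_def edge_verts_component_at member_def split: if_splits)
  have inj: "v = w" if "h v = h w" "v \<in> ?T" "w \<in> ?T" for v w
    using self[OF that(2)] mem[of v w] that by simp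
  have eA: "Inner (phi_addr x) \<in> edge_verts ?A \<longleftrightarrow> x \<in> V" for x
    using incident_edge[of x] ends_Inner[of _ x] by (auto simp: edge_verts_def)
  have hQ: "h w \<in> Q" if "w \<in> ?T" for w
    using that by (auto simp: h_def Q_def components_edge_set symb_verts_def eA)
  \<comment> \<open>\<open>Q\<close> also contains the singletons of leaves outside of the subgraph,
    which are not of the form \<open>h w\<close>. An inner vertex in \<open>c\<close> rules them
    out; the class of the root and the class at the end of an \<I>-edge always have one.\<close>
  have Qh: "\<exists>w\<in>?T. c = h w" if "c \<in> Q" "Inner (phi_addr x) \<in> c" for c x
  proof (cases "c \<in> edge_verts ` components ?A")
    case True
    then obtain p where "p \<in> V - L" "c = edge_verts (component_at p)" by (auto simp: components_edge_set)
    then show ?thesis using props(1) by (intro bexI[of _ p]) (auto simp: h_def)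
  next
    case False
    then have "c = {Inner (phi_addr x)}" "Inner (phi_addr x) \<in> symb_verts (phi \<tau>)" "x \<notin> V"
      using that by (auto simp: Q_def eA)
    then show ?thesis using LV by (intro bexI[of _ x]) (auto simp: h_def symb_verts_def)
  qed
  have root: "(THE c. c \<in> Q \<and> Inner [] \<in> c) = h []"
  proof (rule the_equality)
    have T: "[] \<in> ?T" using props(3) by simp
    then show "h [] \<in> Q \<and> Inner [] \<in> h []" using hQ self[OF T] by simp
    fix c assume c: "c \<in> Q \<and> Inner [] \<in> c"
    then obtain w where "w \<in> ?T" "c = h w" using Qh[of c "[]"] by auto
    then show "c = h []" using c mem[of "[]" w] by simp
  qed
  have Xi: "Xi_edge (phi_addr x) \<in> ?E \<longleftrightarrow> x \<in> labelled \<tau> \<and> x \<notin> V" for x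
    using XV by simp
  have I: "I_edge (phi_addr q) \<in> ?E \<longleftrightarrow> q \<in> ?T \<and> q \<noteq> []" for q
    by auto
  have ch: "{c' \<in> Q. \<exists>q. I_edge q \<in> ?E \<and> Inner (butlast q) \<in> h v \<and> Inner q \<in> c'} =
      h ` {q \<in> ?T. q \<noteq> [] \<and> top_of L (butlast q) = v}" (is "?B = ?C") if v: "v \<in> ?T" for v
  proof
    show "?B \<subseteq> ?C"
    proof
      fix c assume "c \<in> ?B"
      then obtain q' where c: "c \<in> Q" "I_edge q' \<in> ?E" "Inner (butlast q') \<in> h v" "Inner q' \<in> c" by blast
      define q where "q = psi_addr q'"
      have q': "q' = phi_addr q" by (simp add: q_def)
      have q: "q \<in> ?T" "q \<noteq> []" using c(2) I unfolding q' by blast+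
      have "v = top_of L (butlast q)"
        using c(3) mem[of "butlast q" v] v q verts_butlast[of q kids \<tau>] unfolding q' butlast_phi_addr by blast
      moreover obtain w where "w \<in> ?T" "c = h w" using Qh[OF c(1)] c(4) unfolding q' by blast
      then have "c = h q" using mem[of q w] c(4) q unfolding q' by simp
      ultimately show "c \<in> ?C" using q by blast
    qed
    show "?C \<subseteq> ?B"
    proof
      fix c assume "c \<in> ?C"
      then obtain q where q: "c = h q" "q \<in> ?T" "q \<noteq> []" "top_of L (butlast q) = v" by blast
      have "Inner (butlast (phi_addr q)) \<in> h v"
        using mem[of "butlast q" v] q v verts_butlast[of q kids \<tau>] by (simp add: butlast_phi_addr)
      moreover have "I_edge (phi_addr q) \<in> ?E" using I q by blast
      ultimately show "c \<in> ?B" using hQ[OF q(2)] self[OF q(2)] q(1) by blast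
    qed
  qed
  have lab: "(if \<exists>q. Inner q \<in> h v \<and> Xi_edge q \<in> ?E
      then noise (sub (phi \<tau>) (THE q. Inner q \<in> h v \<and> Xi_edge q \<in> ?E)) else None) =
    (if v \<in> V then None else root_label (sub \<tau> v))" if v: "v \<in> ?T" for v
  proof (cases "v \<in> V")
    case True
    have "\<not> (Inner q \<in> h v \<and> Xi_edge q \<in> ?E)" for q
    proof (rule all_phi_addr[of "\<lambda>q. \<not> (Inner q \<in> h v \<and> Xi_edge q \<in> ?E)"])
      show "\<not> (Inner (phi_addr x) \<in> h v \<and> Xi_edge (phi_addr x) \<in> ?E)" for x
        unfolding Xi using True v by (auto simp: h_def edge_verts_component_at member_def)
    qed
    then show ?thesis using True by auto
  next
    case False
    have iff: "Inner q \<in> h v \<and> Xi_edge q \<in> ?E \<longleftrightarrow> q = phi_addr v \<and> root_label (sub \<tau> v) \<noteq> None" for q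
    proof (rule all_phi_addr[of "\<lambda>q. Inner q \<in> h v \<and> Xi_edge q \<in> ?E \<longleftrightarrow> q = phi_addr v \<and> root_label (sub \<tau> v) \<noteq> None"])
      show "Inner (phi_addr x) \<in> h v \<and> Xi_edge (phi_addr x) \<in> ?E \<longleftrightarrow>
          phi_addr x = phi_addr v \<and> root_label (sub \<tau> v) \<noteq> None" for x
        unfolding Xi using False v by (auto simp: h_def labelled_def)
    qed
    show ?thesis
      unfolding iff using False by (cases "root_label (sub \<tau> v)") auto
  qed
  have "contract_symb (phi \<tau>) ?A = grow Symb
        (\<lambda>c. if \<exists>p. Inner p \<in> c \<and> Xi_edge p \<in> ?E
              then noise (sub (phi \<tau>) (THE p. Inner p \<in> c \<and> Xi_edge p \<in> ?E)) else None)
        (\<lambda>c. {c' \<in> Q. \<exists>q. I_edge q \<in> ?E \<and> Inner (butlast q) \<in> c \<and> Inner q \<in> c'})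
        (card (verts kids \<tau>)) (h [])"
    unfolding contract_symb_def Let_def Q_def[symmetric] root verts_phi
    by (simp add: card_image[OF inj_phi_addr])
  also have "\<dots> = phi (contracted \<tau> V L [])"
    unfolding contracted_def
  proof (rule grow_transfer[where R = ?T])
    fix v M assume v: "v \<in> ?T"
    show "inj_on h {q \<in> ?T. q \<noteq> [] \<and> top_of L (butlast q) = v}"
      using inj by (auto simp: inj_on_def)
    show "Symb (if \<exists>q. Inner q \<in> h v \<and> Xi_edge q \<in> ?E
      then noise (sub (phi \<tau>) (THE q. Inner q \<in> h v \<and> Xi_edge q \<in> ?E)) else None) (image_mset phi M) =
        phi (Node (if v \<in> V then None else root_label (sub \<tau> v)) M)"
      unfolding lab[OF v] by simp
  qed (use ch props(3) in auto)
  finally show ?thesis .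
qed

end

theorem Delta_minus_symb_phi:
  fixes \<tau> :: "'d rtree"
  assumes \<alpha>: "0 < \<alpha>"
  shows "Delta_minus_symb \<alpha> (phi \<tau>) =
    (\<Sum>(V, L)\<in>{(V, L) \<in> extractions \<tau>. \<forall>p\<in>V - L. piece \<tau> L p \<in> trees_minus \<alpha>}.
      vec (image_mset (\<lambda>p. phi (piece \<tau> L p)) (mset_set (V - L)), phi (contracted \<tau> V L [])))"
  unfolding Delta_minus_symb_def
proof (rule sum.reindex_bij_witness[where i = "\<lambda>(V, L). edge_set V L" and
    j = "\<lambda>A. ({x. Xi_edge (phi_addr x) \<in> A}, {q. I_edge (phi_addr q) \<in> A})"])
  fix A assume "A \<in> {A. A \<subseteq> symb_edges (phi \<tau>) \<and> (\<forall>E\<in>components A. component_symb (phi \<tau>) E \<in> W_minus \<alpha>)}"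
  then have A: "A \<subseteq> symb_edges (phi \<tau>)" "\<forall>E\<in>components A. component_symb (phi \<tau>) E \<in> W_minus \<alpha>" by auto
  define X L where X: "X = {x. Xi_edge (phi_addr x) \<in> A}" and L: "L = {q. I_edge (phi_addr q) \<in> A}"
  have "e \<in> A \<longleftrightarrow> e \<in> edge_set X L" for e
    by (cases e rule: gedge_cases) (auto simp: X L)
  then have A_eq: "A = edge_set X L" by blast
  have sub: "X \<subseteq> verts kids \<tau>" "L \<subseteq> verts kids \<tau> - {[]}"
    using A(1) symb_edges_iff(1)[of "[]" \<tau>] by (auto simp: X L labelled_def dest!: subsetD[OF A(1)])
  define V where "V = X \<union> L \<union> butlast ` L"
  note ctx = sub V_def
  have XV: "X = V" and tm: "\<forall>p\<in>V - L. piece \<tau> L p \<in> trees_minus \<alpha>"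
    using pieces_in_W_minus[OF ctx \<alpha>] A(2) unfolding A_eq by blast+
  show "(case ({x. Xi_edge (phi_addr x) \<in> A}, {q. I_edge (phi_addr q) \<in> A}) of (V, L) \<Rightarrow> edge_set V L) = A"
    unfolding X[symmetric] L[symmetric] by (simp add: A_eq)
  show "({x. Xi_edge (phi_addr x) \<in> A}, {q. I_edge (phi_addr q) \<in> A}) \<in>
      {(V, L) \<in> extractions \<tau>. \<forall>p\<in>V - L. piece \<tau> L p \<in> trees_minus \<alpha>}"
    unfolding X[symmetric] L[symmetric] using edge_extraction[OF ctx] tm XV by simp
  have "image_mset (component_symb (phi \<tau>)) (mset_set (components A)) =
      image_mset (\<lambda>p. phi (piece \<tau> L p)) (mset_set (V - L))"
    unfolding A_eq components_edge_set[OF ctx] image_mset_mset_set[OF inj_on_component_at[OF ctx], symmetric]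
      multiset.map_comp comp_def
    using component_symb_full[OF ctx XV] by (intro image_mset_cong) (auto dest!: in_mset_set_D)
  then show "(case ({x. Xi_edge (phi_addr x) \<in> A}, {q. I_edge (phi_addr q) \<in> A}) of (V, L) \<Rightarrow>
      vec (image_mset (\<lambda>p. phi (piece \<tau> L p)) (mset_set (V - L)), phi (contracted \<tau> V L []))) =
    vec (image_mset (component_symb (phi \<tau>)) (mset_set (components A)), contract_symb (phi \<tau>) A)"
    unfolding X[symmetric] L[symmetric] using contract_symb_full[OF ctx XV] XV A_eq by simp
next
  fix c assume "c \<in> {(V, L) \<in> extractions \<tau>. \<forall>p\<in>V - L. piece \<tau> L p \<in> trees_minus \<alpha>}"
  then obtain V L where c: "c = (V, L)" "(V, L) \<in> extractions \<tau>" "\<forall>p\<in>V - L. piece \<tau> L p \<in> trees_minus \<alpha>" by auto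
  note props = extraction_props[OF c(2)]
  show "({x. Xi_edge (phi_addr x) \<in> (case c of (V, L) \<Rightarrow> edge_set V L)},
      {q. I_edge (phi_addr q) \<in> (case c of (V, L) \<Rightarrow> edge_set V L)}) = c"
    by (simp add: c(1))
  have sub: "V \<subseteq> verts kids \<tau>" "L \<subseteq> verts kids \<tau> - {[]}" "V = V \<union> L \<union> butlast ` L"
    using props by auto
  \<comment> \<open>A piece in \<open>trees_minus \<alpha>\<close> has no label 0, so each covered
    vertex has a noise edge and \<open>edge_set V L\<close> consists of edges of the symbol.\<close>
  have "x \<in> labelled \<tau>" if "x \<in> V" for x
  proof -
    have "root_label (sub \<tau> x) \<in> set_tree (piece \<tau> L (top_of L x))"
      using piece_lab_label[OF c(2) that, of "\<lambda>x. root_label (sub \<tau> x)"] by (simp add: piece_piece_lab)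
    moreover have "None \<notin> set_tree (piece \<tau> L (top_of L x))"
      using c(3) top_of_in[OF c(2) that] trees_minus_None by blast
    ultimately have "root_label (sub \<tau> x) \<noteq> None" by metis
    then show ?thesis using that props(1) by (auto simp: labelled_def)
  qed
  then have "edge_set V L \<subseteq> symb_edges (phi \<tau>)"
    using sub(2) by (auto elim!: edge_set_cases)
  moreover have "component_symb (phi \<tau>) E \<in> W_minus \<alpha>" if "E \<in> components (edge_set V L)" for E
    using that c(3) unfolding components_edge_set[OF sub]
    by (auto simp: component_symb_full[OF sub] phi_W_minus[OF \<alpha>])
  ultimately show "(case c of (V, L) \<Rightarrow> edge_set V L) \<in>
      {A. A \<subseteq> symb_edges (phi \<tau>) \<and> (\<forall>E\<in>components A. component_symb (phi \<tau>) E \<in> W_minus \<alpha>)}"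
    by (simp add: c(1))
qed

lemma pi_minus_eq: "pi_minus \<alpha> F = (if set_mset F \<subseteq> trees_minus \<alpha> then vec F else 0)"
  unfolding pi_minus_def
proof (induction F)
  case (add t F)
  have "vec {#t#} * vec F = vec (add_mset t F)" by (simp flip: vec_plus)
  then show ?case using add by simp
qed (simp flip: vec_zero)

theorem Delta_minus_symb_delta_minus:
  fixes \<tau> :: "'d rtree"
  assumes "0 < \<alpha>"
  shows "Delta_minus_symb \<alpha> (phi \<tau>) = push (map_prod (image_mset phi) phi) (delta_minus \<alpha> \<tau>)"
proof -
  let ?P = "\<lambda>(V, L). \<forall>p\<in>V - L. piece \<tau> L p \<in> trees_minus \<alpha>"
  have *: "tensor (pi_minus \<alpha> F) (vec t) = (if set_mset F \<subseteq> trees_minus \<alpha> then vec (F, t) else 0)" for F t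
    by (simp add: pi_minus_eq tensor_def)
  have sub: "set_mset (image_mset (piece \<tau> L) (mset_set (V - L))) \<subseteq> trees_minus \<alpha> \<longleftrightarrow> ?P (V, L)"
    if "(V, L) \<in> extractions \<tau>" for V L
    using extraction_props(5)[OF that] by (auto simp: image_subset_iff)
  have "delta_minus \<alpha> \<tau> = (\<Sum>c\<in>extractions \<tau>. if ?P c then
      vec (image_mset (piece \<tau> (snd c)) (mset_set (fst c - snd c)), contracted \<tau> (fst c) (snd c) []) else 0)"
    unfolding delta_minus_def delta_extractions tensor_map_def lin_sum
  proof (rule sum.cong)
    fix c assume "c \<in> extractions \<tau>"
    then obtain V L where "c = (V, L)" "(V, L) \<in> extractions \<tau>" by (cases c) auto
    then show "lin (\<lambda>(a, b). tensor (pi_minus \<alpha> a) (vec b)) (case c of (V, L) \<Rightarrow>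
        vec (image_mset (piece \<tau> L) (mset_set (V - L)), contracted \<tau> V L [])) =
      (if ?P c then vec (image_mset (piece \<tau> (snd c)) (mset_set (fst c - snd c)),
        contracted \<tau> (fst c) (snd c) []) else 0)"
      using sub[of V L] by (simp add: * del: set_image_mset)
  qed simp
  then show ?thesis
    unfolding Delta_minus_symb_phi[OF assms]
    by (simp add: sum.inter_filter[symmetric] push_sum multiset.map_comp comp_def case_prod_unfold)
qed

section \<open>Substitution and its compatibility with the coproduct\<close>

lemma lin_times_iterated:
  fixes f :: "'a::monoid_add \<Rightarrow> 'v::real_vector"
  shows "lin f (x * y) = lin (\<lambda>a. lin (\<lambda>b. f (a + b)) y) x"
proof -
  have 1: "lin f (Poly_Mapping.single a c * y) = c *\<^sub>R lin (\<lambda>b. f (a + b)) y" for a c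
    by (induction y rule: poly_mapping_single_induct)
      (simp_all add: lin_add lin_single mult_single distrib_left scaleR_add_right)
  show ?thesis
    by (induction x rule: poly_mapping_single_induct) (simp_all add: lin_add lin_single distrib_right 1)
qed

lemma tensor_add_right: "tensor x (y + z) = tensor x y + tensor x z"
  by (simp add: tensor_def lin_add lin_add_fun)

lemma tensor_scaleR_right: "tensor x (c *\<^sub>R y) = c *\<^sub>R tensor x y"
  by (simp add: tensor_def lin_scaleR lin_scaleR_fun)

lemma tensor_push_right: "tensor x (push g y) = push (\<lambda>(a, b). (a, g b)) (tensor x y)"
  by (simp add: tensor_def push_lin)

lemma tensor_lin_right: "tensor x (lin g y) = lin (\<lambda>b. tensor x (g b)) y"
  by (simp add: tensor_def lin_lin) (rule lin_swap)

lemma tensor_times: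
  "tensor (x * x') (y * y') = tensor x y * tensor x' y'"
  for x y :: "'a::comm_monoid_add \<Rightarrow>\<^sub>0 real"
proof -
  have *: "tensor x y = push (\<lambda>a. (a, 0)) x * push (\<lambda>b. (0, b)) y" for x y :: "'a \<Rightarrow>\<^sub>0 real"
    by (simp add: tensor_def push_def lin_mult_left[symmetric] lin_mult_right[symmetric] flip: vec_plus)
      (rule lin_swap)
  have "push (\<lambda>a. (a, 0::'a)) (x * x') = push (\<lambda>a. (a, 0)) x * push (\<lambda>a. (a, 0)) x'"
    "push (\<lambda>a. (0::'a, a)) (y * y') = push (\<lambda>a. (0, a)) y * push (\<lambda>a. (0, a)) y'"
    by (rule push_times, simp)+
  then show ?thesis by (simp add: * mult_ac)
qed

text \<open>The map \<open>\<delta>\<^sub>v\<close> of the overview, for an arbitrary real function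
  \<open>w\<close> on trees in place of \<open>v\<close>; \<open>subst_forest\<close> is its
  multiplicative extension.\<close>

definition subst_tree :: "('d rtree \<Rightarrow> real) \<Rightarrow> 'd rtree \<Rightarrow> ('d rtree \<Rightarrow>\<^sub>0 real)" where
  "subst_tree w \<tau> = contract_left (\<lambda>F. \<Prod>t\<in>#F. w t) (delta \<tau>)"

definition subst_forest :: "('d rtree \<Rightarrow> real) \<Rightarrow> 'd forest \<Rightarrow> ('d forest \<Rightarrow>\<^sub>0 real)" where
  "subst_forest w F = (\<Prod>t\<in>#F. push (\<lambda>s. {#s#}) (subst_tree w t))"

lemma subst_forest_empty [simp]: "subst_forest w {#} = 1"
  by (simp add: subst_forest_def)

lemma subst_forest_union: "subst_forest w (F + G) = subst_forest w F * subst_forest w G"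
  by (simp add: subst_forest_def)

lemma subst_forest_add: "subst_forest w (add_mset t F) = push (\<lambda>s. {#s#}) (subst_tree w t) * subst_forest w F"
  by (simp add: subst_forest_def)

lemma subst_forest_single [simp]: "subst_forest w {#t#} = push (\<lambda>s. {#s#}) (subst_tree w t)"
  by (simp add: subst_forest_def)

text \<open>Contraction with \<open>w\<close> extends to the algebra morphism \<open>m\<close>;
  applied to \<open>extraction_sum_rec\<close> it turns the products over branches into
  \<open>subst_forest\<close>.\<close>

lemma subst_tree_rec:
  "subst_tree w \<tau> = push (Node (root_label \<tau>)) (subst_forest w (kids \<tau>)) +
    lin (\<lambda>(b, s). w s *\<^sub>R push (Node None) (subst_forest w b)) (pruned \<tau>)"
proof -
  define m where "m = (\<lambda>(F :: 'a forest, H :: 'a forest). (\<Prod>t\<in>#F. w t) *\<^sub>R vec H)"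
  have m0: "m 0 = 1"
    by (simp add: m_def zero_prod_def flip: vec_zero)
  have m_add: "m (x + y) = m x * m y" for x y
    by (simp add: m_def case_prod_unfold vec_plus)
  have m_ext: "lin m (extraction_sum t) = push (\<lambda>s. {#s#}) (subst_tree w t)" for t
    by (simp add: extraction_sum_delta m_def subst_tree_def contract_left_def push_def lin_lin
        case_prod_unfold lin_scaleR)
  then have m_prod: "lin m (\<Prod>t\<in>#F. extraction_sum t) = subst_forest w F" for F
    by (simp add: subst_forest_def lin_prod_mset[OF m0 m_add])
  have "lin (\<lambda>x. m (fst x, {#Node i (snd x)#})) z = push (\<lambda>H. {#Node i H#}) (lin m z)" for i z
    by (simp add: m_def push_lin push_scaleR case_prod_unfold)
  moreover have "lin (\<lambda>x. m (add_mset s (fst x), {#Node i (snd x)#})) z = w s *\<^sub>R push (\<lambda>H. {#Node i H#}) (lin m z)" for s i z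
    by (simp add: m_def push_lin push_scaleR case_prod_unfold lin_scaleR_fun[symmetric])
  ultimately have "push (\<lambda>s. {#s#}) (subst_tree w \<tau>) =
      push (\<lambda>H. {#Node (root_label \<tau>) H#}) (subst_forest w (kids \<tau>)) +
      lin (\<lambda>(b, s). w s *\<^sub>R push (\<lambda>H. {#Node None H#}) (subst_forest w b)) (pruned \<tau>)"
    unfolding m_ext[symmetric]
    by (subst extraction_sum_rec) (simp add: lin_add lin_lin case_prod_unfold m_prod)
  \<comment> \<open>All forests here are single trees; reading off the tree undoes the embedding of
    trees into forests.\<close>
  then have "push (\<lambda>F. THE t. F = {#t#}) (push (\<lambda>s. {#s#}) (subst_tree w \<tau>)) =
      push (\<lambda>F. THE t. F = {#t#}) (push (\<lambda>H. {#Node (root_label \<tau>) H#}) (subst_forest w (kids \<tau>)) +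
      lin (\<lambda>(b, s). w s *\<^sub>R push (\<lambda>H. {#Node None H#}) (subst_forest w b)) (pruned \<tau>))"
    by simp
  then show ?thesis
    by (simp add: push_push push_add push_lin push_scaleR case_prod_unfold)
qed

lemma lin_subst_tree:
  "lin f (subst_tree w \<tau>) = lin (\<lambda>H. f (Node (root_label \<tau>) H)) (subst_forest w (kids \<tau>)) +
    lin (\<lambda>(b, s). w s *\<^sub>R lin (\<lambda>H. f (Node None H)) (subst_forest w b)) (pruned \<tau>)"
  by (subst subst_tree_rec) (simp add: lin_add lin_lin lin_scaleR case_prod_unfold)

text \<open>A cut distributes the nodes over its two sides, so every quantity that adds up over the
  nodes is conserved: \<open>num_nodes\<close> for inductions on the size, \<open>weight\<close> for
  degrees.\<close>

lemma keys_copr: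
  fixes \<omega> :: "'l tree \<Rightarrow> 'w::comm_monoid_add"
  assumes \<omega>: "\<And>i ts. \<omega> (Node i ts) = c i + (\<Sum>t\<in>#ts. \<omega> t)"
  shows "(a, b) \<in> Poly_Mapping.keys (copr F) \<Longrightarrow> (\<Sum>t\<in>#a. \<omega> t) + (\<Sum>t\<in>#b. \<omega> t) = (\<Sum>t\<in>#F. \<omega> t)"
proof -
  let ?W = "\<lambda>F. \<Sum>t\<in>#F. \<omega> t"
  let ?P = "\<lambda>x F. \<forall>(a, b)\<in>Poly_Mapping.keys x. ?W a + ?W b = ?W F"
  have forest: "?P (copr F) F" if "\<And>t. t \<in># F \<Longrightarrow> ?P (copr_tree t) {#t#}" for F
    using that
  proof (induction F)
    case (add t F)
    show ?case
    proof (intro ballI, clarify)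
      fix a b assume "(a, b) \<in> Poly_Mapping.keys (copr (add_mset t F))"
      then have "(a, b) \<in> Poly_Mapping.keys (copr_tree t * copr F)" by (simp add: copr_def)
      then obtain a1 b1 a2 b2 where *: "(a1, b1) \<in> Poly_Mapping.keys (copr_tree t)" "(a2, b2) \<in> Poly_Mapping.keys (copr F)"
        "a = a1 + a2" "b = b1 + b2"
        using keys_times_subset[of "copr_tree t" "copr F"] by auto
      have "?W a1 + ?W b1 = \<omega> t" "?W a2 + ?W b2 = ?W F"
        using add * by fastforce+
      moreover have "?W a + ?W b = (?W a1 + ?W b1) + (?W a2 + ?W b2)"
        unfolding * by (simp add: ac_simps)
      ultimately show "?W a + ?W b = ?W (add_mset t F)"
        by simp
    qed
  qed (simp flip: vec_zero add: zero_prod_def)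
  have tree: "?P (copr_tree \<tau>) {#\<tau>#}" for \<tau>
  proof (induction \<tau> rule: tree_induct)
    case (Node i ts)
    show ?case
    proof (intro ballI, clarify)
      fix a b assume "(a, b) \<in> Poly_Mapping.keys (copr_tree (Node i ts))"
      then have "(a, b) \<in> {({#Node i ts#}, {#})} \<or>
          (a, b) \<in> Poly_Mapping.keys (push (\<lambda>(a, b). (a, {#Node i b#})) (copr ts))"
        using keys_add[of "vec ({#Node i ts#}, {#})" "push (\<lambda>(a, b). (a, {#Node i b#})) (copr ts)"]
        by (auto simp: copr_tree.simps copr_def)
      then consider "a = {#Node i ts#}" "b = {#}" |
        b' where "(a, b') \<in> Poly_Mapping.keys (copr ts)" "b = {#Node i b'#}"
        using keys_push[of "\<lambda>(a, b). (a, {#Node i b#})" "copr ts"] by auto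
      then show "?W a + ?W b = ?W {#Node i ts#}"
      proof cases
        case 2
        have "?W a + ?W b' = ?W ts" using forest[OF Node] 2(1) by fastforce
        then show ?thesis using 2(2) by (simp add: \<omega> add.left_commute[of _ "c i"])
      qed simp
    qed
  qed
  show "(a, b) \<in> Poly_Mapping.keys (copr F) \<Longrightarrow> ?W a + ?W b = ?W F"
    using forest[of F] tree by fastforce
qed

lemma keys_pruned:
  fixes \<omega> :: "'l tree \<Rightarrow> 'w::comm_monoid_add"
  assumes \<omega>: "\<And>i ts. \<omega> (Node i ts) = c i + (\<Sum>t\<in>#ts. \<omega> t)"
    and "(b, s) \<in> Poly_Mapping.keys (pruned \<tau>)"
  shows "(\<Sum>t\<in>#b. \<omega> t) + \<omega> s = \<omega> \<tau>"
proof (cases \<tau>)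
  case (Node i ts)
  have "(b, s) \<in> (\<lambda>(a, b). (a, Node i b)) ` Poly_Mapping.keys (copr ts)"
    using assms(2) keys_push[of "\<lambda>(a, b). (a, Node i b)" "copr ts"] unfolding Node pruned_Node by blast
  then obtain b' where b': "(b, b') \<in> Poly_Mapping.keys (copr ts)" "s = Node i b'" by auto
  show ?thesis
    using keys_copr[of \<omega> c, OF \<omega> b'(1)] by (simp add: Node b'(2) \<omega> add.left_commute[of _ "c i"])
qed

lemma num_nodes_pos: "0 < num_nodes \<tau>"
  by (cases \<tau>) simp

lemma num_nodes_kid: "t \<in># ts \<Longrightarrow> num_nodes t < num_nodes (Node i ts)"
  by (auto dest!: multi_member_split)

lemma num_nodes_pruned:
  assumes "(b, s) \<in> Poly_Mapping.keys (pruned \<tau>)" "t \<in># b"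
  shows "num_nodes t < num_nodes \<tau>"
proof -
  have "(\<Sum>t\<in>#b. num_nodes t) + num_nodes s = num_nodes \<tau>"
    by (rule keys_pruned[of num_nodes "\<lambda>_. 1", OF _ assms(1)]) simp
  moreover have "num_nodes t \<le> (\<Sum>t\<in>#b. num_nodes t)"
    using assms(2) by (auto dest!: multi_member_split)
  ultimately show ?thesis using num_nodes_pos[of s] by linarith
qed

definition subst_tensor :: "('d rtree \<Rightarrow> real) \<Rightarrow> 'd forest \<times> 'd forest \<Rightarrow> ('d forest \<times> 'd forest \<Rightarrow>\<^sub>0 real)" where
  "subst_tensor w = (\<lambda>(a, b). tensor (subst_forest w a) (subst_forest w b))"

lemma subst_tensor_mult: "subst_tensor w 0 = 1" "subst_tensor w (x + y) = subst_tensor w x * subst_tensor w y"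
  by (simp_all add: subst_tensor_def case_prod_unfold subst_forest_union tensor_times)
    (simp add: zero_multiset_def[symmetric] tensor_def flip: vec_zero zero_prod_def)

text \<open>The compatibility is asked of the trees in \<open>F\<close> only, so that the induction
  for trees can apply this to the branches of a cut.\<close>

lemma copr_subst_forest_of_trees:
  assumes "\<And>t. t \<in># F \<Longrightarrow> lin pruned (subst_tree w t) =
    lin (\<lambda>(a, s). tensor (subst_forest w a) (subst_tree w s)) (pruned t)"
  shows "lin copr (subst_forest w F) = lin (subst_tensor w) (copr F)"
proof -
  have "lin copr (push (\<lambda>s. {#s#}) (subst_tree w t)) = lin (subst_tensor w) (copr_tree t)" if "t \<in># F" for t
  proof -
    have "lin copr (push (\<lambda>s. {#s#}) (subst_tree w t)) =
        push (\<lambda>s. ({#s#}, {#})) (subst_tree w t) + push (\<lambda>(a, s). (a, {#s#})) (lin pruned (subst_tree w t))"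
      by (simp add: copr_tree_pruned lin_add_fun push_lin) (simp add: push_def)
    also have "push (\<lambda>s. ({#s#}, {#})) (subst_tree w t) = subst_tensor w ({#t#}, {#})"
      by (simp add: subst_tensor_def tensor_def push_def lin_unit lin_lin)
    also have "push (\<lambda>(a, s). (a, {#s#})) (lin pruned (subst_tree w t)) =
        lin (\<lambda>(a, s). subst_tensor w (a, {#s#})) (pruned t)"
      unfolding assms[OF that] push_lin
      by (simp add: subst_tensor_def case_prod_unfold tensor_push_right)
    finally show ?thesis by (simp add: lin_copr_tree)
  qed
  then show ?thesis
    unfolding copr_def subst_forest_def
    by (subst lin_prod_mset, simp, simp add: copr_union copr_def)
      (simp add: lin_prod_mset subst_tensor_mult cong: image_mset_cong)
qed

text \<open>The term of the recursion that extracts the root cuts the tree and then cuts the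
  branches again. By coassociativity this is the same as cutting once and then extracting the root
  of the remaining trunk. The induction is on the number of nodes, because the branches of a cut
  need not be children of the root.\<close>

theorem pruned_subst_tree:
  "lin pruned (subst_tree w \<tau>) = lin (\<lambda>(a, s). tensor (subst_forest w a) (subst_tree w s)) (pruned \<tau>)"
proof (induction "num_nodes \<tau>" arbitrary: \<tau> rule: less_induct)
  case less
  obtain i ts where \<tau>: "\<tau> = Node i ts" by (cases \<tau>)
  let ?N = "\<lambda>i (a, b). (a, Node i b)"
  let ?f = "\<lambda>(x, y, z). w (Node i z) *\<^sub>R push (?N None) (subst_tensor w (x, y))"
  have IH_ts: "lin copr (subst_forest w ts) = lin (subst_tensor w) (copr ts)"
    by (rule copr_subst_forest_of_trees, rule less) (simp add: \<tau> num_nodes_kid del: num_nodes.simps)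
  have IH_b: "lin copr (subst_forest w b) = lin (subst_tensor w) (copr b)" if "(b, s) \<in> Poly_Mapping.keys (pruned \<tau>)" for b s
    by (rule copr_subst_forest_of_trees, rule less) (rule num_nodes_pruned[OF that])
  have pr: "lin (\<lambda>H. pruned (Node j H)) x = push (?N j) (lin copr x)" for j x
    by (simp add: pruned_Node push_lin)
  have "lin pruned (subst_tree w \<tau>) = push (?N i) (lin (subst_tensor w) (copr ts)) +
      lin (\<lambda>(b, s). w s *\<^sub>R push (?N None) (lin copr (subst_forest w b))) (pruned \<tau>)"
    by (subst lin_subst_tree) (simp add: pr IH_ts \<tau>)
  also have "lin (\<lambda>(b, s). w s *\<^sub>R push (?N None) (lin copr (subst_forest w b))) (pruned \<tau>) =
      lin (\<lambda>(b, s). w s *\<^sub>R push (?N None) (lin (subst_tensor w) (copr b))) (pruned \<tau>)"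
    by (rule lin_cong) (auto simp: IH_b)
  also have "\<dots> = lin (\<lambda>(b, c). lin (\<lambda>(x, y). ?f (x, y, c)) (copr b)) (copr ts)"
    by (simp add: \<tau> pruned_Node case_prod_unfold push_lin lin_scaleR_fun)
  also have "\<dots> = lin ?f (lin (\<lambda>(a, b). push (\<lambda>(a1, a2). (a1, a2, b)) (copr a)) (copr ts))"
    by (simp add: lin_lin case_prod_unfold)
  also have "\<dots> = lin ?f (lin (\<lambda>(a, b). push (\<lambda>(b1, b2). (a, b1, b2)) (copr b)) (copr ts))"
    by (simp only: copr_coassoc)
  also have "\<dots> = lin (\<lambda>(a, b). tensor (subst_forest w a)
      (lin (\<lambda>(b', s). w s *\<^sub>R push (Node None) (subst_forest w b')) (pruned (Node i b)))) (copr ts)"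
    by (simp add: lin_lin case_prod_unfold pruned_Node tensor_lin_right tensor_scaleR_right tensor_push_right
        subst_tensor_def)
  also have "push (?N i) (lin (subst_tensor w) (copr ts)) =
      lin (\<lambda>(a, b). tensor (subst_forest w a) (push (Node i) (subst_forest w b))) (copr ts)"
    by (simp add: push_lin subst_tensor_def case_prod_unfold tensor_push_right)
  also have "lin (\<lambda>(a, b). tensor (subst_forest w a) (push (Node i) (subst_forest w b))) (copr ts) +
      lin (\<lambda>(a, b). tensor (subst_forest w a)
        (lin (\<lambda>(b', s). w s *\<^sub>R push (Node None) (subst_forest w b')) (pruned (Node i b)))) (copr ts) =
      lin (\<lambda>(a, s). tensor (subst_forest w a) (subst_tree w s)) (pruned \<tau>)"
    by (simp add: \<tau> pruned_Node[of i ts] case_prod_unfold tensor_add_right lin_add_fun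
        subst_tree_rec[where \<tau> = "Node i b" for b])
  finally show ?case .
qed

corollary copr_subst_forest: "lin copr (subst_forest w F) = lin (subst_tensor w) (copr F)"
  by (rule copr_subst_forest_of_trees) (rule pruned_subst_tree)

lemma lin_subst_forest_noise_only:
  assumes "\<And>F. (\<exists>t\<in>#F. None \<in> set_tree t) \<Longrightarrow> g F = 0"
    and "\<And>t f. t \<in># F \<Longrightarrow> (\<And>s. None \<in> set_tree s \<Longrightarrow> f s = (0::'v::real_vector)) \<Longrightarrow> lin f (subst_tree w t) = f t"
  shows "lin g (subst_forest w F) = (g F :: 'v)"
  using assms
proof (induction F arbitrary: g)
  case (add t F)
  have "lin g (subst_forest w (add_mset t F)) = lin (\<lambda>s. lin (\<lambda>b. g (add_mset s b)) (subst_forest w F)) (subst_tree w t)"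
    by (simp add: subst_forest_add lin_times_iterated)
  also have "\<dots> = lin (\<lambda>s. g (add_mset s F)) (subst_tree w t)"
    by (rule lin_cong, rule add.IH) (use add.prems in auto)
  also have "\<dots> = g (add_mset t F)"
    using add.prems by simp
  finally show ?case .
qed (simp add: lin_unit)

text \<open>Each extraction creates a node with label 0. A function that vanishes on trees with such
  a node therefore sees only the term in which nothing is extracted.\<close>

lemma lin_subst_tree_noise_only:
  assumes "\<And>t. None \<in> set_tree t \<Longrightarrow> f t = 0"
  shows "lin f (subst_tree w \<tau>) = (f \<tau> :: 'v::real_vector)"
  using assms
proof (induction \<tau> arbitrary: f rule: tree_induct)
  case (Node i ts)
  have "lin (\<lambda>H. f (Node i H)) (subst_forest w ts) = f (Node i ts)"
    by (rule lin_subst_forest_noise_only) (use Node in auto)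
  then show ?case by (simp add: lin_subst_tree Node.prems case_prod_unfold)
qed

lemma lin_subst_forest_subst_forest:
  assumes "\<And>t. t \<in># F \<Longrightarrow> lin (subst_tree v) (subst_tree v' t) = subst_tree u t"
  shows "lin (subst_forest v) (subst_forest v' F) = subst_forest u F"
proof -
  have "lin (subst_forest v) (push (\<lambda>s. {#s#}) (subst_tree v' t)) = push (\<lambda>s. {#s#}) (subst_tree u t)" if "t \<in># F" for t
    unfolding assms[OF that, symmetric] by (simp add: push_lin)
  then show ?thesis
    unfolding subst_forest_def[of v' F] subst_forest_def[of u F]
    by (subst lin_prod_mset) (auto simp: subst_forest_union intro!: arg_cong[where f = prod_mset] image_mset_cong)
qed

text \<open>The root is extracted by the inner map, with weight \<open>v'\<close>, or by the outer
  one, which cuts the result of the inner map. By \<open>pruned_subst_tree\<close> that cut can be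
  made beforehand, and in the substituted trunk \<open>v\<close> sees the unchanged trunk only. So
  the weights of a trunk add up.\<close>

theorem subst_tree_subst_tree:
  assumes v: "\<And>t. None \<in> set_tree t \<Longrightarrow> v t = 0"
  shows "lin (subst_tree v) (subst_tree v' \<tau>) = subst_tree (\<lambda>t. v t + v' t) \<tau>"
proof (induction "num_nodes \<tau>" arbitrary: \<tau> rule: less_induct)
  case less
  let ?u = "\<lambda>t. v t + v' t"
  obtain i ts where \<tau>: "\<tau> = Node i ts" by (cases \<tau>)
  have IH_ts: "lin (subst_forest v) (subst_forest v' ts) = subst_forest ?u ts"
    by (rule lin_subst_forest_subst_forest, rule less) (simp add: \<tau> num_nodes_kid del: num_nodes.simps)
  have IH_b: "lin (subst_forest v) (subst_forest v' b) = subst_forest ?u b" if "(b, s) \<in> Poly_Mapping.keys (pruned \<tau>)" for b s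
    by (rule lin_subst_forest_subst_forest, rule less) (rule num_nodes_pruned[OF that])
  \<comment> \<open>The two terms of the recursion of the outer map: \<open>A\<close> keeps the
    root, \<open>B\<close> extracts it.\<close>
  define A where "A = (\<lambda>t. push (Node (root_label t)) (subst_forest v (kids t)))"
  define B where "B = (\<lambda>(b, s). v s *\<^sub>R push (Node None) (subst_forest v b))"
  have 1: "lin A (subst_tree v' \<tau>) = push (Node i) (subst_forest ?u ts) +
      lin (\<lambda>(b, s). v' s *\<^sub>R push (Node None) (lin (subst_forest v) (subst_forest v' b))) (pruned \<tau>)"
    by (subst lin_subst_tree) (simp add: A_def \<tau> IH_ts[symmetric] push_lin)
  have "lin (\<lambda>t. lin B (pruned t)) (subst_tree v' \<tau>) =
      lin B (lin (\<lambda>(a, s). tensor (subst_forest v' a) (subst_tree v' s)) (pruned \<tau>))"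
    unfolding pruned_subst_tree[symmetric] by (simp add: lin_lin)
  also have "\<dots> = lin (\<lambda>(b, s). lin (\<lambda>c. lin (\<lambda>t. v t *\<^sub>R push (Node None) (subst_forest v c)) (subst_tree v' s))
      (subst_forest v' b)) (pruned \<tau>)"
    by (simp add: lin_lin case_prod_unfold tensor_lin B_def)
  also have "\<dots> = lin (\<lambda>(b, s). v s *\<^sub>R push (Node None) (lin (subst_forest v) (subst_forest v' b))) (pruned \<tau>)"
    by (simp add: lin_subst_tree_noise_only v push_lin lin_scaleR_fun)
  finally have 2: "lin (\<lambda>t. lin B (pruned t)) (subst_tree v' \<tau>) =
      lin (\<lambda>(b, s). v s *\<^sub>R push (Node None) (lin (subst_forest v) (subst_forest v' b))) (pruned \<tau>)" .
  have "lin (subst_tree v) (subst_tree v' \<tau>) = lin A (subst_tree v' \<tau>) + lin (\<lambda>t. lin B (pruned t)) (subst_tree v' \<tau>)"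
    unfolding lin_add_fun[symmetric] A_def B_def by (subst (1) subst_tree_rec[abs_def]) simp
  also have "\<dots> = push (Node i) (subst_forest ?u ts) +
      lin (\<lambda>(b, s). (v s + v' s) *\<^sub>R push (Node None) (lin (subst_forest v) (subst_forest v' b))) (pruned \<tau>)"
    unfolding 1 2 by (simp add: lin_add_fun case_prod_unfold scaleR_add_left)
  also have "lin (\<lambda>(b, s). (v s + v' s) *\<^sub>R push (Node None) (lin (subst_forest v) (subst_forest v' b))) (pruned \<tau>) =
      lin (\<lambda>(b, s). (v s + v' s) *\<^sub>R push (Node None) (subst_forest ?u b)) (pruned \<tau>)"
    by (rule lin_cong) (auto simp: IH_b)
  finally show ?case by (subst subst_tree_rec) (simp add: \<tau>)
qed

lemma subst_forest_zero_of_trees: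
  "(\<And>t. t \<in># F \<Longrightarrow> subst_tree (\<lambda>_. 0) t = vec t) \<Longrightarrow> subst_forest (\<lambda>_. 0) F = vec F"
proof (induction F)
  case (add t F)
  then have "subst_forest (\<lambda>_. 0) (add_mset t F) = vec {#t#} * vec F"
    by (simp add: subst_forest_add)
  then show ?case by (simp flip: vec_plus)
qed (simp flip: vec_zero)

lemma subst_tree_zero: "subst_tree (\<lambda>_. 0) \<tau> = vec \<tau>"
proof (induction \<tau> rule: tree_induct)
  case (Node i ts)
  then show ?case by (subst subst_tree_rec) (simp add: subst_forest_zero_of_trees case_prod_unfold)
qed

section \<open>Counit, single nodes and weights under substitution\<close>

abbreviation empty_indicator :: "'a multiset \<Rightarrow> real" where
  "empty_indicator F \<equiv> (if F = {#} then 1 else 0)"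

lemma empty_indicator_subst_forest: "lin empty_indicator (subst_forest w F) = empty_indicator F"
proof -
  have "lin empty_indicator (subst_forest w F) = (\<Prod>t\<in>#F. (0::real))"
    unfolding subst_forest_def by (subst lin_prod_mset) auto
  then show ?thesis by (induction F) auto
qed

lemma copr_counit: "lin (\<lambda>(a, b). empty_indicator a *\<^sub>R vec b) (copr F) = vec F"
proof -
  let ?e = "\<lambda>(a, b). empty_indicator a *\<^sub>R vec b"
  have e0: "?e 0 = 1" by (simp add: zero_prod_def flip: vec_zero)
  have e_add: "?e (x + y) = ?e x * ?e y" for x y :: "'a tree multiset \<times> 'a tree multiset"
    by (auto simp: case_prod_unfold vec_plus)
  have forest: "lin ?e (copr F) = vec F" if "\<And>t. t \<in># F \<Longrightarrow> lin ?e (copr_tree t) = vec {#t#}" for F :: "'a tree multiset"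
    using that
  proof (induction F)
    case (add t F)
    have "lin ?e (copr (add_mset t F)) = vec {#t#} * vec F"
      using add by (simp add: copr_def lin_times[OF e_add])
    then show ?case by (simp flip: vec_plus)
  qed (simp add: lin_unit zero_prod_def)
  have "lin ?e (copr_tree \<tau>) = vec {#\<tau>#}" for \<tau> :: "'a tree"
  proof (induction \<tau> rule: tree_induct)
    case (Node i ts)
    have "lin ?e (copr_tree (Node i ts)) = push (\<lambda>b. {#Node i b#}) (lin ?e (copr ts))"
      by (simp add: lin_copr_tree pruned_Node case_prod_unfold push_lin push_scaleR)
    then show ?case using forest[OF Node] by simp
  qed
  then show ?thesis using forest by blast
qed

lemma pruned_counit: "lin (\<lambda>(a, s). empty_indicator a * f s) (pruned \<tau>) = f \<tau>"
proof (cases \<tau>)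
  case (Node i ts)
  have "lin (\<lambda>(a, s). empty_indicator a * f s) (pruned \<tau>) =
      lin (\<lambda>b. f (Node i b)) (lin (\<lambda>(a, b). empty_indicator a *\<^sub>R vec b) (copr ts))"
    by (simp add: Node pruned_Node lin_lin case_prod_unfold lin_scaleR del: scaleR_eq_0_iff)
  then show ?thesis by (simp add: copr_counit Node)
qed

text \<open>A single node labelled 0 remains if the whole tree is extracted, with weight
  \<open>w \<tau>\<close>, or if \<tau> is such a node and is left alone. These coefficients are the
  values of the transpose at the one-node trees.\<close>

lemma lookup_subst_tree_single:
  "Poly_Mapping.lookup (subst_tree w \<tau>) (Node None {#}) = (if \<tau> = Node None {#} then 1 else 0) + w \<tau>"
  "Poly_Mapping.lookup (subst_tree w \<tau>) (Node (Some i) {#}) = (if \<tau> = Node (Some i) {#} then 1 else 0)"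
proof -
  have *: "lin (\<lambda>H. if P \<and> H = {#} then 1 else 0) (subst_forest w F) = (if P \<and> F = {#} then 1 else (0::real))" for F P
    using empty_indicator_subst_forest[of w F] by (cases P) auto
  show "Poly_Mapping.lookup (subst_tree w \<tau>) (Node None {#}) = (if \<tau> = Node None {#} then 1 else 0) + w \<tau>"
    using pruned_counit[of w \<tau>]
    by (cases \<tau>) (simp add: lookup_eq_lin lin_subst_tree * empty_indicator_subst_forest mult.commute lin_unit)
  show "Poly_Mapping.lookup (subst_tree w \<tau>) (Node (Some i) {#}) = (if \<tau> = Node (Some i) {#} then 1 else 0)"
    by (cases \<tau>) (simp add: lookup_eq_lin lin_subst_tree * case_prod_unfold lin_unit)
qed

lemma weight_pruned: "(b, s) \<in> Poly_Mapping.keys (pruned \<tau>) \<Longrightarrow> (\<Sum>t\<in>#b. weight \<alpha> t) + weight \<alpha> s = weight \<alpha> \<tau>"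
  by (rule keys_pruned[of "weight \<alpha>" "\<lambda>i. if i = None then 1 else \<alpha>"]) (rule weight_Node)

lemma weight_subst_forest_of_trees:
  assumes "\<And>t s. t \<in># F \<Longrightarrow> s \<in> Poly_Mapping.keys (subst_tree w t) \<Longrightarrow> weight \<alpha> t \<le> weight \<alpha> s"
    and "H \<in> Poly_Mapping.keys (subst_forest w F)"
  shows "(\<Sum>t\<in>#F. weight \<alpha> t) \<le> (\<Sum>t\<in>#H. weight \<alpha> t) \<and> size H = size F"
  using assms
proof (induction F arbitrary: H)
  case empty
  then show ?case by (simp flip: vec_zero)
next
  case (add t F)
  have "H \<in> Poly_Mapping.keys (push (\<lambda>s. {#s#}) (subst_tree w t) * subst_forest w F)"
    using add.prems(2) by (simp add: subst_forest_add)
  then obtain a b where ab: "a \<in> Poly_Mapping.keys (push (\<lambda>s. {#s#}) (subst_tree w t))"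
    "b \<in> Poly_Mapping.keys (subst_forest w F)" "H = a + b"
    using keys_times_subset[of "push (\<lambda>s. {#s#}) (subst_tree w t)" "subst_forest w F"] by blast
  then obtain s where s: "a = {#s#}" "s \<in> Poly_Mapping.keys (subst_tree w t)"
    using keys_push[of "\<lambda>s. {#s#}"] by blast
  have "weight \<alpha> t \<le> weight \<alpha> s" using add.prems(1)[of t s] s(2) by simp
  moreover have "(\<Sum>t\<in>#F. weight \<alpha> t) \<le> (\<Sum>t\<in>#b. weight \<alpha> t) \<and> size b = size F"
    by (rule add.IH) (use add.prems(1) ab(2) in auto)
  ultimately show ?case by (simp add: ab(3) s(1))
qed

text \<open>An extracted trunk has weight below 1 and is replaced by a node of weight 1, so each
  extraction raises the weight.\<close>

lemma weight_subst_tree: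
  assumes \<alpha>: "0 < \<alpha>" and w: "\<And>t. w t \<noteq> 0 \<Longrightarrow> t \<in> trees_minus \<alpha>"
    and "s \<in> Poly_Mapping.keys (subst_tree w \<tau>)"
  shows "weight \<alpha> \<tau> \<le> weight \<alpha> s"
  using assms(3)
proof (induction "num_nodes \<tau>" arbitrary: \<tau> s rule: less_induct)
  case less
  obtain i ts where \<tau>: "\<tau> = Node i ts" by (cases \<tau>)
  have "s \<in> Poly_Mapping.keys (push (Node i) (subst_forest w ts)) \<or>
      s \<in> Poly_Mapping.keys (lin (\<lambda>(b, s). w s *\<^sub>R push (Node None) (subst_forest w b)) (pruned \<tau>))"
    using less.prems keys_add[of "push (Node i) (subst_forest w ts)"
        "lin (\<lambda>(b, s). w s *\<^sub>R push (Node None) (subst_forest w b)) (pruned \<tau>)"]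
    by (subst (asm) subst_tree_rec) (simp add: \<tau> subset_iff)
  then show ?case
  proof
    assume "s \<in> Poly_Mapping.keys (push (Node i) (subst_forest w ts))"
    then obtain H where H: "H \<in> Poly_Mapping.keys (subst_forest w ts)" "s = Node i H"
      using keys_push[of "Node i" "subst_forest w ts"] by blast
    have "(\<Sum>t\<in>#ts. weight \<alpha> t) \<le> (\<Sum>t\<in>#H. weight \<alpha> t)"
      using weight_subst_forest_of_trees[of ts w \<alpha> H] less.hyps num_nodes_kid[of _ ts i] H(1) unfolding \<tau> by blast
    then show ?thesis by (simp add: \<tau> H weight_Node)
  next
    assume "s \<in> Poly_Mapping.keys (lin (\<lambda>(b, s). w s *\<^sub>R push (Node None) (subst_forest w b)) (pruned \<tau>))"
    then obtain b r where br: "(b, r) \<in> Poly_Mapping.keys (pruned \<tau>)"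
      "s \<in> Poly_Mapping.keys (w r *\<^sub>R push (Node None) (subst_forest w b))"
      using keys_lin[of "\<lambda>(b, s). w s *\<^sub>R push (Node None) (subst_forest w b)" "pruned \<tau>"] by (auto simp: subset_iff)
    then have "w r \<noteq> 0" "s \<in> Poly_Mapping.keys (push (Node None) (subst_forest w b))"
      by (auto simp: in_keys_iff)
    then obtain H where H: "H \<in> Poly_Mapping.keys (subst_forest w b)" "s = Node None H"
      using keys_push[of "Node None" "subst_forest w b"] by blast
    have "(\<Sum>t\<in>#b. weight \<alpha> t) \<le> (\<Sum>t\<in>#H. weight \<alpha> t)"
      using weight_subst_forest_of_trees[of b w \<alpha> H] less.hyps num_nodes_pruned[OF br(1)] H(1) by blast
    moreover have "weight \<alpha> r < 1" using w[OF \<open>w r \<noteq> 0\<close>] trees_minus_iff[OF \<alpha>] by blast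
    ultimately show ?thesis
      using weight_pruned[OF br(1), of \<alpha>] by (simp add: H weight_Node)
  qed
qed

lemma weight_subst_forest:
  assumes "0 < \<alpha>" "\<And>t. w t \<noteq> 0 \<Longrightarrow> t \<in> trees_minus \<alpha>" "H \<in> Poly_Mapping.keys (subst_forest w F)"
  shows "(\<Sum>t\<in>#F. weight \<alpha> t) \<le> (\<Sum>t\<in>#H. weight \<alpha> t)" "size H = size F"
  using weight_subst_forest_of_trees[OF weight_subst_tree[OF assms(1,2)] assms(3)] by auto

section \<open>Single cuts and the linear part of the coproduct\<close>

definition single_cuts :: "'l tree \<Rightarrow> ('l tree \<times> 'l tree \<Rightarrow>\<^sub>0 real)" where
  "single_cuts \<tau> = (\<Sum>q\<in>verts kids \<tau> - {[]}. vec (sub \<tau> q, cut_trunk \<tau> q))"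

lemma lookup_single_cuts: "Poly_Mapping.lookup (single_cuts \<tau>) (\<tau>1, \<tau>2) = real (num_cuts \<tau>1 \<tau>2 \<tau>)"
proof -
  have "Poly_Mapping.lookup (single_cuts \<tau>) (\<tau>1, \<tau>2) =
      (\<Sum>q\<in>verts kids \<tau> - {[]}. if sub \<tau> q = \<tau>1 \<and> cut_trunk \<tau> q = \<tau>2 then 1 else 0)"
    unfolding single_cuts_def lookup_sum lookup_vec by (rule sum.cong) auto
  also have "\<dots> = real (card {q \<in> verts kids \<tau> - {[]}. sub \<tau> q = \<tau>1 \<and> cut_trunk \<tau> q = \<tau>2})"
    by (simp add: sum.inter_filter[symmetric])
  also have "{q \<in> verts kids \<tau> - {[]}. sub \<tau> q = \<tau>1 \<and> cut_trunk \<tau> q = \<tau>2} =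
      {q \<in> verts kids \<tau>. q \<noteq> [] \<and> sub \<tau> q = \<tau>1 \<and> cut_trunk \<tau> q = \<tau>2}"
    by auto
  finally show ?thesis by (simp add: num_cuts_def)
qed

lemma cut_trunk_piece: "cut_trunk \<tau> q = piece \<tau> (verts kids \<tau> - {q}) []"
proof -
  have "{r \<in> verts kids \<tau>. is_child p r \<and> r \<noteq> q} = {r \<in> verts kids \<tau> - {q}. is_child p r}" for p
    by auto
  then show ?thesis by (simp add: cut_trunk_def piece_def)
qed

lemma all_but_joinings: "(verts kids \<tau>, verts kids \<tau> - Q) \<in> joinings \<tau>"
  by (auto simp: joinings_def verts_butlast)

lemma below_verts: "e \<in> copies ts \<Longrightarrow> below e (verts kids (Node i ts) - Q) = verts kids (fst e) - below e Q"
  by auto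

lemma sum_mset_copies: "(\<Sum>e\<in>copies ts. {#f (fst e)#}) = image_mset f ts"
  using sum_copies[of "\<lambda>t. {#f t#}" ts] by simp

lemma in_copies_fst: "e \<in> copies ts \<Longrightarrow> fst e \<in># ts"
  by (simp add: count_greater_zero_iff[symmetric] del: count_greater_zero_iff)

lemma piece_verts: "piece \<tau> (verts kids \<tau>) [] = \<tau>"
proof (induction \<tau> rule: tree_induct)
  case (Node i ts)
  have "(\<Sum>e\<in>copies ts. if [e] \<in> verts kids (Node i ts)
      then {#piece (fst e) (below e (verts kids (Node i ts))) []#} else {#}) = (\<Sum>e\<in>copies ts. {#fst e#})"
  proof (rule sum.cong)
    fix e assume e: "e \<in> copies ts"
    then have "below e (verts kids (Node i ts)) = verts kids (fst e)"
      using below_verts[of e ts i "{}"] by (simp add: below_def del: copies_iff)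
    then show "(if [e] \<in> verts kids (Node i ts)
      then {#piece (fst e) (below e (verts kids (Node i ts))) []#} else {#}) = {#fst e#}"
      using Node[OF in_copies_fst[OF e]] e by simp
  qed simp
  then show ?case
    using piece_Nil[OF all_but_joinings[of "Node i ts" "{}"]] sum_mset_copies[of "\<lambda>t. t" ts] by simp
qed

text \<open>Cutting the edge above a branch removes the branch, cutting inside changes it alone.
  Only the copy \<open>e\<close> is affected, hence one copy is taken out of the multiset
  \<open>ts\<close>.\<close>

lemma cut_trunk_Cons:
  assumes e: "e \<in> copies ts" and q: "q \<in> verts kids (fst e)"
  shows "cut_trunk (Node i ts) (e # q) =
    Node i ((if q = [] then {#} else {#cut_trunk (fst e) q#}) + (ts - {#fst e#}))"
proof -
  let ?L = "verts kids (Node i ts) - {e # q}"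
  let ?f = "\<lambda>x. if [x] \<in> ?L then {#piece (fst x) (below x ?L) []#} else {#}"
  have other: "?f x = {#fst x#}" if "x \<in> copies ts - {e}" for x
  proof -
    have "below x ?L = verts kids (fst x)"
      using that below_verts[of x ts i "{e # q}"] by (auto simp: below_def simp del: copies_iff)
    then show ?thesis using that by (simp add: piece_verts)
  qed
  have this_one: "?f e = (if q = [] then {#} else {#cut_trunk (fst e) q#})"
  proof -
    have "below e ?L = verts kids (fst e) - {q}"
      unfolding below_verts[OF e] by (auto simp: below_def)
    then show ?thesis using e by (simp add: cut_trunk_piece)
  qed
  have "(\<Sum>x\<in>copies ts. {#fst x#}) = {#fst e#} + (\<Sum>x\<in>copies ts - {e}. {#fst x#})"
    by (rule sum.remove) (use e in simp_all)
  then have rest: "(\<Sum>x\<in>copies ts - {e}. {#fst x#}) = ts - {#fst e#}"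
    using sum_mset_copies[of "\<lambda>t. t" ts] by simp (metis add_mset_remove_trivial)
  have "(\<Sum>x\<in>copies ts. ?f x) = ?f e + (\<Sum>x\<in>copies ts - {e}. ?f x)"
    by (rule sum.remove) (use e in simp_all)
  also have "(\<Sum>x\<in>copies ts - {e}. ?f x) = (\<Sum>x\<in>copies ts - {e}. {#fst x#})"
    by (rule sum.cong[OF refl]) (rule other)
  finally show ?thesis
    unfolding cut_trunk_piece[of "Node i ts"] piece_Nil[OF all_but_joinings[of "Node i ts"]] this_one rest by simp
qed

lemma single_cuts_Node:
  "single_cuts (Node i ts) = (\<Sum>t\<in>#ts. vec (t, Node i (ts - {#t#})) +
     push (\<lambda>(b, s). (b, Node i (add_mset s (ts - {#t#})))) (single_cuts t))"
proof -
  have "verts kids (Node i ts) - {[]} = (\<Union>e\<in>copies ts. (#) e ` verts kids (fst e))"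
    by (auto simp: verts_Node)
  then have "single_cuts (Node i ts) = (\<Sum>e\<in>copies ts. \<Sum>q\<in>(#) e ` verts kids (fst e).
      vec (sub (Node i ts) q, cut_trunk (Node i ts) q))"
    unfolding single_cuts_def by (simp only:, intro sum.UNION_disjoint) auto
  also have "\<dots> = (\<Sum>e\<in>copies ts. vec (fst e, Node i (ts - {#fst e#})) +
     push (\<lambda>(b, s). (b, Node i (add_mset s (ts - {#fst e#})))) (single_cuts (fst e)))"
  proof (rule sum.cong)
    fix e assume e: "e \<in> copies ts"
    have "(\<Sum>q\<in>(#) e ` verts kids (fst e). vec (sub (Node i ts) q, cut_trunk (Node i ts) q)) =
        (\<Sum>q\<in>verts kids (fst e). vec (sub (fst e) q, cut_trunk (Node i ts) (e # q)))"
      by (subst sum.reindex) simp_all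
    also have "\<dots> = vec (fst e, cut_trunk (Node i ts) [e]) +
        (\<Sum>q\<in>verts kids (fst e) - {[]}. vec (sub (fst e) q, cut_trunk (Node i ts) (e # q)))"
      by (subst sum.remove[of _ "[]"]) simp_all
    also have "(\<Sum>q\<in>verts kids (fst e) - {[]}. vec (sub (fst e) q, cut_trunk (Node i ts) (e # q))) =
        push (\<lambda>(b, s). (b, Node i (add_mset s (ts - {#fst e#})))) (single_cuts (fst e))"
      unfolding single_cuts_def push_sum by (rule sum.cong) (simp_all add: cut_trunk_Cons[OF e])
    finally show "(\<Sum>q\<in>(#) e ` verts kids (fst e). vec (sub (Node i ts) q, cut_trunk (Node i ts) q)) =
        vec (fst e, Node i (ts - {#fst e#})) +
        push (\<lambda>(b, s). (b, Node i (add_mset s (ts - {#fst e#})))) (single_cuts (fst e))"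
      by (simp add: cut_trunk_Cons[OF e])
  qed simp
  finally show ?thesis
    by (simp add: sum_copies[of "\<lambda>t. vec (t, Node i (ts - {#t#})) +
     push (\<lambda>(b, s). (b, Node i (add_mset s (ts - {#t#})))) (single_cuts t)"])
qed

text \<open>For \<open>n = 1\<close> this is the part of the coproduct that is linear in the left
  factor, to be compared with single cuts.\<close>

definition branches_of_size :: "nat \<Rightarrow> ('l tree multiset \<times> 'l tree multiset \<Rightarrow>\<^sub>0 real) \<Rightarrow> ('l tree multiset \<times> 'l tree multiset \<Rightarrow>\<^sub>0 real)" where
  "branches_of_size n = lin (\<lambda>(a, b). if size a = n then vec (a, b) else 0)"

lemma branches_of_size_add: "branches_of_size n (x + y) = branches_of_size n x + branches_of_size n y"
  by (simp add: branches_of_size_def lin_add)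

text \<open>The numbers of branches add up in a product: no branch in total means none in either
  factor, and a single branch comes from exactly one factor, which is a Leibniz rule.\<close>

lemma branches_of_size_times:
  "branches_of_size 0 (x * y) = branches_of_size 0 x * branches_of_size 0 y"
  "branches_of_size (Suc 0) (x * y) =
    branches_of_size (Suc 0) x * branches_of_size 0 y + branches_of_size 0 x * branches_of_size (Suc 0) y"
proof -
  let ?g = "\<lambda>n (a, b). if size a = n then vec (a, b) else (0 :: ('a tree multiset \<times> 'a tree multiset \<Rightarrow>\<^sub>0 real))"
  have "?g 0 (p + q) = ?g 0 p * ?g 0 q" for p q
    by (auto simp: case_prod_unfold simp flip: vec_plus)
  then show "branches_of_size 0 (x * y) = branches_of_size 0 x * branches_of_size 0 y"
    unfolding branches_of_size_def by (rule lin_times)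
  have g1: "?g (Suc 0) (p + q) = ?g (Suc 0) p * ?g 0 q + ?g 0 p * ?g (Suc 0) q" for p q
    by (cases p; cases q) (auto simp: add_is_1 simp flip: vec_plus)
  have "lin (?g (Suc 0)) (x * y) = lin (\<lambda>p. lin (\<lambda>q. ?g (Suc 0) p * ?g 0 q + ?g 0 p * ?g (Suc 0) q) y) x"
    unfolding lin_times_iterated g1 ..
  then show "branches_of_size (Suc 0) (x * y) =
    branches_of_size (Suc 0) x * branches_of_size 0 y + branches_of_size 0 x * branches_of_size (Suc 0) y"
    unfolding branches_of_size_def by (simp only: lin_add_fun lin_mult_left lin_mult_right)
qed

lemma branches_of_size_push:
  "branches_of_size n (push (\<lambda>(a, b). (a, f b)) x) = push (\<lambda>(a, b). (a, f b)) (branches_of_size n x)"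
  unfolding branches_of_size_def push_lin lin_push by (rule lin_cong) (auto simp: case_prod_unfold)

lemma branches_of_size_0: "branches_of_size 0 (copr F) = vec ({#}, F)"
proof -
  have "branches_of_size 0 (copr F) = push (\<lambda>b. ({#}, b)) (lin (\<lambda>(a, b). empty_indicator a *\<^sub>R vec b) (copr F))"
    unfolding branches_of_size_def push_lin by (rule lin_cong) (auto simp: push_scaleR)
  then show ?thesis by (simp add: copr_counit)
qed

lemma branches_of_size_1_of_trees:
  "branches_of_size (Suc 0) (copr F) = (\<Sum>t\<in>#F. branches_of_size (Suc 0) (copr_tree t) * vec ({#}, F - {#t#}))"
proof (induction F)
  case empty
  show ?case by (simp add: branches_of_size_def lin_unit zero_prod_def)
next
  case (add t F)
  have *: "vec ({#}, {#t#}) * (branches_of_size (Suc 0) (copr_tree s) * vec ({#}, F - {#s#})) =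
      branches_of_size (Suc 0) (copr_tree s) * vec ({#}, add_mset t F - {#s#})" if "s \<in># F" for s
  proof -
    have "vec ({#}, {#t#}) * vec ({#}, F - {#s#}) = vec ({#}, add_mset t F - {#s#})"
      using that by (simp flip: vec_plus)
    then show ?thesis
      by (rule subst) (rule mult.left_commute)
  qed
  have "branches_of_size (Suc 0) (copr (add_mset t F)) =
      branches_of_size (Suc 0) (copr_tree t * copr F)"
    by (simp add: copr_def)
  also have "\<dots> = branches_of_size (Suc 0) (copr_tree t) * vec ({#}, F) +
      vec ({#}, {#t#}) * (\<Sum>s\<in>#F. branches_of_size (Suc 0) (copr_tree s) * vec ({#}, F - {#s#}))"
    using branches_of_size_0[of "{#t#}"] by (simp add: branches_of_size_times branches_of_size_0 add.IH)
  also have "vec ({#}, {#t#}) * (\<Sum>s\<in>#F. branches_of_size (Suc 0) (copr_tree s) * vec ({#}, F - {#s#})) =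
      (\<Sum>s\<in>#F. branches_of_size (Suc 0) (copr_tree s) * vec ({#}, add_mset t F - {#s#}))"
    unfolding sum_mset_distrib_left using * by (intro arg_cong[where f = sum_mset] image_mset_cong) blast
  finally show ?case by simp
qed

lemma push_sum_mset: "push f (\<Sum>t\<in>#M. g t) = (\<Sum>t\<in>#M. push f (g t))"
  by (induction M) (simp_all add: push_add)

text \<open>The edge of a single cut is the one above a branch of the root or lies inside that
  branch, which is the recursion that the Leibniz rule gives for the coproduct. The additional term
  \<tau> \<otimes> 1 cuts no edge.\<close>

lemma branches_of_size_1_tree:
  "branches_of_size (Suc 0) (copr_tree \<tau>) = vec ({#\<tau>#}, {#}) + push (\<lambda>(b, s). ({#b#}, {#s#})) (single_cuts \<tau>)"
proof (induction \<tau> rule: tree_induct)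
  case (Node i ts)
  have one: "push (\<lambda>(a, b). (a, {#Node i b#})) (branches_of_size (Suc 0) (copr_tree t) * vec ({#}, ts - {#t#})) =
      push (\<lambda>(b, s). ({#b#}, {#s#})) (vec (t, Node i (ts - {#t#})) +
     push (\<lambda>(b, s). (b, Node i (add_mset s (ts - {#t#})))) (single_cuts t))" if "t \<in># ts" for t
  proof -
    have "push f x * vec y = push (\<lambda>z. f z + y) x" for f :: "'a tree \<times> 'a tree \<Rightarrow> 'a tree multiset \<times> 'a tree multiset" and x y
      unfolding push_def lin_mult_right[symmetric] vec_plus ..
    then show ?thesis
      unfolding Node[OF that]
      by (simp add: distrib_right push_add push_push case_prod_unfold flip: vec_plus)
  qed
  have "branches_of_size (Suc 0) (copr_tree (Node i ts)) = vec ({#Node i ts#}, {#}) +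
      push (\<lambda>(a, b). (a, {#Node i b#})) (branches_of_size (Suc 0) (copr ts))"
    by (simp add: copr_tree.simps copr_def[symmetric] branches_of_size_add branches_of_size_push)
      (simp add: branches_of_size_def)
  also have "push (\<lambda>(a, b). (a, {#Node i b#})) (branches_of_size (Suc 0) (copr ts)) =
      (\<Sum>t\<in>#ts. push (\<lambda>(a, b). (a, {#Node i b#})) (branches_of_size (Suc 0) (copr_tree t) * vec ({#}, ts - {#t#})))"
    unfolding branches_of_size_1_of_trees by (rule push_sum_mset)
  also have "\<dots> = (\<Sum>t\<in>#ts. push (\<lambda>(b, s). ({#b#}, {#s#})) (vec (t, Node i (ts - {#t#})) +
     push (\<lambda>(b, s). (b, Node i (add_mset s (ts - {#t#})))) (single_cuts t)))"
    by (intro arg_cong[where f = sum_mset] image_mset_cong one)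
  also have "\<dots> = push (\<lambda>(b, s). ({#b#}, {#s#})) (single_cuts (Node i ts))"
    unfolding single_cuts_Node by (rule push_sum_mset[symmetric])
  finally show ?case .
qed

lemma lookup_branches_of_size: "Poly_Mapping.lookup (branches_of_size n x) (a, b) =
    (if size a = n then Poly_Mapping.lookup x (a, b) else 0)"
  by (auto simp: branches_of_size_def lookup_lin lookup_eq_lin[of x] lookup_vec case_prod_unfold intro!: lin_cong)
    (auto simp: lin_def lookup_vec intro!: sum.neutral)

lemma pre_lie_tree_series: "pre_lie f g \<in> tree_series"
  by (auto simp: tree_series_def pre_lie_def split: if_splits)

text \<open>A tree series pairs with the terms of one branch only, and the term \<tau> \<otimes> 1
  is killed because \<open>g\<close> vanishes at the empty forest. What remains are the single
  cuts.\<close>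

lemma pre_lie_eq_star:
  assumes f: "f \<in> tree_series" and g: "g \<in> tree_series"
  shows "pre_lie f g {#\<tau>#} = star f g {#\<tau>#}"
proof -
  have keys: "Poly_Mapping.keys (single_cuts \<tau>) = {(\<tau>1, \<tau>2). num_cuts \<tau>1 \<tau>2 \<tau> \<noteq> 0}"
    by (auto simp: in_keys_iff lookup_single_cuts)
  have "pre_lie f g {#\<tau>#} = lin (\<lambda>(\<tau>1, \<tau>2). f {#\<tau>1#} * g {#\<tau>2#}) (single_cuts \<tau>)"
    unfolding pre_lie_def lin_def keys by (auto simp: lookup_single_cuts mult.assoc intro!: sum.cong)
  moreover have f0: "f a = 0" if "size a \<noteq> Suc 0" for a
    using f that by (auto simp: tree_series_def)
  have "star f g {#\<tau>#} = lin (\<lambda>(a, b). f a * g b) (branches_of_size (Suc 0) (copr_tree \<tau>))"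
    unfolding star_def branches_of_size_def lin_lin by (auto simp: f0 intro!: lin_cong)
  moreover have "g {#} = 0" using g by (auto simp: tree_series_def)
  ultimately show ?thesis
    by (simp add: branches_of_size_1_tree lin_add case_prod_unfold)
qed


section \<open>Translation maps\<close>

text \<open>The transpose of \<open>subst_forest\<close>. It acts on arbitrary formal series because
  the substitution of a forest is a finite sum, and for the same reason it is continuous.\<close>

definition translate :: "('d forest \<Rightarrow> real) \<Rightarrow> ('d forest \<Rightarrow> real) \<Rightarrow> ('d forest \<Rightarrow> real)" where
  "translate v f = (\<lambda>F. lin f (subst_forest (\<lambda>t. v {#t#}) F))"

lemma translate_star: "translate v (star f g) = star (translate v f) (translate v g)"
proof
  fix F
  let ?w = "\<lambda>t. v {#t#}"
  have "translate v (star f g) F = lin (\<lambda>(a, b). f a * g b) (lin copr (subst_forest ?w F))"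
    by (simp add: translate_def star_def[abs_def] lin_lin)
  also have "\<dots> = star (translate v f) (translate v g) F"
    unfolding copr_subst_forest lin_lin star_def translate_def subst_tensor_def
    by (rule lin_cong) (simp add: case_prod_unfold tensor_lin lin_mult_left lin_mult_right)
  finally show "translate v (star f g) F = star (translate v f) (translate v g) F" .
qed

lemma continuous_on_lin_eval: "continuous_on UNIV (\<lambda>f :: 'a \<Rightarrow> real. lin f x)"
  unfolding lin_def by (intro continuous_intros) simp_all

context
  fixes \<alpha> :: real and v :: "'d forest \<Rightarrow> real"
  assumes \<alpha>: "0 < \<alpha>" and v: "v \<in> B_minus_dual \<alpha>"
begin

lemma B_minus_dual_support: "v {#t#} \<noteq> 0 \<Longrightarrow> t \<in> trees_minus \<alpha>"
  using v by (fastforce simp: B_minus_dual_def)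

lemma translate_tree_series:
  assumes "f \<in> tree_series"
  shows "translate v f \<in> tree_series"
proof -
  have "\<exists>\<tau>. F = {#\<tau>#}" if nz: "translate v f F \<noteq> 0" for F
  proof -
    let ?x = "subst_forest (\<lambda>t. v {#t#}) F"
    have "(\<Sum>H\<in>Poly_Mapping.keys ?x. Poly_Mapping.lookup ?x H * f H) \<noteq> 0"
      using nz by (simp add: translate_def lin_def)
    then obtain H where "H \<in> Poly_Mapping.keys ?x" "Poly_Mapping.lookup ?x H * f H \<noteq> 0"
      by (rule sum.not_neutral_contains_not_neutral)
    then have H: "H \<in> Poly_Mapping.keys ?x" "f H \<noteq> 0" by auto
    then obtain \<tau> where "H = {#\<tau>#}" using assms by (auto simp: tree_series_def)
    moreover have "size H = size F"
      by (rule weight_subst_forest(2)[OF \<alpha> B_minus_dual_support H(1)])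
    ultimately show ?thesis by (metis size_1_singleton_mset size_single)
  qed
  then show ?thesis by (simp add: tree_series_def)
qed

lemma translate_tree: "translate v f {#\<tau>#} = lin (\<lambda>s. f {#s#}) (subst_tree (\<lambda>t. v {#t#}) \<tau>)"
  by (simp add: translate_def)

lemma tree_series_eqI: "f \<in> tree_series \<Longrightarrow> g \<in> tree_series \<Longrightarrow> (\<And>\<tau>. f {#\<tau>#} = g {#\<tau>#}) \<Longrightarrow> f = g"
proof (rule ext)
  fix F assume *: "f \<in> tree_series" "g \<in> tree_series" "\<And>\<tau>. f {#\<tau>#} = g {#\<tau>#}"
  show "f F = g F"
  proof (cases "\<exists>\<tau>. F = {#\<tau>#}")
    case False
    then have "f F = 0" "g F = 0" using *(1,2) unfolding tree_series_def by blast+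
    then show ?thesis by simp
  qed (use *(3) in auto)
qed

lemma is_translation_translate: "is_translation v (translate v)"
  unfolding is_translation_def
proof (intro conjI allI ballI)
  show "translate v (\<lambda>F. a * f F + b * g F) = (\<lambda>F. a * translate v f F + b * translate v g F)" for a b f g
    by (simp add: translate_def lin_add_fun lin_mult_left)
  show "continuous_on UNIV (translate v)"
    unfolding translate_def[abs_def] by (intro continuous_on_coordinatewise_then_product continuous_on_lin_eval)
  show "translate v (dual_basis {#}) = dual_basis {#}"
    by (simp add: translate_def dual_basis_def empty_indicator_subst_forest)
  show "translate v (star f g) = star (translate v f) (translate v g)" for f g
    by (rule translate_star)
  show "translate v f \<in> tree_series" if "f \<in> tree_series" for f
    by (rule translate_tree_series[OF that])
  show "translate v (pre_lie f g) = pre_lie (translate v f) (translate v g)"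
    if fg: "f \<in> tree_series" "g \<in> tree_series" for f g
  proof (rule tree_series_eqI)
    fix \<tau>
    have "translate v (pre_lie f g) {#\<tau>#} = translate v (star f g) {#\<tau>#}"
      by (simp add: translate_tree pre_lie_eq_star[OF fg])
    also have "\<dots> = pre_lie (translate v f) (translate v g) {#\<tau>#}"
      by (simp add: translate_star pre_lie_eq_star[OF fg[THEN translate_tree_series]])
    finally show "translate v (pre_lie f g) {#\<tau>#} = pre_lie (translate v f) (translate v g) {#\<tau>#}" .
  qed (intro translate_tree_series pre_lie_tree_series)+
  have bullet: "bullet i \<in> tree_series" for i :: "'d option"
    by (auto simp: tree_series_def bullet_def dual_basis_def)
  have tr: "translate v (bullet i) {#\<tau>#} = Poly_Mapping.lookup (subst_tree (\<lambda>t. v {#t#}) \<tau>) (Node i {#})" for i \<tau>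
    by (simp add: translate_tree bullet_def dual_basis_def lookup_eq_lin)
  show "translate v (bullet None) = (\<lambda>F. bullet None F + v F)"
  proof (rule tree_series_eqI)
    show "(\<lambda>F. bullet None F + v F) \<in> tree_series"
      using v by (fastforce simp: tree_series_def B_minus_dual_def bullet_def dual_basis_def)
    show "translate v (bullet None) {#\<tau>#} = bullet None {#\<tau>#} + v {#\<tau>#}" for \<tau>
      unfolding tr lookup_subst_tree_single by (simp add: bullet_def dual_basis_def)
  qed (rule translate_tree_series[OF bullet])
  show "translate v (bullet (Some i)) = bullet (Some i)" for i
  proof (rule tree_series_eqI)
    show "translate v (bullet (Some i)) {#\<tau>#} = bullet (Some i) {#\<tau>#}" for \<tau>
      unfolding tr lookup_subst_tree_single by (simp add: bullet_def dual_basis_def)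
  qed (rule translate_tree_series[OF bullet], rule bullet)
qed

end

section \<open>Uniqueness of the translation map\<close>

text \<open>A basic neighbourhood of \<open>h\<close> in the product topology restricts finitely
  many coordinates, so it contains a truncation of \<open>h\<close>, where the two maps agree by
  linearity. Agreement is asked on the support of \<open>h\<close> only, which is what the later
  inductions provide.\<close>

lemma agree_density:
  fixes M M' :: "('a \<Rightarrow> real) \<Rightarrow> ('b \<Rightarrow> real)"
  assumes lin: "\<And>a b f g. M (\<lambda>F. a * f F + b * g F) = (\<lambda>F. a * M f F + b * M g F)"
      "\<And>a b f g. M' (\<lambda>F. a * f F + b * g F) = (\<lambda>F. a * M' f F + b * M' g F)"
    and cont: "continuous_on UNIV M" "continuous_on UNIV M'"
    and agree: "\<And>F. h F \<noteq> 0 \<Longrightarrow> M (dual_basis F) = M' (dual_basis F)"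
  shows "M h = M' h"
proof (rule ext, rule ccontr)
  fix G assume G: "M h G \<noteq> M' h G"
  have c: "continuous_on UNIV (\<lambda>f. M f G)" "continuous_on UNIV (\<lambda>f. M' f G)"
    using cont by (auto dest: continuous_on_product_then_coordinatewise)
  then have "closed {f. M f G = M' f G}"
    by (rule closed_Collect_eq)
  then have "open (- {f. M f G = M' f G})" by (rule open_Compl)
  then obtain X where X: "h \<in> PiE UNIV X" "finite {i. X i \<noteq> UNIV}" "PiE UNIV X \<subseteq> - {f. M f G = M' f G}"
    using product_topology_open_contains_basis[of "\<lambda>_. euclidean" UNIV "- {f. M f G = M' f G}" h] G
    by (auto simp: open_fun_def)
  have fin: "M (\<lambda>F. if F \<in> S then h F else 0) = M' (\<lambda>F. if F \<in> S then h F else 0)" if "finite S" for S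
    using that
  proof (induction S)
    case empty
    show ?case using lin(1)[of 0 _ 0] lin(2)[of 0 _ 0] by simp
  next
    case (insert F S)
    have eq: "(\<lambda>F'. if F' \<in> insert F S then h F' else 0) =
        (\<lambda>F'. h F * dual_basis F F' + 1 * (if F' \<in> S then h F' else 0))"
      using insert by (auto simp: dual_basis_def)
    show ?case
      unfolding eq lin insert.IH using agree[of F] by (cases "h F = 0") auto
  qed
  let ?S = "{i. X i \<noteq> UNIV}"
  have "(\<lambda>F. if F \<in> ?S then h F else 0) \<in> PiE UNIV X"
    using X(1) by (auto simp: PiE_def Pi_def)
  then show False using X(3) fin[OF X(2)] by (auto dest: fun_cong)
qed

text \<open>Grafting \<open>t\<close> onto \<open>Node i ts\<close> adds a child to the root or
  grafts inside a child. So the product is triangular: besides \<open>Node i (add_mset t ts)\<close>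
  it contains only trees of the same size with fewer children at the root.\<close>

lemma num_cuts_nonzero:
  assumes "num_cuts t (Node i ts) \<sigma> \<noteq> 0"
  shows "num_nodes \<sigma> = num_nodes (Node i (add_mset t ts))"
    "\<sigma> = Node i (add_mset t ts) \<or> size (kids \<sigma>) = size ts"
proof -
  have "Poly_Mapping.lookup (branches_of_size (Suc 0) (copr_tree \<sigma>)) ({#t#}, {#Node i ts#}) \<noteq> 0"
  proof -
    have "inj (\<lambda>(b, s). ({#b#}, {#s#}))" by (auto simp: inj_on_def)
    from lookup_push_inj[OF this, of "single_cuts \<sigma>" "(t, Node i ts)"] show ?thesis
      using assms by (simp add: branches_of_size_1_tree lookup_add lookup_vec lookup_single_cuts)
  qed
  then have "({#t#}, {#Node i ts#}) \<in> Poly_Mapping.keys (copr {#\<sigma>#})"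
    by (simp add: lookup_branches_of_size in_keys_iff)
  from keys_copr[of num_nodes "\<lambda>_. 1", OF _ this] show "num_nodes \<sigma> = num_nodes (Node i (add_mset t ts))"
    by simp
  obtain q where q: "q \<in> verts kids \<sigma>" "q \<noteq> []" "sub \<sigma> q = t" "cut_trunk \<sigma> q = Node i ts"
  proof -
    have "{q \<in> verts kids \<sigma>. q \<noteq> [] \<and> sub \<sigma> q = t \<and> cut_trunk \<sigma> q = Node i ts} \<noteq> {}"
      using assms unfolding num_cuts_def by (intro notI) (simp only: card.empty)
    then show thesis using that by blast
  qed
  obtain j us where \<sigma>: "\<sigma> = Node j us" by (cases \<sigma>)
  obtain e p where ep: "q = e # p" using q(2) by (cases q) auto
  have e: "e \<in> copies us" "p \<in> verts kids (fst e)" using q(1) by (auto simp: \<sigma> ep)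
  note cut = cut_trunk_Cons[OF e, of j]
  obtain us' where us': "us = add_mset (fst e) us'" using in_copies_fst[OF e(1)] by (metis multi_member_split)
  show "\<sigma> = Node i (add_mset t ts) \<or> size (kids \<sigma>) = size ts"
  proof (cases "p = []")
    case True
    then show ?thesis using q(3,4) cut by (auto simp: \<sigma> ep us')
  next
    case False
    then show ?thesis using q(4) cut by (auto simp: \<sigma> ep us')
  qed
qed

lemma num_cuts_graft: "num_cuts t (Node i ts) (Node i (add_mset t ts)) \<noteq> 0"
proof -
  let ?\<sigma> = "Node i (add_mset t ts)"
  have "(t, 0) \<in> copies (add_mset t ts)" by simp
  from cut_trunk_Cons[OF this, of "[]" i]
  have "[(t, 0)] \<in> {q \<in> verts kids ?\<sigma>. q \<noteq> [] \<and> sub ?\<sigma> q = t \<and> cut_trunk ?\<sigma> q = Node i ts}" by simp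
  moreover have "finite {q \<in> verts kids ?\<sigma>. q \<noteq> [] \<and> sub ?\<sigma> q = t \<and> cut_trunk ?\<sigma> q = Node i ts}" by simp
  ultimately show ?thesis unfolding num_cuts_def using card_0_eq by blast
qed

lemma pre_lie_dual_basis: "pre_lie (dual_basis {#t#}) (dual_basis {#s#}) {#\<sigma>#} = real (num_cuts t s \<sigma>)"
proof -
  have "dual_basis {#t#} \<in> tree_series" for t :: "'a tree"
    by (auto simp: tree_series_def dual_basis_def)
  note eq = pre_lie_eq_star[OF this this]
  have "star (dual_basis {#t#}) (dual_basis {#s#}) {#\<sigma>#} = Poly_Mapping.lookup (copr_tree \<sigma>) ({#t#}, {#s#})"
    unfolding star_def lookup_eq_lin copr_single by (rule lin_cong) (auto simp: dual_basis_def split: if_splits)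
  also have "\<dots> = Poly_Mapping.lookup (branches_of_size (Suc 0) (copr_tree \<sigma>)) ({#t#}, {#s#})"
    by (simp add: lookup_branches_of_size)
  also have "\<dots> = real (num_cuts t s \<sigma>)"
  proof -
    have "inj (\<lambda>(b, s). ({#b#}, {#s#}))" by (auto simp: inj_on_def)
    from lookup_push_inj[OF this, of "single_cuts \<sigma>" "(t, s)"] show ?thesis
      by (simp add: branches_of_size_1_tree lookup_add lookup_vec lookup_single_cuts)
  qed
  finally show ?thesis using eq by simp
qed

lemma lookup_push_nonneg:
  assumes "\<And>a. 0 \<le> Poly_Mapping.lookup x a"
  shows "0 \<le> Poly_Mapping.lookup (push f x) b"
  unfolding push_def lookup_lin unfolding lin_def lookup_vec by (intro sum_nonneg) (use assms in auto)

lemma lookup_sum_mset: "Poly_Mapping.lookup (\<Sum>t\<in>#M. f t) a = (\<Sum>t\<in>#M. Poly_Mapping.lookup (f t) a)"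
  by (induction M) (simp_all add: lookup_add)

lemma star_dual_basis:
  fixes t :: "'l tree"
  shows "star (dual_basis {#t#}) (dual_basis G) F = (\<Sum>s\<in>#F. Poly_Mapping.lookup
     (vec ({#s#}, F - {#s#}) + push (\<lambda>(b, r). ({#b#}, add_mset r (F - {#s#}))) (single_cuts s)) ({#t#}, G))"
proof -
  have "star (dual_basis {#t#}) (dual_basis G) F = Poly_Mapping.lookup (copr F) ({#t#}, G)"
    unfolding star_def lookup_eq_lin by (rule lin_cong) (auto simp: dual_basis_def split: if_splits)
  also have "\<dots> = Poly_Mapping.lookup (branches_of_size (Suc 0) (copr F)) ({#t#}, G)"
    by (simp add: lookup_branches_of_size)
  also have "branches_of_size (Suc 0) (copr F) = (\<Sum>s\<in>#F. vec ({#s#}, F - {#s#}) +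
      push (\<lambda>(b, r). ({#b#}, add_mset r (F - {#s#}))) (single_cuts s))"
    unfolding branches_of_size_1_of_trees
  proof (intro arg_cong[where f = sum_mset] image_mset_cong)
    fix s
    have "push f x * vec y = push (\<lambda>z. f z + y) x" for f :: "'l tree \<times> 'l tree \<Rightarrow> 'l tree multiset \<times> 'l tree multiset" and x y
      unfolding push_def lin_mult_right[symmetric] vec_plus ..
    then show "branches_of_size (Suc 0) (copr_tree s) * vec ({#}, F - {#s#}) = vec ({#s#}, F - {#s#}) +
      push (\<lambda>(b, r). ({#b#}, add_mset r (F - {#s#}))) (single_cuts s)"
      by (simp add: branches_of_size_1_tree distrib_right case_prod_unfold flip: vec_plus)
  qed
  finally show ?thesis by (simp add: lookup_sum_mset)
qed

text \<open>All coefficients are nonnegative, so the contribution of the occurrence of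
  \<open>t\<close> itself cannot cancel.\<close>

lemma star_dual_basis_add: "star (dual_basis {#t#}) (dual_basis G) (add_mset t G) \<noteq> 0"
proof -
  let ?x = "\<lambda>s. vec ({#s#}, add_mset t G - {#s#}) + push (\<lambda>(b, r). ({#b#}, add_mset r (add_mset t G - {#s#}))) (single_cuts s)"
  have nonneg: "0 \<le> Poly_Mapping.lookup (?x s) ({#t#}, G)" for s
    unfolding lookup_add
    by (intro add_nonneg_nonneg lookup_push_nonneg) (auto simp: lookup_vec lookup_single_cuts)
  have "1 \<le> Poly_Mapping.lookup (?x t) ({#t#}, G)"
    using lookup_push_nonneg[of "single_cuts t" "\<lambda>(b, r). ({#b#}, add_mset r G)" "({#t#}, G)"]
    by (auto simp: lookup_add lookup_vec lookup_single_cuts)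
  also have "\<dots> \<le> star (dual_basis {#t#}) (dual_basis G) (add_mset t G)"
    unfolding star_dual_basis by (rule sum_mset_member_le[OF _ nonneg]) simp
  finally show ?thesis by simp
qed

text \<open>Apart from the union, the product of a tree with \<open>G\<close> consists of forests in
  which the tree is grafted onto one of the trees of \<open>G\<close>, which keeps their number.
  This is the triangularity for forests.\<close>

lemma star_dual_basis_nonzero:
  assumes "star (dual_basis {#t#}) (dual_basis G) F \<noteq> 0" "F \<noteq> add_mset t G"
  shows "size F = size G"
proof -
  let ?x = "\<lambda>s. vec ({#s#}, F - {#s#}) + push (\<lambda>(b, r). ({#b#}, add_mset r (F - {#s#}))) (single_cuts s)"
  have zero: "(\<Sum>s\<in>#F. f s) = 0" if "\<And>s. s \<in># F \<Longrightarrow> f s = 0" for f :: "'a tree \<Rightarrow> real" and F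
    using that by (induction F) auto
  have "\<exists>s. s \<in># F \<and> Poly_Mapping.lookup (?x s) ({#t#}, G) \<noteq> 0"
  proof (rule ccontr)
    assume "\<not> ?thesis"
    then have "(\<Sum>s\<in>#F. Poly_Mapping.lookup (?x s) ({#t#}, G)) = 0" by (intro zero) blast
    then show False using assms(1) by (simp only: star_dual_basis)
  qed
  then obtain s where s: "s \<in># F" "Poly_Mapping.lookup (?x s) ({#t#}, G) \<noteq> 0" by blast
  then obtain F' where F': "F = add_mset s F'" by (metis multi_member_split)
  have "\<not> ({#t#}, G) = ({#s#}, F - {#s#})"
    using assms(2) by (auto simp: F')
  then have "({#t#}, G) \<in> Poly_Mapping.keys (push (\<lambda>(b, r). ({#b#}, add_mset r F')) (single_cuts s))"
    using s(2) by (auto simp: lookup_add lookup_vec F' in_keys_iff split: if_splits)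
  then show ?thesis
    using keys_push[of "\<lambda>(b, r). ({#b#}, add_mset r F')" "single_cuts s"] by (auto simp: F')
qed

text \<open>Agreement spreads from the one-node trees to all trees through pre-Lie products, from
  there to all forests through \<open>star\<close>, and to all series by density.\<close>

lemma is_translation_unique:
  assumes M: "is_translation v M" and M': "is_translation v M'"
  shows "M = M'"
proof -
  have lin: "M (\<lambda>F. a * f F + b * g F) = (\<lambda>F. a * M f F + b * M g F)"
    "M' (\<lambda>F. a * f F + b * g F) = (\<lambda>F. a * M' f F + b * M' g F)" for a b f g
    using M M' unfolding is_translation_def by blast+
  have cont: "continuous_on UNIV M" "continuous_on UNIV M'"
    using M M' unfolding is_translation_def by blast+
  note density = agree_density[OF lin cont]
  have star: "M (star f g) = M' (star f g)" if "M f = M' f" "M g = M' g" for f g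
    using M M' that unfolding is_translation_def by metis
  have pre: "M (pre_lie f g) = M' (pre_lie f g)"
    if "f \<in> tree_series" "g \<in> tree_series" "M f = M' f" "M g = M' g" for f g
    using M M' that unfolding is_translation_def by metis
  have bullet: "M (bullet i) = M' (bullet i)" for i
    using M M' unfolding is_translation_def by (cases i) metis+
  have ts: "dual_basis {#t#} \<in> tree_series" for t :: "'a rtree"
    by (auto simp: tree_series_def dual_basis_def split: if_splits)
  \<comment> \<open>Solves a triangular relation for its leading term \<open>F\<close>: the rest of
    \<open>g\<close> is treated by density, and linearity isolates the basis element.\<close>
  have single_out: "M (dual_basis F) = M' (dual_basis F)"
    if g: "M g = M' g" "g F \<noteq> 0" and rest: "\<And>F'. F' \<noteq> F \<Longrightarrow> g F' \<noteq> 0 \<Longrightarrow> M (dual_basis F') = M' (dual_basis F')" for g F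
  proof -
    let ?h = "\<lambda>F'. if F' = F then 0 else g F'"
    have "M ?h = M' ?h"
      by (rule density) (use rest in \<open>auto split: if_splits\<close>)
    moreover have "dual_basis F = (\<lambda>F'. (1 / g F) * g F' + (- 1 / g F) * ?h F')"
      using g(2) by (auto simp: dual_basis_def)
    ultimately show ?thesis using g(1) lin by (simp only:)
  qed
  have tree: "M (dual_basis {#\<tau>#}) = M' (dual_basis {#\<tau>#})" for \<tau> :: "'a rtree"
  \<comment> \<open>Lexicographic order: the factors of the product have fewer nodes, its other
    terms have as many nodes as \<tau> but fewer children at the root.\<close>
  proof (induction "(num_nodes \<tau>, size (kids \<tau>))" arbitrary: \<tau> rule: wf_induct[OF wf_lex_prod[OF wf_less_than wf_less_than]])
    case 1
    have IH: "M (dual_basis {#\<sigma>#}) = M' (dual_basis {#\<sigma>#})"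
      if "num_nodes \<sigma> < num_nodes \<tau> \<or> num_nodes \<sigma> = num_nodes \<tau> \<and> size (kids \<sigma>) < size (kids \<tau>)" for \<sigma>
      using 1 that by auto
    obtain i us where \<tau>: "\<tau> = Node i us" by (cases \<tau>)
    show ?case
    proof (cases us)
      case empty
      then show ?thesis using bullet[of i] by (simp add: \<tau> bullet_def)
    next
      case (add t ts)
      let ?g = "pre_lie (dual_basis {#t#}) (dual_basis {#Node i ts#})"
      show ?thesis
      proof (rule single_out)
        show "M ?g = M' ?g"
          by (rule pre[OF ts ts]; rule IH) (auto simp: \<tau> add intro: num_nodes_pos)
        show "?g {#\<tau>#} \<noteq> 0"
          using num_cuts_graft[of t i ts] by (simp add: pre_lie_dual_basis \<tau> add)
        fix F assume F: "F \<noteq> {#\<tau>#}" "?g F \<noteq> 0"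
        then obtain \<sigma> where \<sigma>: "F = {#\<sigma>#}" using pre_lie_tree_series unfolding tree_series_def by blast
        have "num_cuts t (Node i ts) \<sigma> \<noteq> 0" using F(2) by (simp add: \<sigma> pre_lie_dual_basis)
        from num_cuts_nonzero[OF this] show "M (dual_basis F) = M' (dual_basis F)"
          using F(1) unfolding \<sigma> by (intro IH) (auto simp: \<tau> add)
      qed
    qed
  qed
  have forest: "M (dual_basis F) = M' (dual_basis F)" for F
  proof (induction "size F" arbitrary: F rule: less_induct)
    case less
    show ?case
    proof (cases F)
      case empty
      then show ?thesis using M M' unfolding is_translation_def by simp
    next
      case (add t G)
      show ?thesis
      proof (rule single_out)
        show "M (star (dual_basis {#t#}) (dual_basis G)) = M' (star (dual_basis {#t#}) (dual_basis G))"
          by (rule star[OF tree less]) (simp add: add)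
        show "star (dual_basis {#t#}) (dual_basis G) F \<noteq> 0"
          unfolding add by (rule star_dual_basis_add)
        fix F' assume "F' \<noteq> F" "star (dual_basis {#t#}) (dual_basis G) F' \<noteq> 0"
        then show "M (dual_basis F') = M' (dual_basis F')"
          using star_dual_basis_nonzero[of t G F'] by (intro less) (auto simp: add)
      qed
    qed
  qed
  show ?thesis
    by (rule ext, rule density) (rule forest)
qed

theorem translation_eq:
  assumes "0 < \<alpha>" "v \<in> B_minus_dual \<alpha>"
  shows "translation v = translate v"
  unfolding translation_def
  by (rule the_equality) (use is_translation_translate[OF assms] is_translation_unique in blast)+

section \<open>Negative renormalization on trees\<close>

lemma push_phi_psi [simp]: "push phi (push psi y) = y"
  by (simp add: push_push)

lemma image_phi_psi [simp]: "image_mset phi (image_mset psi F) = F" "image_mset psi (image_mset phi G) = G"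
  by (simp_all add: multiset.map_comp comp_def)

lemma T_minus_phi: "0 < \<alpha> \<Longrightarrow> image_mset phi G \<in> T_minus \<alpha> \<longleftrightarrow> set_mset G \<subseteq> trees_minus \<alpha>"
  by (auto simp: T_minus_def phi_W_minus image_subset_iff)

lemma assoc_char_phi:
  assumes \<alpha>: "0 < \<alpha>" and v: "v \<in> B_minus_dual \<alpha>"
  shows "assoc_char \<alpha> v (image_mset phi G) = (\<Prod>t\<in>#G. v {#t#})"
proof (cases "set_mset G \<subseteq> trees_minus \<alpha>")
  case True
  then show ?thesis by (simp add: assoc_char_def T_minus_phi[OF \<alpha>] inv_phi multiset.map_comp comp_def)
next
  case False
  then obtain t where t: "t \<in># G" "t \<notin> trees_minus \<alpha>" by auto
  then have "v {#t#} = 0" using B_minus_dual_support[OF \<alpha> v] by blast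
  then have "(\<Prod>t\<in>#G. v {#t#}) = 0" using t(1) by (auto dest!: multi_member_split)
  then show ?thesis using False by (simp add: assoc_char_def T_minus_phi[OF \<alpha>])
qed

lemma lin_delta_minus:
  fixes f :: "'d forest \<times> 'd rtree \<Rightarrow> 'v::real_vector"
  assumes "\<And>F t. \<not> set_mset F \<subseteq> trees_minus \<alpha> \<Longrightarrow> f (F, t) = 0"
  shows "lin f (delta_minus \<alpha> \<tau>) = lin f (delta \<tau>)"
proof -
  have "lin f (tensor (pi_minus \<alpha> F) (vec t)) = f (F, t)" for F t
    using assms[of F t] by (simp add: tensor_lin pi_minus_eq)
  then show ?thesis by (simp add: delta_minus_def tensor_map_def lin_lin case_prod_unfold)
qed

text \<open>The weight of a family is zero as soon as one of its trees lies outside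
  \<open>trees_minus \<alpha>\<close>, so contracting \<open>delta_minus\<close> or
  \<open>delta\<close> gives the same. Statements on \<open>renorm_map\<close> thereby become
  statements on \<open>subst_tree\<close>.\<close>

lemma renorm_map_phi:
  fixes v :: "'d forest \<Rightarrow> real"
  assumes \<alpha>: "0 < \<alpha>" and v: "v \<in> B_minus_dual \<alpha>"
  shows "renorm_map \<alpha> (assoc_char \<alpha> v) (push phi x) = push phi (lin (subst_tree (\<lambda>t. v {#t#})) x)"
proof -
  have "contract_left (assoc_char \<alpha> v) (Delta_minus_symb \<alpha> (phi \<tau>)) = push phi (subst_tree (\<lambda>t. v {#t#}) \<tau>)" for \<tau>
  proof -
    have "contract_left (assoc_char \<alpha> v) (Delta_minus_symb \<alpha> (phi \<tau>)) =
        lin (\<lambda>(F, t). (\<Prod>t\<in>#F. v {#t#}) *\<^sub>R vec (phi t)) (delta_minus \<alpha> \<tau>)"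
      by (simp add: Delta_minus_symb_delta_minus[OF \<alpha>] contract_left_push assoc_char_phi[OF \<alpha> v] case_prod_unfold)
    also have "\<dots> = lin (\<lambda>(F, t). (\<Prod>t\<in>#F. v {#t#}) *\<^sub>R vec (phi t)) (delta \<tau>)"
    proof (rule lin_delta_minus)
      fix F :: "'d forest" and t assume "\<not> set_mset F \<subseteq> trees_minus \<alpha>"
      then obtain s where "s \<in># F" "v {#s#} = 0" using B_minus_dual_support[OF \<alpha> v] by blast
      then show "(case (F, t) of (F, t) \<Rightarrow> (\<Prod>t\<in>#F. v {#t#}) *\<^sub>R vec (phi t)) = 0"
        by (auto dest!: multi_member_split)
    qed
    also have "\<dots> = push phi (subst_tree (\<lambda>t. v {#t#}) \<tau>)"
      by (simp add: subst_tree_def contract_left_def push_lin push_scaleR case_prod_unfold)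
    finally show ?thesis .
  qed
  then show ?thesis
    by (simp add: renorm_map_def Delta_minus_def push_lin)
      (simp add: contract_left_def lin_lin)
qed

lemma renorm_map_lin: "renorm_map \<alpha> l (lin f x) = lin (\<lambda>a. renorm_map \<alpha> l (f a)) x"
  by (simp add: renorm_map_def Delta_minus_def contract_left_def lin_lin)

lemma linear_renorm_map: "linear (renorm_map \<alpha> l)"
  unfolding renorm_map_def[abs_def] Delta_minus_def contract_left_def
  by (intro linearI) (simp_all add: lin_add lin_scaleR)

lemma renorm_map_eq: "renorm_map \<alpha> l y = lin (\<lambda>\<sigma>. renorm_map \<alpha> l (vec \<sigma>)) y"
  by (rule linear_eq_lin[OF linear_renorm_map])

lemma renorm_map_vec:
  assumes "0 < \<alpha>" "v \<in> B_minus_dual \<alpha>"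
  shows "renorm_map \<alpha> (assoc_char \<alpha> v) (vec (phi \<tau>)) = push phi (subst_tree (\<lambda>t. v {#t#}) \<tau>)"
  using renorm_map_phi[OF assms, of "vec \<tau>"] by simp

lemma B_minus_dual_None: "0 < \<alpha> \<Longrightarrow> v \<in> B_minus_dual \<alpha> \<Longrightarrow> None \<in> set_tree t \<Longrightarrow> v {#t#} = 0"
  using B_minus_dual_support[of \<alpha> v t] trees_minus_None[of t \<alpha>] by blast

lemma B_minus_dual_uminus: "v \<in> B_minus_dual \<alpha> \<Longrightarrow> (\<lambda>F. - v F) \<in> B_minus_dual \<alpha>"
  by (simp add: B_minus_dual_def)

text \<open>By additivity in \<open>v\<close> the two substitutions compose to the one for 0, which
  is the identity.\<close>

lemma renorm_map_inverse:
  assumes \<alpha>: "0 < \<alpha>" and v: "v \<in> B_minus_dual \<alpha>"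
  shows "renorm_map \<alpha> (assoc_char \<alpha> v) (renorm_map \<alpha> (assoc_char \<alpha> (\<lambda>F. - v F)) y) = y"
    "renorm_map \<alpha> (assoc_char \<alpha> (\<lambda>F. - v F)) (renorm_map \<alpha> (assoc_char \<alpha> v) y) = y"
proof -
  note v' = B_minus_dual_uminus[OF v]
  have *: "lin (subst_tree (\<lambda>t. v {#t#})) (lin (subst_tree (\<lambda>t. - v {#t#})) x) = x"
    "lin (subst_tree (\<lambda>t. - v {#t#})) (lin (subst_tree (\<lambda>t. v {#t#})) x) = x" for x
    using B_minus_dual_None[OF \<alpha> v]
    by (simp_all add: lin_lin subst_tree_subst_tree subst_tree_zero)
  have "y = push phi (push psi y)" by simp
  then show "renorm_map \<alpha> (assoc_char \<alpha> v) (renorm_map \<alpha> (assoc_char \<alpha> (\<lambda>F. - v F)) y) = y"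
    "renorm_map \<alpha> (assoc_char \<alpha> (\<lambda>F. - v F)) (renorm_map \<alpha> (assoc_char \<alpha> v) y) = y"
    by (metis renorm_map_phi[OF \<alpha> v] renorm_map_phi[OF \<alpha> v'] *)+
qed

lemma translate_inverse:
  assumes \<alpha>: "0 < \<alpha>" and v: "v \<in> B_minus_dual \<alpha>"
  shows "translate (\<lambda>F. - v F) (translate v f) = f"
proof
  fix F
  have "lin (subst_forest (\<lambda>t. v {#t#})) (subst_forest (\<lambda>t. - v {#t#}) F) = subst_forest (\<lambda>_. 0) F"
    by (rule lin_subst_forest_subst_forest) (simp add: subst_tree_subst_tree B_minus_dual_None[OF \<alpha> v])
  also have "\<dots> = vec F" by (rule subst_forest_zero_of_trees) (rule subst_tree_zero)
  finally have "lin f (lin (subst_forest (\<lambda>t. v {#t#})) (subst_forest (\<lambda>t. - v {#t#}) F)) = f F" by simp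
  then show "translate (\<lambda>F. - v F) (translate v f) F = f F"
    by (simp add: translate_def lin_lin)
qed

text \<open>Every trunk of a cut contains the root, whose label 0 makes \<open>w\<close> vanish on
  it. So a root labelled 0 is never extracted; on symbols this is compatibility with \<I>, on paths
  compatibility with time integrals.\<close>

lemma subst_tree_None_root:
  assumes "\<And>t. None \<in> set_tree t \<Longrightarrow> w t = 0"
  shows "subst_tree w (Node None ts) = push (Node None) (subst_forest w ts)"
proof -
  have "lin (\<lambda>(b, s). w s *\<^sub>R push (Node None) (subst_forest w b)) (pruned (Node None ts)) = 0"
    by (simp add: pruned_Node case_prod_unfold assms)
  then show ?thesis by (subst subst_tree_rec) simp
qed

section \<open>The group of characters\<close>

lemma finite_trees_bounded: "finite {\<tau> :: 'l::finite tree. num_nodes \<tau> \<le> n}"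
proof (induction n)
  case 0
  have "num_nodes \<tau> \<noteq> 0" for \<tau> :: "'l tree" using num_nodes_pos[of \<tau>] by simp
  then have "{\<tau> :: 'l tree. num_nodes \<tau> = 0} = {}" by blast
  then show ?case by (simp only: le_zero_eq finite.emptyI)
next
  case (Suc n)
  let ?A = "{\<tau> :: 'l tree. num_nodes \<tau> \<le> n}"
  have fin: "finite {xs. set xs \<subseteq> ?A \<and> length xs \<le> n}"
    by (rule finite_lists_length_le) (rule Suc)
  have "\<tau> \<in> (\<lambda>(i, xs). Node i (mset xs)) ` (UNIV \<times> {xs. set xs \<subseteq> ?A \<and> length xs \<le> n})"
    if le: "num_nodes \<tau> \<le> Suc n" for \<tau> :: "'l tree"
  proof -
    obtain i ts where \<tau>: "\<tau> = Node i ts" by (cases \<tau>)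
    obtain xs where xs: "mset xs = ts" using ex_mset by blast
    have sum: "(\<Sum>t\<in>#ts. num_nodes t) \<le> n" using le by (simp add: \<tau>)
    have "size ts \<le> (\<Sum>t\<in>#ts. num_nodes t)"
    proof (induction ts)
      case (add t ts)
      then show ?case using num_nodes_pos[of t] by simp
    qed simp
    then have "length xs \<le> n" using sum xs by auto
    moreover have "num_nodes t \<le> n" if "t \<in># ts" for t
      using sum that by (auto dest!: multi_member_split)
    then have "set xs \<subseteq> ?A" using xs by auto
    ultimately show ?thesis by (auto simp: \<tau> xs[symmetric] intro!: image_eqI[of _ _ "(i, xs)"])
  qed
  then have "{\<tau> :: 'l tree. num_nodes \<tau> \<le> Suc n} \<subseteq>
      (\<lambda>(i, xs). Node i (mset xs)) ` (UNIV \<times> {xs. set xs \<subseteq> ?A \<and> length xs \<le> n})" by blast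
  then show ?case by (rule finite_subset) (use fin in auto)
qed

text \<open>With finitely many labels a bound on the number of nodes leaves finitely many trees. So
  every function on \<open>trees_minus \<alpha>\<close> has finite support, which gives surjectivity
  from \<open>B_minus \<alpha>\<close> onto \<open>G_minus \<alpha>\<close>.\<close>

lemma finite_trees_minus: "finite (trees_minus \<alpha> :: 'd::finite rtree set)"
  by (rule finite_subset[OF _ finite_trees_bounded[of "nat \<lfloor>1 / \<alpha>\<rfloor>"]]) (auto simp: trees_minus_def)

lemma to_dual_apply: "to_dual v F = (if \<exists>\<tau>. F = {#\<tau>#} then Poly_Mapping.lookup v (THE \<tau>. F = {#\<tau>#}) else 0)"
  by (auto simp: to_dual_def dual_basis_def lookup_eq_lin intro!: lin_cong)

lemma to_dual_single [simp]: "to_dual v {#\<tau>#} = Poly_Mapping.lookup v \<tau>"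
  by (simp add: to_dual_apply)

lemma to_dual_B_minus_dual: "v \<in> B_minus \<alpha> \<Longrightarrow> to_dual v \<in> B_minus_dual \<alpha>"
  by (auto simp: B_minus_def B_minus_dual_def to_dual_apply in_keys_iff subset_iff split: if_splits)

lemma assoc_char_mult:
  assumes "0 < \<alpha>"
  shows "assoc_char \<alpha> v {#} = 1" "assoc_char \<alpha> v (F + G) = assoc_char \<alpha> v F * assoc_char \<alpha> v G"
  by (auto simp: assoc_char_def T_minus_def)

lemma single_None_notin: "0 < \<alpha> \<Longrightarrow> Node None {#} \<notin> trees_minus \<alpha>"
  by (simp add: trees_minus_def)

text \<open>On a single negative symbol two terms survive: the extraction of the whole tree, which
  leaves the symbol 1, and the empty extraction. Any other contracted tree has a label 0, on which
  \<open>v'\<close> vanishes.\<close>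

lemma conv_assoc_char:
  fixes v v' :: "'d forest \<Rightarrow> real"
  assumes \<alpha>: "0 < \<alpha>" and v: "v \<in> B_minus_dual \<alpha>" and v': "v' \<in> B_minus_dual \<alpha>"
  shows "conv_minus \<alpha> (assoc_char \<alpha> v) (assoc_char \<alpha> v') = assoc_char \<alpha> (\<lambda>F. v F + v' F)"
proof
  fix F :: "'d symb multiset"
  let ?l = "assoc_char \<alpha> v" and ?l' = "assoc_char \<alpha> v'"
  let ?m = "\<lambda>(a, b). ?l a * ?l' b"
  have m: "?m 0 = 1" "?m (x + y) = ?m x * ?m y" for x y
    by (simp_all add: zero_prod_def assoc_char_mult[OF \<alpha>] case_prod_unfold)
  have one: "lin ?m (tensor_map vec (proj_minus \<alpha>) (Delta_minus_symb \<alpha> (phi \<tau>))) = v {#\<tau>#} + v' {#\<tau>#}"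
    if \<tau>: "\<tau> \<in> trees_minus \<alpha>" for \<tau>
  proof -
    \<comment> \<open>The second character after the projection. The symbol 1 is sent to the unit
      and contributes 1, so the total extraction counts although \<open>v'\<close> is zero
      there.\<close>
    define \<kappa> where "\<kappa> t = lin ?l' (proj_minus \<alpha> (phi t))" for t
    have \<kappa>: "\<kappa> t = (if t = Node None {#} then 1 else 0) + v' {#t#}" for t
    proof -
      have eq: "phi t = symb_one \<longleftrightarrow> t = Node None {#}"
        by (cases t) (simp add: symb_one_def)
      have "?l' {#phi t#} = v' {#t#}" for t
        using assoc_char_phi[OF \<alpha> v', of "{#t#}"] by simp
      moreover have "v' {#t#} = 0" if "t \<notin> trees_minus \<alpha>" for t
        using B_minus_dual_support[OF \<alpha> v'] that by blast
      ultimately show ?thesis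
        using single_None_notin[OF \<alpha>]
        by (auto simp: \<kappa>_def proj_minus_def eq phi_W_minus[OF \<alpha>] assoc_char_mult[OF \<alpha>] simp del: phi.simps)
    qed
    have "lin ?m (tensor_map vec (proj_minus \<alpha>) (Delta_minus_symb \<alpha> (phi \<tau>))) =
        lin (\<lambda>(F, t). ?l (image_mset phi F) * \<kappa> t) (delta_minus \<alpha> \<tau>)"
      by (simp add: Delta_minus_symb_delta_minus[OF \<alpha>] tensor_map_def lin_lin case_prod_unfold tensor_lin
          lin_mult_left \<kappa>_def)
    also have "\<dots> = lin (\<lambda>t. \<kappa> (psi t)) (contract_left ?l (push (map_prod (image_mset phi) phi) (delta_minus \<alpha> \<tau>)))"
      by (simp add: contract_left_push lin_lin lin_scaleR case_prod_unfold)
    also have "\<dots> = lin (\<lambda>t. \<kappa> (psi t)) (renorm_map \<alpha> ?l (vec (phi \<tau>)))"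
      by (simp add: renorm_map_def Delta_minus_def Delta_minus_symb_delta_minus[OF \<alpha>])
    also have "\<dots> = Poly_Mapping.lookup (subst_tree (\<lambda>t. v {#t#}) \<tau>) (Node None {#}) +
        lin (\<lambda>t. v' {#t#}) (subst_tree (\<lambda>t. v {#t#}) \<tau>)"
      by (simp add: renorm_map_vec[OF \<alpha> v] \<kappa> lin_add_fun lookup_eq_lin)
    also have "\<dots> = v {#\<tau>#} + v' {#\<tau>#}"
    proof -
      have "lin (\<lambda>t. v' {#t#}) (subst_tree (\<lambda>t. v {#t#}) \<tau>) = v' {#\<tau>#}"
        by (rule lin_subst_tree_noise_only) (rule B_minus_dual_None[OF \<alpha> v'])
      moreover have "\<tau> \<noteq> Node None {#}" using single_None_notin[OF \<alpha>] \<tau> by metis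
      ultimately show ?thesis by (simp add: lookup_subst_tree_single)
    qed
    finally show ?thesis .
  qed
  show "conv_minus \<alpha> ?l ?l' F = assoc_char \<alpha> (\<lambda>F. v F + v' F) F"
  proof (cases "F \<in> T_minus \<alpha>")
    case True
    then have "conv_minus \<alpha> ?l ?l' F =
        (\<Prod>\<sigma>\<in>#F. lin ?m (tensor_map vec (proj_minus \<alpha>) (Delta_minus_symb \<alpha> \<sigma>)))"
      unfolding conv_minus_def copr_minus_def by (simp only: if_True) (rule lin_prod_mset[OF m])
    also have "\<dots> = (\<Prod>\<sigma>\<in>#F. v {#psi \<sigma>#} + v' {#psi \<sigma>#})"
    proof (intro arg_cong[where f = prod_mset] image_mset_cong)
      fix \<sigma> assume "\<sigma> \<in># F"
      then have "psi \<sigma> \<in> trees_minus \<alpha>" using True phi_W_minus[OF \<alpha>, of "psi \<sigma>"] by (auto simp: T_minus_def)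
      from one[OF this] show "lin ?m (tensor_map vec (proj_minus \<alpha>) (Delta_minus_symb \<alpha> \<sigma>)) = v {#psi \<sigma>#} + v' {#psi \<sigma>#}"
        by simp
    qed
    finally show ?thesis using True by (simp add: assoc_char_def inv_phi)
  qed (simp add: conv_minus_def assoc_char_def)
qed

lemma to_dual_add: "to_dual (v + v') = (\<lambda>F. to_dual v F + to_dual v' F)"
  by (simp add: to_dual_def lin_add)

lemma assoc_char_add:
  assumes "0 < \<alpha>" "v \<in> B_minus \<alpha>" "v' \<in> B_minus \<alpha>"
  shows "assoc_char \<alpha> (to_dual (v + v')) = conv_minus \<alpha> (assoc_char \<alpha> (to_dual v)) (assoc_char \<alpha> (to_dual v'))"
  by (simp add: conv_assoc_char assms to_dual_B_minus_dual to_dual_add)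

lemma group_B_minus: "group (B_minus_group \<alpha> :: ('d rtree \<Rightarrow>\<^sub>0 real) monoid)"
proof (rule groupI)
  fix x :: "'d rtree \<Rightarrow>\<^sub>0 real" assume x: "x \<in> carrier (B_minus_group \<alpha>)"
  then show "\<exists>y\<in>carrier (B_minus_group \<alpha>). y \<otimes>\<^bsub>B_minus_group \<alpha>\<^esub> x = \<one>\<^bsub>B_minus_group \<alpha>\<^esub>"
    by (intro bexI[of _ "- x"]) (auto simp: B_minus_group_def B_minus_def in_keys_iff subset_iff)
next
  fix x y :: "'d rtree \<Rightarrow>\<^sub>0 real" assume "x \<in> carrier (B_minus_group \<alpha>)" "y \<in> carrier (B_minus_group \<alpha>)"
  then show "x \<otimes>\<^bsub>B_minus_group \<alpha>\<^esub> y \<in> carrier (B_minus_group \<alpha>)"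
    using keys_add[of x y] by (auto simp: B_minus_group_def B_minus_def)
qed (auto simp: B_minus_group_def B_minus_def add.assoc)

lemma bij_betw_assoc_char:
  assumes \<alpha>: "0 < \<alpha>"
  shows "bij_betw (\<lambda>v. assoc_char \<alpha> (to_dual v)) (B_minus \<alpha>) (G_minus \<alpha> :: ('d::finite symb multiset \<Rightarrow> real) set)"
  unfolding bij_betw_def
proof
  have single: "assoc_char \<alpha> (to_dual v) {#phi \<tau>#} = Poly_Mapping.lookup v \<tau>"
    if "v \<in> B_minus \<alpha>" for v :: "'d rtree \<Rightarrow>\<^sub>0 real" and \<tau>
    using assoc_char_phi[OF \<alpha> to_dual_B_minus_dual[OF that], of "{#\<tau>#}"] by simp
  show "inj_on (\<lambda>v. assoc_char \<alpha> (to_dual v)) (B_minus \<alpha> :: ('d rtree \<Rightarrow>\<^sub>0 real) set)"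
    by (rule inj_onI, rule poly_mapping_eqI) (metis single)
  show "(\<lambda>v. assoc_char \<alpha> (to_dual v)) ` B_minus \<alpha> = (G_minus \<alpha> :: ('d symb multiset \<Rightarrow> real) set)"
  proof
    show "(\<lambda>v. assoc_char \<alpha> (to_dual v)) ` B_minus \<alpha> \<subseteq> (G_minus \<alpha> :: ('d symb multiset \<Rightarrow> real) set)"
      using assoc_char_mult[OF \<alpha>] by (auto simp: G_minus_def assoc_char_def)
    show "(G_minus \<alpha> :: ('d symb multiset \<Rightarrow> real) set) \<subseteq> (\<lambda>v. assoc_char \<alpha> (to_dual v)) ` B_minus \<alpha>"
    proof
      fix l :: "'d symb multiset \<Rightarrow> real" assume l: "l \<in> G_minus \<alpha>"
      \<comment> \<open>A character is determined by its values at single symbols; these are the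
        coefficients of the preimage.\<close>
      define v where "v = (\<Sum>t\<in>trees_minus \<alpha>. l {#phi t#} *\<^sub>R vec t)"
      have look: "Poly_Mapping.lookup v \<tau> = (if \<tau> \<in> trees_minus \<alpha> then l {#phi \<tau>#} else 0)" for \<tau>
        by (auto simp: v_def lookup_sum lookup_vec finite_trees_minus if_distrib[of "\<lambda>x. _ * x"] cong: if_cong)
      then have v: "v \<in> B_minus \<alpha>" by (auto simp: B_minus_def in_keys_iff split: if_splits)
      have "l F = assoc_char \<alpha> (to_dual v) F" for F
      proof (cases "F \<in> T_minus \<alpha>")
        case True
        then show ?thesis
        proof (induction F)
          case empty
          then show ?case using l by (simp add: assoc_char_mult[OF \<alpha>] G_minus_def)
        next
          case (add \<sigma> F)
          then have T: "{#\<sigma>#} \<in> T_minus \<alpha>" "F \<in> T_minus \<alpha>" by (auto simp: T_minus_def)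
          then have "psi \<sigma> \<in> trees_minus \<alpha>" using phi_W_minus[OF \<alpha>, of "psi \<sigma>"] by (simp add: T_minus_def)
          then have "l {#\<sigma>#} = assoc_char \<alpha> (to_dual v) {#\<sigma>#}"
            using single[OF v, of "psi \<sigma>"] look[of "psi \<sigma>"] by simp
          moreover have "l ({#\<sigma>#} + F) = l {#\<sigma>#} * l F" using l T unfolding G_minus_def by blast
          moreover note assoc_char_mult(2)[OF \<alpha>, of "to_dual v" "{#\<sigma>#}" F]
          ultimately show ?case using add.IH[OF T(2)] by simp
        qed
      qed (use l in \<open>simp add: G_minus_def assoc_char_def\<close>)
      then show "l \<in> (\<lambda>v. assoc_char \<alpha> (to_dual v)) ` B_minus \<alpha>" using v by blast
    qed
  qed
qed

lemma assoc_char_zero: "assoc_char \<alpha> (to_dual 0) = counit_minus"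
proof
  fix F :: "'a symb multiset"
  show "assoc_char \<alpha> (to_dual 0) F = counit_minus F"
    by (cases F) (auto simp: assoc_char_def counit_minus_def dual_basis_def T_minus_def to_dual_def)
qed

lemma group_G_minus:
  assumes \<alpha>: "0 < \<alpha>"
  shows "group (G_minus_group \<alpha> :: ('d::finite symb multiset \<Rightarrow> real) monoid)"
    "(\<lambda>v. assoc_char \<alpha> (to_dual v)) \<in>
       iso (B_minus_group \<alpha> :: ('d rtree \<Rightarrow>\<^sub>0 real) monoid) (G_minus_group \<alpha>)"
proof -
  let ?\<Theta> = "\<lambda>v :: 'd rtree \<Rightarrow>\<^sub>0 real. assoc_char \<alpha> (to_dual v)"
  interpret B: group "B_minus_group \<alpha> :: ('d rtree \<Rightarrow>\<^sub>0 real) monoid" by (rule group_B_minus)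
  have carrier: "carrier (G_minus_group \<alpha>) = ?\<Theta> ` B_minus \<alpha>"
    using bij_betw_assoc_char[OF \<alpha>, where 'd = 'd] by (simp add: G_minus_group_def bij_betw_def)
  have mult: "?\<Theta> v \<otimes>\<^bsub>G_minus_group \<alpha>\<^esub> ?\<Theta> v' = ?\<Theta> (v + v')" if "v \<in> B_minus \<alpha>" "v' \<in> B_minus \<alpha>" for v v'
    using assoc_char_add[OF \<alpha> that] by (simp add: G_minus_group_def)
  have closed: "v + v' \<in> B_minus \<alpha>" if "v \<in> B_minus \<alpha>" "v' \<in> B_minus \<alpha>" for v v' :: "'d rtree \<Rightarrow>\<^sub>0 real"
    using B.m_closed[of v v'] that by (simp add: B_minus_group_def)
  have one: "\<one>\<^bsub>G_minus_group \<alpha>\<^esub> = ?\<Theta> 0" by (simp add: G_minus_group_def assoc_char_zero)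
  have zero: "0 \<in> (B_minus \<alpha> :: ('d rtree \<Rightarrow>\<^sub>0 real) set)" by (simp add: B_minus_def)
  show "group (G_minus_group \<alpha> :: ('d symb multiset \<Rightarrow> real) monoid)"
  proof (rule groupI)
    fix x assume "x \<in> carrier (G_minus_group \<alpha> :: ('d symb multiset \<Rightarrow> real) monoid)"
    then obtain v where v: "v \<in> B_minus \<alpha>" "x = ?\<Theta> v" unfolding carrier by blast
    then have "- v \<in> B_minus \<alpha>" by (simp add: B_minus_def)
    then show "\<exists>y\<in>carrier (G_minus_group \<alpha>). y \<otimes>\<^bsub>G_minus_group \<alpha>\<^esub> x = \<one>\<^bsub>G_minus_group \<alpha>\<^esub>"
      unfolding carrier one v(2) by (intro bexI[of _ "?\<Theta> (- v)"]) (simp_all only: mult v(1), simp_all)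
    show "\<one>\<^bsub>G_minus_group \<alpha>\<^esub> \<otimes>\<^bsub>G_minus_group \<alpha>\<^esub> x = x"
      unfolding one v(2) mult[OF zero v(1)] by simp
  qed (use closed zero in \<open>auto simp: carrier mult one add.assoc simp del: image_iff\<close>)
  show "?\<Theta> \<in> iso (B_minus_group \<alpha> :: ('d rtree \<Rightarrow>\<^sub>0 real) monoid) (G_minus_group \<alpha>)"
    using bij_betw_assoc_char[OF \<alpha>, where 'd = 'd] assoc_char_add[OF \<alpha>]
    by (auto simp: iso_def hom_def B_minus_group_def G_minus_group_def bij_betw_def)
qed

section \<open>Test functions\<close>

text \<open>Polynomials in 1/x times exp(-1/x), extended by 0: a class that contains the building
  block of a bump and is closed under differentiation, so that no formula for higher derivatives is
  involved.\<close>

definition flat :: "real poly \<Rightarrow> real \<Rightarrow> real" where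
  "flat p x = (if 0 < x then poly p (1 / x) * exp (- (1 / x)) else 0)"

lemma flat_limit: "((\<lambda>x. poly p (1 / x) * exp (- (1 / x))) \<longlongrightarrow> 0) (at_right (0::real))"
proof (induction p)
  case (pCons a p)
  have mono: "((\<lambda>x::real. (1 / x) ^ n * exp (- (1 / x))) \<longlongrightarrow> 0) (at_right 0)" for n
    by real_asymp
  have "((\<lambda>x::real. \<Sum>i\<le>Polynomial.degree (pCons a p). coeff (pCons a p) i * ((1 / x) ^ i * exp (- (1 / x)))) \<longlongrightarrow>
      (\<Sum>i\<le>Polynomial.degree (pCons a p). coeff (pCons a p) i * 0)) (at_right 0)"
    by (intro tendsto_intros mono)
  then show ?case
    by (simp add: poly_altdef sum_distrib_right mult.assoc)
qed simp

text \<open>For positive \<open>x\<close> the factor \<open>[:0, 0, 1:]\<close> comes from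
  differentiating 1/x. At 0 the right difference quotient is again of the same form, with the
  polynomial multiplied by \<open>[:0, 1:]\<close>, and tends to 0.\<close>

lemma flat_derivative: "(flat p has_real_derivative flat ([:0, 0, 1:] * (p - pderiv p)) x) (at x)"
proof -
  consider "x > 0" | "x < 0" | "x = 0" by linarith
  then show ?thesis
  proof cases
    case 1
    have "((\<lambda>x. poly p (1 / x) * exp (- (1 / x))) has_real_derivative
        poly (pderiv p) (1 / x) * (- 1 / x\<^sup>2) * exp (- (1 / x)) + poly p (1 / x) * (exp (- (1 / x)) * (1 / x\<^sup>2))) (at x)"
      using 1 by (auto intro!: derivative_eq_intros DERIV_chain'[OF _ poly_DERIV] simp: power2_eq_square field_simps)
    then have "((\<lambda>x. poly p (1 / x) * exp (- (1 / x))) has_real_derivative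
        flat ([:0, 0, 1:] * (p - pderiv p)) x) (at x)"
      using 1 by (simp add: flat_def field_simps power2_eq_square)
    moreover have "\<forall>\<^sub>F y in nhds x. flat p y = poly p (1 / y) * exp (- (1 / y))"
      using eventually_nhds_in_open[of "{0<..}" x] 1 by (auto simp: flat_def elim!: eventually_mono)
    ultimately show ?thesis
      by (subst DERIV_cong_ev[OF refl _ refl])
  next
    case 2
    have "\<forall>\<^sub>F y in nhds x. flat p y = 0"
      using eventually_nhds_in_open[of "{..<0}" x] 2 by (auto simp: flat_def elim!: eventually_mono)
    then show ?thesis
      using 2 by (subst DERIV_cong_ev[OF refl _ refl]) (auto simp: flat_def)
  next
    case 3
    have right: "((\<lambda>h. (flat p (0 + h) - flat p 0) / h) \<longlongrightarrow> 0) (at_right 0)"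
    proof (rule Lim_transform_eventually)
      show "((\<lambda>h. poly ([:0, 1:] * p) (1 / h) * exp (- (1 / h))) \<longlongrightarrow> 0) (at_right (0::real))"
        by (rule flat_limit)
      show "\<forall>\<^sub>F h in at_right 0. poly ([:0, 1:] * p) (1 / h) * exp (- (1 / h)) = (flat p (0 + h) - flat p 0) / h"
        using eventually_at_right_less[of "0::real"] by (auto simp: flat_def elim!: eventually_mono)
    qed
    have left: "((\<lambda>h. (flat p (0 + h) - flat p 0) / h) \<longlongrightarrow> 0) (at_left 0)"
    proof (rule Lim_transform_eventually)
      show "((\<lambda>_. 0) \<longlongrightarrow> (0::real)) (at_left (0::real))" by simp
      show "\<forall>\<^sub>F h in at_left 0. 0 = (flat p (0 + h) - flat p 0) / h"
        by (simp add: eventually_at_filter flat_def)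
    qed
    show ?thesis
      using left right filterlim_split_at_real unfolding 3 DERIV_def by (simp add: flat_def filterlim_at_split)
  qed
qed

lemma smooth_closed_class:
  assumes "f \<in> S" "\<And>f. f \<in> S \<Longrightarrow> \<exists>f'\<in>S. \<forall>x. (f has_real_derivative f' x) (at x)"
  shows "smooth f"
proof -
  have "(deriv ^^ n) f \<in> S" for n
  proof (induction n)
    case (Suc n)
    then obtain f' where "f' \<in> S" "\<forall>x. ((deriv ^^ n) f has_real_derivative f' x) (at x)"
      using assms(2) by blast
    then have "deriv ((deriv ^^ n) f) = f'" by (auto intro: DERIV_imp_deriv)
    then show ?case using \<open>f' \<in> S\<close> by simp
  qed (simp add: assms(1))
  then show ?thesis
    using assms(2) unfolding smooth_def by (meson real_differentiable_def)
qed

text \<open>Closure under differences matches the product rule: the derivative of a product is a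
  difference of two products, the minus sign coming from \<open>b - x\<close>.\<close>

inductive_set bumps :: "real \<Rightarrow> real \<Rightarrow> (real \<Rightarrow> real) set" for a b where
  bump: "(\<lambda>x. flat p (x - a) * flat q (b - x)) \<in> bumps a b"
| diff: "f \<in> bumps a b \<Longrightarrow> g \<in> bumps a b \<Longrightarrow> (\<lambda>x. f x - g x) \<in> bumps a b"

lemma smooth_bump: "smooth (\<lambda>x. flat p (x - a) * flat q (b - x))"
proof (rule smooth_closed_class[OF bumps.bump])
  show "\<exists>f'\<in>bumps a b. \<forall>x. (f has_real_derivative f' x) (at x)" if "f \<in> bumps a b" for f
    using that
  proof induction
    case (bump p q)
    let ?p = "[:0, 0, 1:] * (p - pderiv p)" and ?q = "[:0, 0, 1:] * (q - pderiv q)"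
    have "((\<lambda>x. flat p (x - a) * flat q (b - x)) has_real_derivative
        flat ?p (x - a) * flat q (b - x) - flat p (x - a) * flat ?q (b - x)) (at x)" for x
    proof -
      have 1: "((\<lambda>x. flat p (x - a)) has_real_derivative flat ?p (x - a) * 1) (at x)"
        by (rule DERIV_chain'[OF _ flat_derivative]) (auto intro!: derivative_eq_intros)
      have 2: "((\<lambda>x. flat q (b - x)) has_real_derivative flat ?q (b - x) * (- 1)) (at x)"
        by (rule DERIV_chain'[OF _ flat_derivative]) (auto intro!: derivative_eq_intros)
      show ?thesis using DERIV_mult[OF 1 2] by (simp add: algebra_simps)
    qed
    then show ?case by (intro bexI[OF _ bumps.diff[OF bumps.bump bumps.bump]]) auto
  next
    case (diff f g)
    then obtain f' g' where "f' \<in> bumps a b" "g' \<in> bumps a b"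
      "\<forall>x. (f has_real_derivative f' x) (at x)" "\<forall>x. (g has_real_derivative g' x) (at x)" by blast
    then show ?case by (intro bexI[OF _ bumps.diff[of f' a b g']]) (auto intro: DERIV_diff)
  qed
qed

lemma bump_exists:
  fixes x0 e :: real
  assumes "0 < e"
  obtains \<psi> where "test_function UNIV \<psi>" "\<And>x. 0 \<le> \<psi> x" "0 < \<psi> x0" "\<And>x. \<psi> x \<noteq> 0 \<Longrightarrow> \<bar>x - x0\<bar> < e"
proof
  let ?\<psi> = "\<lambda>x. flat 1 (x - (x0 - e)) * flat 1 (x0 + e - x)"
  show supp: "\<bar>x - x0\<bar> < e" if "?\<psi> x \<noteq> 0" for x
    using that by (auto simp: flat_def split: if_splits)
  then have "closure {x. ?\<psi> x \<noteq> 0} \<subseteq> {x0 - e..x0 + e}"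
    by (intro closure_minimal) force+
  then have "compact (closure {x. ?\<psi> x \<noteq> 0})"
    by (meson bounded_closed_interval bounded_subset closed_closure compact_eq_bounded_closed)
  then show "test_function UNIV ?\<psi>" by (simp add: test_function_def smooth_bump)
qed (use assms in \<open>auto simp: flat_def\<close>)

lemma smooth_continuous: "smooth \<psi> \<Longrightarrow> continuous_on S \<psi>"
proof -
  assume "smooth \<psi>"
  then have "((deriv ^^ 0) \<psi>) differentiable (at x)" for x
    unfolding smooth_def by blast
  then show ?thesis
    by (intro differentiable_imp_continuous_on) (simp add: differentiable_on_def differentiable_at_withinI)
qed

lemma integrable_test_function:
  assumes "continuous_on UNIV f" "test_function UNIV \<psi>"
  shows "integrable lborel (\<lambda>x. f x * \<psi> x :: real)"
proof -
  let ?S = "closure {x. \<psi> x \<noteq> 0}"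
  have "continuous_on ?S (\<lambda>x. f x * \<psi> x)"
    by (intro continuous_on_mult continuous_on_subset[OF assms(1)] smooth_continuous)
      (use assms(2) in \<open>auto simp: test_function_def\<close>)
  then have "integrable lborel (\<lambda>x. indicator ?S x *\<^sub>R (f x * \<psi> x))"
    using assms(2) by (intro borel_integrable_compact) (auto simp: test_function_def)
  moreover have "(\<lambda>x. indicator ?S x *\<^sub>R (f x * \<psi> x)) = (\<lambda>x. f x * \<psi> x)"
    using closure_subset[of "{x. \<psi> x \<noteq> 0}"] by (auto simp: indicator_def fun_eq_iff)
  ultimately show ?thesis by (simp only:)
qed

text \<open>The fundamental lemma of the calculus of variations, one sign at a time: near
  \<open>x0\<close> the function stays above half its value, and a bump supported there has a
  positive integral against it.\<close>

lemma continuous_zero_of_integrals: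
  fixes h :: "real \<Rightarrow> real"
  assumes cont: "continuous_on UNIV h"
    and zero: "\<And>\<psi>. test_function UNIV \<psi> \<Longrightarrow> (LINT x|lborel. h x * \<psi> x) = 0"
  shows "\<not> 0 < h x0"
proof
  assume pos: "0 < h x0"
  \<comment> \<open>Applied to \<open>h\<close> to choose the width of the bump, and to the product
    of \<open>h\<close> with the bump to bound its integral from below.\<close>
  have near: "\<exists>d>0. \<forall>x. \<bar>x - x0\<bar> < d \<longrightarrow> 0 < g x0 \<longrightarrow> g x0 / 2 < g x" if "continuous_on UNIV g" for g :: "real \<Rightarrow> real"
  proof (cases "0 < g x0")
    case True
    have "continuous (at x0) g" using that by (simp add: continuous_on_eq_continuous_at)
    then obtain d where "d > 0" "\<forall>x. dist x x0 < d \<longrightarrow> dist (g x) (g x0) < g x0 / 2"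
      unfolding continuous_at_eps_delta using True by (meson half_gt_zero)
    moreover have "g x0 / 2 < g x" if "dist (g x) (g x0) < g x0 / 2" for x
      using that by (simp add: dist_real_def abs_if split: if_splits)
    ultimately show ?thesis by (intro exI[of _ d]) (simp add: dist_real_def)
  qed (auto intro: exI[of _ 1])
  obtain d where d: "d > 0" "\<And>x. \<bar>x - x0\<bar> < d \<Longrightarrow> h x0 / 2 < h x"
    using near[OF cont] pos by blast
  obtain \<psi> where \<psi>: "test_function UNIV \<psi>" "\<And>x. 0 \<le> \<psi> x" "0 < \<psi> x0" "\<And>x. \<psi> x \<noteq> 0 \<Longrightarrow> \<bar>x - x0\<bar> < d"
    using bump_exists[OF d(1)] by metis
  have nonneg: "0 \<le> h x * \<psi> x" for x
    using d(2)[of x] \<psi>(2)[of x] \<psi>(4)[of x] pos by (cases "\<psi> x = 0") auto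
  have "continuous_on UNIV (\<lambda>x. h x * \<psi> x)"
    by (rule continuous_on_mult[OF cont smooth_continuous]) (use \<psi>(1) in \<open>simp add: test_function_def\<close>)
  from near[OF this] obtain c where c: "c > 0" "\<And>x. \<bar>x - x0\<bar> < c \<Longrightarrow> h x0 * \<psi> x0 / 2 < h x * \<psi> x"
    using pos \<psi>(3) by auto
  let ?k = "h x0 * \<psi> x0 / 2"
  have "(LINT x|lborel. indicator {x0 - c / 2..x0 + c / 2} x * ?k) \<le> (LINT x|lborel. h x * \<psi> x)"
  proof (rule integral_mono)
    show "integrable lborel (\<lambda>x. indicator {x0 - c / 2..x0 + c / 2} x * ?k)"
      by (intro integrable_mult_left integrable_real_indicator) (auto simp: emeasure_lborel_Icc_eq)
    show "integrable lborel (\<lambda>x. h x * \<psi> x)" by (rule integrable_test_function[OF cont \<psi>(1)])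
    show "indicator {x0 - c / 2..x0 + c / 2} x * ?k \<le> h x * \<psi> x" for x
      using c(2)[of x] c(1) nonneg[of x] by (auto simp: indicator_def abs_less_iff)
  qed
  moreover have "(LINT x|lborel. indicator {x0 - c / 2..x0 + c / 2} x * ?k) = c * ?k"
    using c(1) by simp
  moreover have "0 < c * ?k" using c(1) pos \<psi>(3) by simp
  ultimately have "0 < (LINT x|lborel. h x * \<psi> x)" by linarith
  then show False using zero[OF \<psi>(1)] by simp
qed

text \<open>Makes the point values in \<open>matches\<close> well defined.\<close>

lemma represents_unique:
  assumes "continuous_on UNIV f" "continuous_on UNIV g" "represents f D" "represents g D"
  shows "f = g"
proof
  fix x
  have zero: "(LINT x|lborel. (f x - g x) * \<psi> x) = 0" "(LINT x|lborel. (g x - f x) * \<psi> x) = 0"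
    if \<psi>: "test_function UNIV \<psi>" for \<psi>
  proof -
    have "(LINT x|lborel. f x * \<psi> x) = (LINT x|lborel. g x * \<psi> x)"
      using assms(3,4) \<psi> by (simp add: represents_def)
    then show "(LINT x|lborel. (f x - g x) * \<psi> x) = 0" "(LINT x|lborel. (g x - f x) * \<psi> x) = 0"
      using integrable_test_function[OF assms(1) \<psi>] integrable_test_function[OF assms(2) \<psi>]
      by (simp_all add: left_diff_distrib)
  qed
  have "\<not> 0 < f x - g x"
    by (rule continuous_zero_of_integrals[of "\<lambda>x. f x - g x"]) (use assms zero in \<open>auto intro!: continuous_intros\<close>)
  moreover have "\<not> 0 < g x - f x"
    by (rule continuous_zero_of_integrals[of "\<lambda>x. g x - f x"]) (use assms zero in \<open>auto intro!: continuous_intros\<close>)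
  ultimately show "f x = g x" by simp
qed

lemma represents_add:
  assumes "continuous_on UNIV f" "continuous_on UNIV g" "represents f D" "represents g E"
  shows "represents (\<lambda>x. c * f x + g x) (c *\<^sub>R D + E)"
  unfolding represents_def
proof (intro allI impI)
  fix \<psi> assume \<psi>: "test_function UNIV \<psi>"
  have "(LINT x|lborel. (c * f x + g x) * \<psi> x) = c * (LINT x|lborel. f x * \<psi> x) + (LINT x|lborel. g x * \<psi> x)"
    using integrable_test_function[OF assms(1) \<psi>] integrable_test_function[OF assms(2) \<psi>]
    by (simp add: distrib_right mult.assoc)
  then show "apply_distr (c *\<^sub>R D + E) \<psi> = (LINT x|lborel. (c * f x + g x) * \<psi> x)"
    using assms(3,4) \<psi> by (simp add: apply_distr_simps represents_def)
qed

section \<open>The structure group on trees\<close>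

text \<open>Both recursions multiply the same terms over the branches: a branch is kept, after being
  cut itself, or sent to \<J> as a whole. So \<open>Delta_plus\<close> is the coproduct with its
  factors exchanged.\<close>

lemma Delta_plus_phi: "Delta_plus (phi \<tau>) = push (\<lambda>(a, s). (phi s, image_mset phi a)) (pruned \<tau>)"
proof (induction \<tau> rule: tree_induct)
  case (Node i ts)
  let ?\<psi> = "\<lambda>(a :: 'a forest, b :: 'a forest). (image_mset phi b, image_mset phi a)"
  have "push (map_prod (\<lambda>\<rho>. {#\<rho>#}) id) (Delta_plus (phi t)) + vec ({#}, {#phi t#}) = push ?\<psi> (copr_tree t)"
    if "t \<in># ts" for t
    by (simp add: Node[OF that] copr_tree_pruned push_add push_push case_prod_unfold add.commute)
  then have "(\<Prod>t\<in>#ts. push (map_prod (\<lambda>\<rho>. {#\<rho>#}) id) (Delta_plus (phi t)) + vec ({#}, {#phi t#})) =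
      (\<Prod>t\<in>#ts. push ?\<psi> (copr_tree t))"
    by (intro arg_cong[where f = prod_mset] image_mset_cong)
  also have "\<dots> = push ?\<psi> (copr ts)"
    unfolding copr_def by (rule push_prod_mset[symmetric]) (auto simp: zero_prod_def)
  finally show ?case
    by (simp add: multiset.map_comp comp_def push_push pruned_Node case_prod_unfold)
qed

lemma linear_Gamma_of: "linear (Gamma_of g)"
  unfolding Gamma_of_def[abs_def] contract_right_def by (intro linearI) (simp_all add: lin_add lin_scaleR)

lemma Gamma_of_vec_phi:
  "Gamma_of g (vec (phi \<tau>)) = push phi (lin (\<lambda>(a, s). g (image_mset phi a) *\<^sub>R vec s) (pruned \<tau>))"
  by (simp add: Gamma_of_def contract_right_def Delta_plus_phi push_lin push_scaleR case_prod_unfold)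

lemma Gamma_of_phi:
  "Gamma_of g (push phi x) = push phi (lin (\<lambda>\<tau>. lin (\<lambda>(a, s). g (image_mset phi a) *\<^sub>R vec s) (pruned \<tau>)) x)"
proof -
  have "Gamma_of g (push phi x) = lin (\<lambda>\<tau>. Gamma_of g (vec (phi \<tau>))) x"
    unfolding push_def by (rule linear_lin_eq[OF linear_Gamma_of])
  then show ?thesis by (simp only: Gamma_of_vec_phi push_lin)
qed

lemma symb_I_phi: "symb_I (phi \<tau>) = phi (Node None {#\<tau>#})"
  by (simp add: symb_I_def)

lemma symb_one_phi: "symb_one = phi (Node None {#})"
  by (simp add: symb_one_def)

text \<open>\<Gamma> commutes with \<I> up to a multiple of 1. The coefficient of 1 recovers
  \<open>g\<close>, and on a model it recovers the rough path.\<close>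

lemma Gamma_of_I:
  "Gamma_of g (vec (symb_I (phi \<tau>))) = g {#phi \<tau>#} *\<^sub>R vec symb_one +
    push symb_I (push phi (lin (\<lambda>(a, s). g (image_mset phi a) *\<^sub>R vec s) (pruned \<tau>)))"
  unfolding symb_I_phi Gamma_of_vec_phi
  by (simp add: pruned_Node copr_tree_pruned push_add lin_add push_lin push_scaleR push_push case_prod_unfold
      symb_one_phi symb_I_def)

lemma lookup_Gamma_of_I: "Poly_Mapping.lookup (Gamma_of g (vec (symb_I (phi \<tau>)))) symb_one = g {#phi \<tau>#}"
proof -
  have "symb_one \<notin> Poly_Mapping.keys (push symb_I z)" for z :: "'a symb \<Rightarrow>\<^sub>0 real"
    using keys_push[of symb_I z] by (auto simp: symb_I_def symb_one_def)
  then show ?thesis by (simp add: Gamma_of_I lookup_add lookup_vec in_keys_iff)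
qed

lemma character_prod: "g \<in> characters \<Longrightarrow> g F = (\<Prod>t\<in>#F. g {#t#})"
proof (induction F)
  case (add t F)
  then have "g ({#t#} + F) = g {#t#} * g F" unfolding characters_def by blast
  then show ?case using add by simp
qed (simp add: characters_def)

lemma char_of_Gamma_of:
  assumes "g \<in> characters"
  shows "char_of_Gamma (Gamma_of g) = g"
  unfolding char_of_Gamma_def
proof (rule the_equality)
  fix h assume h: "h \<in> characters \<and> Gamma_of g = Gamma_of h"
  have "h {#\<sigma>#} = g {#\<sigma>#}" for \<sigma>
    using lookup_Gamma_of_I[of g "psi \<sigma>"] lookup_Gamma_of_I[of h "psi \<sigma>"] h by simp
  then have "h F = g F" for F
    unfolding character_prod[OF assms, of F] character_prod[OF conjunct1[OF h], of F] by simp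
  then show "h = g" by blast
qed (use assms in simp)

lemma renorm_map_plus_phi:
  assumes "0 < \<alpha>" "v \<in> B_minus_dual \<alpha>"
  shows "renorm_map_plus \<alpha> (assoc_char \<alpha> v) (image_mset phi G) = push (image_mset phi) (subst_forest (\<lambda>t. v {#t#}) G)"
  unfolding renorm_map_plus_def subst_forest_def
  by (subst push_prod_mset) (simp_all add: multiset.map_comp comp_def renorm_map_vec[OF assms] push_push)

lemma twisted_character:
  assumes "0 < \<alpha>" "v \<in> B_minus_dual \<alpha>" and g: "g \<in> characters"
  shows "(\<lambda>F. lin g (renorm_map_plus \<alpha> (assoc_char \<alpha> v) F)) \<in> characters"
proof -
  let ?R = "renorm_map_plus \<alpha> (assoc_char \<alpha> v)"
  have g: "g {#} = 1" "g (a + b) = g a * g b" for a b using g by (auto simp: characters_def)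
  have "lin g (?R (F + H)) = lin g (?R F * ?R H)" for F H
    by (simp add: renorm_map_plus_def)
  moreover have "lin g (?R F * ?R H) = lin g (?R F) * lin g (?R H)" for F H
    by (rule lin_times) (rule g(2))
  moreover have "lin g (?R {#}) = 1"
    by (simp add: renorm_map_plus_def lin_unit g(1))
  ultimately show ?thesis by (simp add: characters_def)
qed

text \<open>This is \<open>pruned_subst_tree\<close> with \<open>g\<close> applied to the cut
  branches: substitution in the branches twists the character, substitution in the trunk is
  \<open>renorm_map\<close>.\<close>

lemma Gamma_of_renorm_map:
  assumes \<alpha>: "0 < \<alpha>" and v: "v \<in> B_minus_dual \<alpha>"
  shows "Gamma_of g (renorm_map \<alpha> (assoc_char \<alpha> v) y) =
    renorm_map \<alpha> (assoc_char \<alpha> v) (Gamma_of (\<lambda>F. lin g (renorm_map_plus \<alpha> (assoc_char \<alpha> v) F)) y)"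
proof -
  let ?w = "\<lambda>t. v {#t#}"
  let ?f = "\<lambda>(a, s). g (image_mset phi a) *\<^sub>R vec s"
  have "lin (\<lambda>t. lin ?f (pruned t)) (subst_tree ?w \<tau>) = lin (subst_tree ?w)
      (lin (\<lambda>(a, s). lin (\<lambda>H. g (image_mset phi H)) (subst_forest ?w a) *\<^sub>R vec s) (pruned \<tau>))" for \<tau>
  proof -
    have "lin (\<lambda>t. lin ?f (pruned t)) (subst_tree ?w \<tau>) = lin ?f (lin pruned (subst_tree ?w \<tau>))"
      by (simp add: lin_lin)
    also have "\<dots> = lin (\<lambda>(a, s). lin (\<lambda>H. g (image_mset phi H) *\<^sub>R subst_tree ?w s) (subst_forest ?w a)) (pruned \<tau>)"
      unfolding pruned_subst_tree by (simp add: lin_lin case_prod_unfold tensor_lin lin_scaleR_fun)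
    also have "\<dots> = lin (\<lambda>(a, s). lin (\<lambda>H. g (image_mset phi H)) (subst_forest ?w a) *\<^sub>R subst_tree ?w s) (pruned \<tau>)"
      by (simp add: lin_def scaleR_sum_left)
    finally show ?thesis by (simp add: lin_lin case_prod_unfold lin_scaleR)
  qed
  then have "Gamma_of g (renorm_map \<alpha> (assoc_char \<alpha> v) (push phi x)) =
    renorm_map \<alpha> (assoc_char \<alpha> v) (Gamma_of (\<lambda>F. lin g (renorm_map_plus \<alpha> (assoc_char \<alpha> v) F)) (push phi x))" for x
    by (simp add: renorm_map_phi[OF \<alpha> v] Gamma_of_phi renorm_map_plus_phi[OF \<alpha> v] lin_lin)
  from this[of "push psi y"] show ?thesis by simp
qed

lemma Gamma_of_twisted:
  assumes \<alpha>: "0 < \<alpha>" and v: "v \<in> B_minus_dual \<alpha>"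
  shows "Gamma_of (\<lambda>F. lin g (renorm_map_plus \<alpha> (assoc_char \<alpha> v) F)) =
    renorm_map \<alpha> (assoc_char \<alpha> (\<lambda>F. - v F)) \<circ> Gamma_of g \<circ> renorm_map \<alpha> (assoc_char \<alpha> v)"
  by (rule ext) (simp add: Gamma_of_renorm_map[OF \<alpha> v] renorm_map_inverse[OF \<alpha> v])

lemma renorm_model_eq:
  assumes \<alpha>: "0 < \<alpha>" and v: "v \<in> B_minus_dual \<alpha>" and G: "\<And>s t. G s t \<in> structure_group"
  shows "renorm_model \<alpha> (assoc_char \<alpha> v) (p, G) =
    (\<lambda>s y. p s (renorm_map \<alpha> (assoc_char \<alpha> v) y),
     \<lambda>t s. renorm_map \<alpha> (assoc_char \<alpha> (\<lambda>F. - v F)) \<circ> G t s \<circ> renorm_map \<alpha> (assoc_char \<alpha> v))"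
proof -
  have "Gamma_of (\<lambda>F. lin (char_of_Gamma (G t s)) (renorm_map_plus \<alpha> (assoc_char \<alpha> v) F)) =
      renorm_map \<alpha> (assoc_char \<alpha> (\<lambda>F. - v F)) \<circ> G t s \<circ> renorm_map \<alpha> (assoc_char \<alpha> v)" for t s
  proof -
    obtain g where g: "g \<in> characters" "G t s = Gamma_of g"
      using G[of t s] by (auto simp: structure_group_def)
    show ?thesis unfolding Gamma_of_twisted[OF \<alpha> v] g(2) char_of_Gamma_of[OF g(1)] ..
  qed
  then show ?thesis by (simp add: renorm_model_def)
qed

lemma renorm_structure_group:
  assumes \<alpha>: "0 < \<alpha>" and v: "v \<in> B_minus_dual \<alpha>" and G: "\<Gamma> \<in> structure_group"
  shows "renorm_map \<alpha> (assoc_char \<alpha> (\<lambda>F. - v F)) \<circ> \<Gamma> \<circ> renorm_map \<alpha> (assoc_char \<alpha> v) \<in> structure_group"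
proof -
  obtain g where g: "g \<in> characters" "\<Gamma> = Gamma_of g"
    using G by (auto simp: structure_group_def)
  show ?thesis
    unfolding g(2) Gamma_of_twisted[OF \<alpha> v, symmetric] structure_group_def
    using twisted_character[OF \<alpha> v g(1)] by blast
qed

lemma renorm_model_inverse:
  assumes \<alpha>: "0 < \<alpha>" and v: "v \<in> B_minus_dual \<alpha>" and G: "\<And>s t. G s t \<in> structure_group"
  shows "renorm_model \<alpha> (assoc_char \<alpha> v) (renorm_model \<alpha> (assoc_char \<alpha> (\<lambda>F. - v F)) (p, G)) = (p, G)"
proof -
  note v' = B_minus_dual_uminus[OF v]
  show ?thesis
    unfolding renorm_model_eq[OF \<alpha> v' G]
    by (subst renorm_model_eq[OF \<alpha> v])
      (use renorm_structure_group[OF \<alpha> v' G] in \<open>auto simp: comp_def renorm_map_inverse[OF \<alpha> v]\<close>)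
qed

section \<open>Effect of the renormalisation on degrees, on the symbol 1 and on \<I>\<close>

lemma degree_renorm_map:
  assumes \<alpha>: "0 < \<alpha>" and v: "v \<in> B_minus_dual \<alpha>"
    and \<rho>: "\<rho> \<in> Poly_Mapping.keys (renorm_map \<alpha> (assoc_char \<alpha> v) (vec \<sigma>))"
  shows "degree \<alpha> \<sigma> \<le> degree \<alpha> \<rho>"
proof -
  have "\<rho> \<in> Poly_Mapping.keys (push phi (subst_tree (\<lambda>t. v {#t#}) (psi \<sigma>)))"
    using \<rho> renorm_map_vec[OF \<alpha> v, of "psi \<sigma>"] by simp
  then obtain s where s: "\<rho> = phi s" "s \<in> Poly_Mapping.keys (subst_tree (\<lambda>t. v {#t#}) (psi \<sigma>))"
    using keys_push[of phi "subst_tree (\<lambda>t. v {#t#}) (psi \<sigma>)"] by blast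
  have "weight \<alpha> (psi \<sigma>) \<le> weight \<alpha> s"
    by (rule weight_subst_tree[OF \<alpha> B_minus_dual_support[OF \<alpha> v] s(2)])
  then show ?thesis by (simp add: weight_def s(1))
qed

lemma degree_renorm_map_homogeneous:
  assumes "0 < \<alpha>" "v \<in> B_minus_dual \<alpha>" "homogeneous \<alpha> \<beta> y"
    and "\<rho> \<in> Poly_Mapping.keys (renorm_map \<alpha> (assoc_char \<alpha> v) y)"
  shows "\<beta> \<le> degree \<alpha> \<rho>"
proof -
  let ?R = "renorm_map \<alpha> (assoc_char \<alpha> v)"
  have "\<rho> \<in> Poly_Mapping.keys (lin (\<lambda>\<sigma>. ?R (vec \<sigma>)) y)"
    using assms(4) by (simp only: renorm_map_eq[of \<alpha> "assoc_char \<alpha> v" y, symmetric])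
  then obtain \<sigma> where \<sigma>: "\<sigma> \<in> Poly_Mapping.keys y" "\<rho> \<in> Poly_Mapping.keys (?R (vec \<sigma>))"
    using keys_lin[of "\<lambda>\<sigma>. ?R (vec \<sigma>)" y] by blast
  have "degree \<alpha> \<sigma> = \<beta>" using assms(3) \<sigma>(1) by (simp add: homogeneous_def)
  then show ?thesis using degree_renorm_map[OF assms(1,2) \<sigma>(2)] by simp
qed

lemma renorm_map_one:
  assumes "0 < \<alpha>" "v \<in> B_minus_dual \<alpha>"
  shows "renorm_map \<alpha> (assoc_char \<alpha> v) (vec symb_one) = vec symb_one"
proof -
  have "subst_tree (\<lambda>t. v {#t#}) (Node None {#}) = vec (Node None {#})"
    by (subst subst_tree_None_root) (simp_all add: B_minus_dual_None[OF assms] push_def lin_unit)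
  then show ?thesis using renorm_map_vec[OF assms, of "Node None {#}"] by (simp add: symb_one_def)
qed

lemma renorm_map_I:
  assumes \<alpha>: "0 < \<alpha>" and v: "v \<in> B_minus_dual \<alpha>"
  shows "renorm_map \<alpha> (assoc_char \<alpha> v) (push symb_I y) = push symb_I (renorm_map \<alpha> (assoc_char \<alpha> v) y)"
proof -
  have I: "push symb_I (push phi z) = push phi (push (\<lambda>s. Node None {#s#}) z)" for z :: "'a rtree \<Rightarrow>\<^sub>0 real"
    by (simp add: push_push symb_I_def)
  have "subst_tree (\<lambda>t. v {#t#}) (Node None {#\<tau>#}) = push (\<lambda>s. Node None {#s#}) (subst_tree (\<lambda>t. v {#t#}) \<tau>)" for \<tau>
    by (subst subst_tree_None_root) (simp_all add: B_minus_dual_None[OF \<alpha> v] push_push)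
  then have "renorm_map \<alpha> (assoc_char \<alpha> v) (push symb_I (push phi x)) =
      push symb_I (renorm_map \<alpha> (assoc_char \<alpha> v) (push phi x))" for x
    unfolding I renorm_map_phi[OF \<alpha> v] by (simp add: push_lin)
  from this[of "push psi y"] show ?thesis by simp
qed

section \<open>Renormalised models are models\<close>

text \<open>The constant \<open>B powr a\<close> is cruder than \<open>B powr (a - b)\<close>, but
  independent of \<open>b\<close>, which varies with the component that is estimated.\<close>

lemma powr_le_powr_mult:
  fixes x B a b :: real
  assumes "0 \<le> x" "x \<le> B" "1 \<le> B" "0 \<le> b" "b \<le> a"
  shows "x powr a \<le> B powr a * x powr b"
proof (cases "x = 0")
  case False
  have "x powr a = x powr (a - b) * x powr b" by (simp flip: powr_add)
  also have "\<dots> \<le> B powr a * x powr b"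
  proof (rule mult_right_mono)
    have "x powr (a - b) \<le> B powr (a - b)" using assms by (intro powr_mono2) auto
    also have "\<dots> \<le> B powr a" using assms by (intro powr_mono) auto
    finally show "x powr (a - b) \<le> B powr a" .
  qed simp
  finally show ?thesis .
qed simp

lemma lin_abs_le: "\<bar>lin f x\<bar> \<le> (\<Sum>a\<in>Poly_Mapping.keys x. \<bar>Poly_Mapping.lookup x a\<bar> * \<bar>f a\<bar>)" for f :: "'a \<Rightarrow> real"
  unfolding lin_def by (rule order.trans[OF sum_abs]) (simp add: abs_mult)

lemma apply_distr_lin: "apply_distr (lin F x) \<psi> = lin (\<lambda>a. apply_distr (F a) \<psi>) x"
  by (rule linear_lin_eq) (intro linearI, simp_all add: apply_distr_simps)

lemma keys_Gamma_of: "Poly_Mapping.keys (Gamma_of g (vec \<sigma>)) \<subseteq> fst ` Poly_Mapping.keys (Delta_plus \<sigma>)"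
proof
  fix \<rho> assume "\<rho> \<in> Poly_Mapping.keys (Gamma_of g (vec \<sigma>))"
  then obtain x where "x \<in> Poly_Mapping.keys (Delta_plus \<sigma>)" "\<rho> \<in> Poly_Mapping.keys (case x of (a, b) \<Rightarrow> g b *\<^sub>R vec a)"
    using keys_lin[of "\<lambda>(a, b). g b *\<^sub>R vec a" "Delta_plus \<sigma>"]
    unfolding Gamma_of_def contract_right_def lin_vec by blast
  then show "\<rho> \<in> fst ` Poly_Mapping.keys (Delta_plus \<sigma>)"
    by (cases x) (force simp: in_keys_iff lookup_vec split: if_splits)
qed

text \<open>Renormalisation does not lower degrees, and since \<open>r \<le> 1\<close> a symbol of
  degree at least \<beta> satisfies the bound for \<beta>.\<close>

lemma renorm_distribution_bound:
  assumes \<alpha>: "0 < \<alpha>" and v: "v \<in> B_minus_dual \<alpha>"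
    and lin: "\<And>t. linear (p t)"
    and bound: "\<And>\<beta> y. homogeneous \<alpha> \<beta> y \<Longrightarrow> \<exists>C. \<forall>t\<in>K. \<forall>r\<in>{0<..1}. \<forall>f\<in>unit_test_functions.
           \<bar>apply_distr (p t y) (\<lambda>x. inverse r * f ((x - t) / r))\<bar> \<le> C * r powr \<beta>"
    and y: "homogeneous \<alpha> \<beta> y"
  shows "\<exists>C. \<forall>t\<in>K. \<forall>r\<in>{0<..1}. \<forall>f\<in>unit_test_functions.
    \<bar>apply_distr (p t (renorm_map \<alpha> (assoc_char \<alpha> v) y)) (\<lambda>x. inverse r * f ((x - t) / r))\<bar> \<le> C * r powr \<beta>"
proof -
  let ?z = "renorm_map \<alpha> (assoc_char \<alpha> v) y"
  let ?a = "\<lambda>\<sigma> t r f. apply_distr (p t (vec \<sigma>)) (\<lambda>x. inverse r * f ((x - t) / r))"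
  have "\<forall>\<sigma>. \<exists>C. \<forall>t\<in>K. \<forall>r\<in>{0<..1}. \<forall>f\<in>unit_test_functions. \<bar>?a \<sigma> t r f\<bar> \<le> C * r powr degree \<alpha> \<sigma>"
    by (intro allI bound) (simp add: homogeneous_def)
  then obtain C where C: "\<And>\<sigma> t r f. t \<in> K \<Longrightarrow> r \<in> {0<..1} \<Longrightarrow> f \<in> unit_test_functions \<Longrightarrow>
      \<bar>?a \<sigma> t r f\<bar> \<le> C \<sigma> * r powr degree \<alpha> \<sigma>"
    by metis
  show ?thesis
  proof (intro exI ballI)
    fix t r :: real and f :: "real \<Rightarrow> real" assume H: "t \<in> K" "r \<in> {0<..1}" "f \<in> unit_test_functions"
    have "\<bar>?a \<sigma> t r f\<bar> \<le> \<bar>C \<sigma>\<bar> * r powr \<beta>" if "\<sigma> \<in> Poly_Mapping.keys ?z" for \<sigma>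
    proof -
      have "\<beta> \<le> degree \<alpha> \<sigma>" by (rule degree_renorm_map_homogeneous[OF \<alpha> v y that])
      then have "r powr degree \<alpha> \<sigma> \<le> r powr \<beta>" using H(2) by (intro powr_mono') auto
      then have "C \<sigma> * r powr degree \<alpha> \<sigma> \<le> \<bar>C \<sigma>\<bar> * r powr \<beta>"
        by (intro mult_mono) auto
      then show ?thesis using C[OF H, of \<sigma>] by linarith
    qed
    then have "(\<Sum>\<sigma>\<in>Poly_Mapping.keys ?z. \<bar>Poly_Mapping.lookup ?z \<sigma>\<bar> * \<bar>?a \<sigma> t r f\<bar>) \<le>
        (\<Sum>\<sigma>\<in>Poly_Mapping.keys ?z. \<bar>Poly_Mapping.lookup ?z \<sigma>\<bar> * (\<bar>C \<sigma>\<bar> * r powr \<beta>))"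
      by (intro sum_mono mult_left_mono) auto
    moreover have "p t ?z = lin (\<lambda>\<sigma>. p t (vec \<sigma>)) ?z" by (rule linear_eq_lin[OF lin])
    ultimately show "\<bar>apply_distr (p t ?z) (\<lambda>x. inverse r * f ((x - t) / r))\<bar> \<le>
        (\<Sum>\<sigma>\<in>Poly_Mapping.keys ?z. \<bar>Poly_Mapping.lookup ?z \<sigma>\<bar> * \<bar>C \<sigma>\<bar>) * r powr \<beta>"
      using lin_abs_le[of "\<lambda>\<sigma>. ?a \<sigma> t r f" ?z] by (simp add: apply_distr_lin sum_distrib_right mult.assoc)
  qed
qed

text \<open>The component at \<rho> comes from symbols \<sigma> of the renormalised \<open>y\<close>
  and \<rho>' of their images under \<open>G s t\<close>, and the degrees satisfy \<rho>' \<le>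
  \<rho> < \<beta> \<le> \<sigma>. So the old exponent is at least the required one, and on a
  compact set the excess goes into the constant.\<close>

lemma renorm_structure_bound:
  fixes v :: "'d forest \<Rightarrow> real"
  assumes \<alpha>: "0 < \<alpha>" and v: "v \<in> B_minus_dual \<alpha>" and K: "compact K"
    and G: "\<And>s t. G s t \<in> structure_group"
    and bound: "\<And>\<beta> y. homogeneous \<alpha> \<beta> y \<Longrightarrow> \<exists>C. \<forall>s\<in>K. \<forall>t\<in>K. \<forall>\<rho>. degree \<alpha> \<rho> < \<beta> \<longrightarrow>
           \<bar>Poly_Mapping.lookup (G s t y) \<rho>\<bar> \<le> C * \<bar>t - s\<bar> powr (\<beta> - degree \<alpha> \<rho>)"
    and y: "homogeneous \<alpha> \<beta> y"
  shows "\<exists>C. \<forall>s\<in>K. \<forall>t\<in>K. \<forall>\<rho>. degree \<alpha> \<rho> < \<beta> \<longrightarrow>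
    \<bar>Poly_Mapping.lookup (renorm_map \<alpha> (assoc_char \<alpha> (\<lambda>F. - v F)) (G s t (renorm_map \<alpha> (assoc_char \<alpha> v) y))) \<rho>\<bar>
      \<le> C * \<bar>t - s\<bar> powr (\<beta> - degree \<alpha> \<rho>)"
proof -
  let ?z = "renorm_map \<alpha> (assoc_char \<alpha> v) y"
  let ?A = "Poly_Mapping.keys ?z"
  let ?N = "renorm_map \<alpha> (assoc_char \<alpha> (\<lambda>F. - v F))"
  \<comment> \<open>The symbols that can occur in \<open>G s t (vec \<sigma>)\<close> are determined
    by \<sigma> through \<open>Delta_plus\<close>; this makes the sum finite uniformly in
    \<open>s\<close> and \<open>t\<close>.\<close>
  define L where "L = (\<Union>\<sigma>\<in>?A. fst ` Poly_Mapping.keys (Delta_plus \<sigma>))"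
  define m where "m \<sigma> = (\<Sum>\<rho>\<in>Poly_Mapping.keys (?N (vec \<sigma>)). \<bar>Poly_Mapping.lookup (?N (vec \<sigma>)) \<rho>\<bar>)" for \<sigma>
  have finL: "finite L" by (simp add: L_def)
  have m: "\<bar>Poly_Mapping.lookup (?N (vec \<sigma>)) \<rho>\<bar> \<le> m \<sigma>" for \<sigma> \<rho>
  proof (cases "\<rho> \<in> Poly_Mapping.keys (?N (vec \<sigma>))")
    case True
    then show ?thesis unfolding m_def by (intro member_le_sum) auto
  next
    case False
    then show ?thesis unfolding m_def by (simp add: in_keys_iff sum_nonneg)
  qed
  have "\<forall>\<sigma>. \<exists>C. \<forall>s\<in>K. \<forall>t\<in>K. \<forall>\<rho>. degree \<alpha> \<rho> < degree \<alpha> \<sigma> \<longrightarrow>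
      \<bar>Poly_Mapping.lookup (G s t (vec \<sigma>)) \<rho>\<bar> \<le> C * \<bar>t - s\<bar> powr (degree \<alpha> \<sigma> - degree \<alpha> \<rho>)"
    by (intro allI bound) (simp add: homogeneous_def)
  then obtain C where C: "\<And>\<sigma> s t \<rho>. s \<in> K \<Longrightarrow> t \<in> K \<Longrightarrow> degree \<alpha> \<rho> < degree \<alpha> \<sigma> \<Longrightarrow>
      \<bar>Poly_Mapping.lookup (G s t (vec \<sigma>)) \<rho>\<bar> \<le> C \<sigma> * \<bar>t - s\<bar> powr (degree \<alpha> \<sigma> - degree \<alpha> \<rho>)"
    by metis
  obtain B0 where B0: "\<And>x. x \<in> K \<Longrightarrow> \<bar>x\<bar> \<le> B0"
    using compact_imp_bounded[OF K] by (auto simp: bounded_real)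
  define B where "B = max 1 (2 * B0)"
  have B: "1 \<le> B" "\<bar>t - s\<bar> \<le> B" if "s \<in> K" "t \<in> K" for s t
    using B0[OF that(1)] B0[OF that(2)] by (auto simp: B_def)
  define D where "D \<sigma> \<rho> = \<bar>C \<sigma>\<bar> * B powr (degree \<alpha> \<sigma> - degree \<alpha> \<rho>) * m \<rho>" for \<sigma> \<rho>
  show ?thesis
  proof (intro exI ballI allI impI)
    fix s t :: real and \<rho> :: "'d symb" assume st: "s \<in> K" "t \<in> K" and \<rho>: "degree \<alpha> \<rho> < \<beta>"
    let ?x = "\<bar>t - s\<bar> powr (\<beta> - degree \<alpha> \<rho>)"
    obtain g where g: "G s t = Gamma_of g" using G[of s t] by (auto simp: structure_group_def)
    have linG: "linear (G s t)" unfolding g by (rule linear_Gamma_of)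
    have summand: "\<bar>Poly_Mapping.lookup (G s t (vec \<sigma>)) \<rho>' * Poly_Mapping.lookup (?N (vec \<rho>')) \<rho>\<bar> \<le> D \<sigma> \<rho>' * ?x"
      if \<sigma>: "\<sigma> \<in> ?A" for \<sigma> \<rho>'
    proof (cases "Poly_Mapping.lookup (?N (vec \<rho>')) \<rho> = 0")
      case True
      then show ?thesis using m[of \<rho>' \<rho>] by (simp add: D_def)
    next
      case False
      then have "degree \<alpha> \<rho>' \<le> degree \<alpha> \<rho>"
        by (intro degree_renorm_map[OF \<alpha> B_minus_dual_uminus[OF v]]) (simp add: in_keys_iff)
      moreover have "\<beta> \<le> degree \<alpha> \<sigma>" by (rule degree_renorm_map_homogeneous[OF \<alpha> v y \<sigma>])
      ultimately have d: "degree \<alpha> \<rho>' < degree \<alpha> \<sigma>" "\<beta> - degree \<alpha> \<rho> \<le> degree \<alpha> \<sigma> - degree \<alpha> \<rho>'"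
        using \<rho> by linarith+
      have "\<bar>Poly_Mapping.lookup (G s t (vec \<sigma>)) \<rho>'\<bar> \<le> C \<sigma> * \<bar>t - s\<bar> powr (degree \<alpha> \<sigma> - degree \<alpha> \<rho>')"
        by (rule C[OF st d(1)])
      also have "\<dots> \<le> \<bar>C \<sigma>\<bar> * (B powr (degree \<alpha> \<sigma> - degree \<alpha> \<rho>') * ?x)"
        using powr_le_powr_mult[of "\<bar>t - s\<bar>" B "\<beta> - degree \<alpha> \<rho>", OF _ B(2)[OF st] B(1)[OF st] _ d(2)] \<rho>
        by (intro mult_mono) auto
      finally have "\<bar>Poly_Mapping.lookup (G s t (vec \<sigma>)) \<rho>'\<bar> * \<bar>Poly_Mapping.lookup (?N (vec \<rho>')) \<rho>\<bar> \<le>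
          \<bar>C \<sigma>\<bar> * (B powr (degree \<alpha> \<sigma> - degree \<alpha> \<rho>') * ?x) * m \<rho>'"
        using m by (intro mult_mono) auto
      then show ?thesis by (simp add: abs_mult D_def mult_ac)
    qed
    have inner: "\<bar>Poly_Mapping.lookup (?N (G s t (vec \<sigma>))) \<rho>\<bar> \<le> (\<Sum>\<rho>'\<in>L. D \<sigma> \<rho>') * ?x" if \<sigma>: "\<sigma> \<in> ?A" for \<sigma>
    proof -
      have sub: "Poly_Mapping.keys (G s t (vec \<sigma>)) \<subseteq> L"
        using keys_Gamma_of[of g \<sigma>] \<sigma> unfolding g L_def by blast
      have "Poly_Mapping.lookup (?N (G s t (vec \<sigma>))) \<rho> =
          (\<Sum>\<rho>'\<in>L. Poly_Mapping.lookup (G s t (vec \<sigma>)) \<rho>' * Poly_Mapping.lookup (?N (vec \<rho>')) \<rho>)"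
        by (subst renorm_map_eq) (simp add: lookup_sum lin_superset[OF finL sub])
      also have "\<bar>\<dots>\<bar> \<le> (\<Sum>\<rho>'\<in>L. D \<sigma> \<rho>' * ?x)"
        by (rule order.trans[OF sum_abs]) (intro sum_mono summand[OF \<sigma>])
      finally show ?thesis by (simp add: sum_distrib_right)
    qed
    have "G s t ?z = lin (\<lambda>\<sigma>. G s t (vec \<sigma>)) ?z" by (rule linear_eq_lin[OF linG])
    then have "Poly_Mapping.lookup (?N (G s t ?z)) \<rho> = lin (\<lambda>\<sigma>. Poly_Mapping.lookup (?N (G s t (vec \<sigma>))) \<rho>) ?z"
      by (simp add: renorm_map_lin lookup_lin)
    then have "\<bar>Poly_Mapping.lookup (?N (G s t ?z)) \<rho>\<bar> \<le>
        (\<Sum>\<sigma>\<in>?A. \<bar>Poly_Mapping.lookup ?z \<sigma>\<bar> * \<bar>Poly_Mapping.lookup (?N (G s t (vec \<sigma>))) \<rho>\<bar>)"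
      using lin_abs_le by metis
    also have "\<dots> \<le> (\<Sum>\<sigma>\<in>?A. \<bar>Poly_Mapping.lookup ?z \<sigma>\<bar> * ((\<Sum>\<rho>'\<in>L. D \<sigma> \<rho>') * ?x))"
      by (intro sum_mono mult_left_mono inner) auto
    finally show "\<bar>Poly_Mapping.lookup (?N (G s t ?z)) \<rho>\<bar> \<le>
        (\<Sum>\<sigma>\<in>?A. \<bar>Poly_Mapping.lookup ?z \<sigma>\<bar> * (\<Sum>\<rho>'\<in>L. D \<sigma> \<rho>')) * ?x"
      by (simp add: sum_distrib_right mult.assoc)
  qed
qed

lemma models_structure_group: "(p, G) \<in> models \<alpha> T U \<Longrightarrow> G s t \<in> structure_group"
proof -
  assume "(p, G) \<in> models \<alpha> T U"
  then have "is_model \<alpha> (p, G)" by (simp add: models_def)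
  from this[unfolded is_model_def prod.case, THEN conjunct2, THEN conjunct1] show ?thesis by blast
qed

text \<open>The new structure maps are conjugates, so in the algebraic identities the
  renormalisation cancels against its inverse. The condition on \<open>U\<close> is carried over
  because the renormalisation commutes with \<open>symb_I\<close>.\<close>

theorem renorm_model_in_models:
  assumes \<alpha>: "0 < \<alpha>" and v: "v \<in> B_minus_dual \<alpha>" and P: "P \<in> models \<alpha> T U"
  shows "renorm_model \<alpha> (assoc_char \<alpha> v) P \<in> models \<alpha> T U"
proof -
  obtain p G where pG: "P = (p, G)" by (cases P)
  let ?M = "renorm_map \<alpha> (assoc_char \<alpha> v)"
  let ?N = "renorm_map \<alpha> (assoc_char \<alpha> (\<lambda>F. - v F))"
  note inv = renorm_map_inverse[OF \<alpha> v]
  note D = P[unfolded pG models_def mem_Collect_eq prod.case]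
  have one: "represents (\<lambda>_. 1) (p t (vec symb_one))" for t
    using D[THEN conjunct2, THEN conjunct1] by blast
  have stop: "G s t = id" if "s \<le> 0 \<and> t \<le> 0 \<or> T \<le> s \<and> T \<le> t" for s t
    using D[THEN conjunct2, THEN conjunct2, THEN conjunct1] that by blast
  have der: "- apply_distr (p t (push symb_I y)) (deriv \<psi>) = apply_distr (p t y) \<psi>"
    if "test_function U \<psi>" for t y \<psi>
    using D[THEN conjunct2, THEN conjunct2, THEN conjunct2] that by blast
  note E1 = D[THEN conjunct1, unfolded is_model_def prod.case]
  note E2 = E1[THEN conjunct2] note E3 = E2[THEN conjunct2] note E4 = E3[THEN conjunct2]
  note E5 = E4[THEN conjunct2] note E6 = E5[THEN conjunct2]
  have lin: "linear (p t)" for t using E1[THEN conjunct1] by blast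
  have SG: "G s t \<in> structure_group" for s t using E2[THEN conjunct1] by blast
  have diag: "G t t = id" for t using E3[THEN conjunct1] by blast
  have comp: "G s t \<circ> G t u = G s u" for s t u using E4[THEN conjunct1] by blast
  have trans: "p s \<circ> G s t = p t" for s t using E5[THEN conjunct1] by blast
  have b1: "\<exists>C. \<forall>t\<in>K. \<forall>r\<in>{0<..1}. \<forall>f\<in>unit_test_functions.
           \<bar>apply_distr (p t y) (\<lambda>x. inverse r * f ((x - t) / r))\<bar> \<le> C * r powr \<beta>"
    if "homogeneous \<alpha> \<beta> y" "compact K" for \<beta> y K
    using E6[THEN conjunct1, THEN spec, THEN spec, THEN spec, THEN mp, THEN mp, OF that] .
  have b2: "\<exists>C. \<forall>s\<in>K. \<forall>t\<in>K. \<forall>\<rho>. degree \<alpha> \<rho> < \<beta> \<longrightarrow>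
           \<bar>Poly_Mapping.lookup (G s t y) \<rho>\<bar> \<le> C * \<bar>t - s\<bar> powr (\<beta> - degree \<alpha> \<rho>)"
    if "homogeneous \<alpha> \<beta> y" "compact K" for \<beta> y K
    using E6[THEN conjunct2, THEN spec, THEN spec, THEN spec, THEN mp, THEN mp, OF that] .
  have "is_model \<alpha> (\<lambda>s y. p s (?M y), \<lambda>t s. ?N \<circ> G t s \<circ> ?M)"
    unfolding is_model_def prod.case
  proof (intro conjI allI impI)
    show "linear (\<lambda>y. p t (?M y))" for t
      using linear_compose[OF linear_renorm_map lin] by (simp add: comp_def)
    show "?N \<circ> G s t \<circ> ?M \<in> structure_group" for s t
      by (rule renorm_structure_group[OF \<alpha> v SG])
    show "?N \<circ> G t t \<circ> ?M = id" for t
      unfolding diag by (simp add: fun_eq_iff inv)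
    show "?N \<circ> G s t \<circ> ?M \<circ> (?N \<circ> G t u \<circ> ?M) = ?N \<circ> G s u \<circ> ?M" for s t u
      using fun_cong[OF comp[of s t u]] by (simp add: fun_eq_iff inv)
    show "(\<lambda>y. p s (?M y)) \<circ> (?N \<circ> G s t \<circ> ?M) = (\<lambda>y. p t (?M y))" for s t
      using fun_cong[OF trans[of s t]] by (simp add: fun_eq_iff inv)
    show "\<exists>C. \<forall>t\<in>K. \<forall>r\<in>{0<..1}. \<forall>f\<in>unit_test_functions.
           \<bar>apply_distr (p t (?M y)) (\<lambda>x. inverse r * f ((x - t) / r))\<bar> \<le> C * r powr \<beta>"
      if "homogeneous \<alpha> \<beta> y" "compact K" for \<beta> y K
      by (rule renorm_distribution_bound[OF \<alpha> v lin b1[OF _ that(2)] that(1)])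
    show "\<exists>C. \<forall>s\<in>K. \<forall>t\<in>K. \<forall>\<rho>. degree \<alpha> \<rho> < \<beta> \<longrightarrow>
           \<bar>Poly_Mapping.lookup ((?N \<circ> G s t \<circ> ?M) y) \<rho>\<bar> \<le> C * \<bar>t - s\<bar> powr (\<beta> - degree \<alpha> \<rho>)"
      if "homogeneous \<alpha> \<beta> y" "compact K" for \<beta> y K
      unfolding comp_def by (rule renorm_structure_bound[OF \<alpha> v that(2) SG b2[OF _ that(2)] that(1)])
  qed
  moreover have "?N \<circ> id \<circ> ?M = id" by (simp add: fun_eq_iff inv)
  ultimately show ?thesis
    unfolding pG renorm_model_eq[OF \<alpha> v SG] models_def
    using one stop der by (simp add: renorm_map_one[OF \<alpha> v] renorm_map_I[OF \<alpha> v])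
qed

section \<open>Renormalised rough paths\<close>

lemma rough_pathsD:
  assumes "X \<in> rough_paths \<alpha> T" "s \<in> {0..T}" "t \<in> {0..T}"
  shows "X s t \<in> characters" "u \<in> {0..T} \<Longrightarrow> X s t = star (X s u) (X u t)"
    "X s t {#Node None {#}#} = t - s" "X s t {#Node None F#} = (LBINT u=ereal s..ereal t. X s u F)"
proof -
  note D = assms(1)[unfolded rough_paths_def mem_Collect_eq]
  show "X s t \<in> characters"
    by (rule D[THEN conjunct1, rule_format, OF assms(2,3)])
  show "X s t = star (X s u) (X u t)" if "u \<in> {0..T}"
    by (rule D[THEN conjunct2, THEN conjunct1, rule_format, OF assms(2) that assms(3)])
  show "X s t {#Node None {#}#} = t - s"
    by (rule D[THEN conjunct2, THEN conjunct2, THEN conjunct2, THEN conjunct1, rule_format, OF assms(2,3)])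
  show "X s t {#Node None F#} = (LBINT u=ereal s..ereal t. X s u F)"
    by (rule D[THEN conjunct2, THEN conjunct2, THEN conjunct2, THEN conjunct2, rule_format, OF assms(2,3)])
qed

text \<open>An idempotent of the group is its unit: in Chen's relation at \<open>(t, t)\<close> the
  cut without branches contributes the value at \<tau> a second time, and every other cut has a
  smaller branch, where the induction hypothesis gives 0.\<close>

lemma rough_path_diag:
  assumes X: "X \<in> rough_paths \<alpha> T" and t: "t \<in> {0..T}"
  shows "X t t {#\<tau>#} = 0"
proof (induction "num_nodes \<tau>" arbitrary: \<tau> rule: less_induct)
  case less
  let ?x = "X t t"
  have x: "?x \<in> characters" and Chen: "?x = star ?x ?x"
    using rough_pathsD(1,2)[OF X t t] t by blast+
  have x1: "?x {#} = 1" using x by (simp add: characters_def)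
  have "?x {#\<tau>#} = star ?x ?x {#\<tau>#}" by (rule fun_cong[OF Chen])
  also have "\<dots> = ?x {#\<tau>#} + lin (\<lambda>(a, s). ?x a * ?x {#s#}) (pruned \<tau>)"
    by (simp add: star_def lin_copr_tree x1)
  also have "lin (\<lambda>(a, s). ?x a * ?x {#s#}) (pruned \<tau>) = lin (\<lambda>(a, s). empty_indicator a * ?x {#s#}) (pruned \<tau>)"
  proof (rule lin_cong)
    fix y assume y: "y \<in> Poly_Mapping.keys (pruned \<tau>)"
    obtain a s where as: "y = (a, s)" by (cases y)
    show "(case y of (a, s) \<Rightarrow> ?x a * ?x {#s#}) = (case y of (a, s) \<Rightarrow> empty_indicator a * ?x {#s#})"
    proof (cases a)
      case empty
      then show ?thesis by (simp add: as x1)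
    next
      case (add u b)
      then have "?x {#u#} = 0" using num_nodes_pruned[of a s \<tau> u] y by (intro less) (simp add: as)
      then have "?x a = 0" using character_prod[OF x, of a] add by simp
      then show ?thesis by (simp add: as add)
    qed
  qed
  finally show ?case by (simp add: pruned_counit)
qed

lemma matches_vec:
  assumes "matches T X P" "s \<in> {0..T}"
  obtains f where "continuous_on UNIV f" "represents f (fst P s (push symb_I (push phi b)))"
    "\<And>t. t \<in> {0..T} \<Longrightarrow> f t = lin (\<lambda>\<tau>. X s t {#\<tau>#}) b"
  using assms unfolding matches_def by blast

text \<open>Evaluate \<open>\<Pi>\<^sub>s \<I>(\<sigma>) = \<Pi>\<^sub>t \<Gamma>\<^sub>t\<^sub>s
  \<I>(\<sigma>)\<close> at the point \<open>t\<close>: the part in the image of \<I> vanishes there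
  by \<open>rough_path_diag\<close>, and the multiple of 1 remains.\<close>

lemma matches_structure_group:
  assumes X: "X \<in> rough_paths \<alpha> T" and P: "(p, G) \<in> models \<alpha> T U" and m: "matches T X (p, G)"
    and st: "s \<in> {0..T}" "t \<in> {0..T}"
  shows "X s t {#\<tau>#} = Poly_Mapping.lookup (G t s (vec (symb_I (phi \<tau>)))) symb_one"
proof -
  note D = P[unfolded models_def mem_Collect_eq prod.case]
  note E = D[THEN conjunct1, unfolded is_model_def prod.case]
  have lin: "linear (p t)" using E[THEN conjunct1] by blast
  have trans: "p t \<circ> G t s = p s" using E[THEN conjunct2, THEN conjunct2, THEN conjunct2, THEN conjunct2, THEN conjunct1] by blast
  have one: "represents (\<lambda>_. 1) (p t (vec symb_one))" using D[THEN conjunct2, THEN conjunct1] by blast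
  obtain g where g: "G t s = Gamma_of g"
    using models_structure_group[OF P, of t s] by (auto simp: structure_group_def)
  define b where "b = lin (\<lambda>(a, s). g (image_mset phi a) *\<^sub>R vec s) (pruned \<tau>)"
  obtain f where f: "continuous_on UNIV f" "represents f (p s (push symb_I (push phi (vec \<tau>))))"
    "\<And>u. u \<in> {0..T} \<Longrightarrow> f u = lin (\<lambda>\<tau>. X s u {#\<tau>#}) (vec \<tau>)"
    using matches_vec[OF m st(1), of "vec \<tau>"] by (metis fst_conv)
  obtain h where h: "continuous_on UNIV h" "represents h (p t (push symb_I (push phi b)))"
    "\<And>u. u \<in> {0..T} \<Longrightarrow> h u = lin (\<lambda>\<tau>. X t u {#\<tau>#}) b"
    using matches_vec[OF m st(2), of b] by (metis fst_conv)
  have "p s (vec (symb_I (phi \<tau>))) = p t (G t s (vec (symb_I (phi \<tau>))))"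
    using fun_cong[OF trans] by simp
  also have "\<dots> = g {#phi \<tau>#} *\<^sub>R p t (vec symb_one) + p t (push symb_I (push phi b))"
    unfolding g Gamma_of_I b_def by (simp add: linear_add[OF lin] linear_scale[OF lin])
  finally have "represents (\<lambda>x. g {#phi \<tau>#} * 1 + h x) (p s (push symb_I (push phi (vec \<tau>))))"
    using represents_add[OF _ h(1) one h(2), of "g {#phi \<tau>#}"] by simp
  then have "f = (\<lambda>x. g {#phi \<tau>#} * 1 + h x)"
    by (intro represents_unique[OF f(1) _ f(2)] continuous_intros h(1))
  then have "f t = g {#phi \<tau>#} + h t" by simp
  moreover have "h t = 0"
    unfolding h(3)[OF st(2)] by (simp add: rough_path_diag[OF X st(2)])
  moreover have "f t = X s t {#\<tau>#}" using f(3)[OF st(2)] by simp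
  ultimately show ?thesis by (simp add: g lookup_Gamma_of_I)
qed

text \<open>
  The definition of a rough path only gives the exponent \<open>\<alpha> |\<tau>|\<close>; that the label \<open>0\<close> counts with
  weight \<open>1\<close> is extracted from the bounds of the model.
\<close>

lemma rough_path_weight_bound:
  assumes \<alpha>: "0 < \<alpha>" and X: "X \<in> rough_paths \<alpha> T" and P: "(p, G) \<in> models \<alpha> T U" and m: "matches T X (p, G)"
  shows "\<exists>C. \<forall>s\<in>{0..T}. \<forall>t\<in>{0..T}. \<bar>X s t {#\<tau>#}\<bar> \<le> C * \<bar>t - s\<bar> powr weight \<alpha> \<tau>"
proof -
  let ?y = "vec (symb_I (phi \<tau>))"
  note D = P[unfolded models_def mem_Collect_eq prod.case]
  note E = D[THEN conjunct1, unfolded is_model_def prod.case, THEN conjunct2, THEN conjunct2,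
      THEN conjunct2, THEN conjunct2, THEN conjunct2, THEN conjunct2]
  have deg: "degree \<alpha> (symb_I (phi \<tau>)) = weight \<alpha> \<tau>" "degree \<alpha> (symb_one :: 'a symb) = 0"
    by (simp_all add: symb_I_def symb_one_def weight_def)
  have "homogeneous \<alpha> (weight \<alpha> \<tau>) ?y" by (simp add: homogeneous_def deg)
  from E[THEN spec, THEN spec, THEN spec, THEN mp, THEN mp, OF this compact_Icc[of 0 T]]
  obtain C where C: "\<And>s t \<rho>. s \<in> {0..T} \<Longrightarrow> t \<in> {0..T} \<Longrightarrow> degree \<alpha> \<rho> < weight \<alpha> \<tau> \<Longrightarrow>
      \<bar>Poly_Mapping.lookup (G s t ?y) \<rho>\<bar> \<le> C * \<bar>t - s\<bar> powr (weight \<alpha> \<tau> - degree \<alpha> \<rho>)"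
    by blast
  have "\<bar>X s t {#\<tau>#}\<bar> \<le> C * \<bar>t - s\<bar> powr weight \<alpha> \<tau>" if "s \<in> {0..T}" "t \<in> {0..T}" for s t
    using C[OF that(2,1), of symb_one] weight_pos[OF \<alpha>, of \<tau>]
    by (simp add: deg matches_structure_group[OF X P m that] abs_minus_commute)
  then show ?thesis by blast
qed

lemma weight_ge_num_nodes:
  assumes "0 < \<alpha>" "\<alpha> < 1"
  shows "\<alpha> * real (num_nodes \<tau>) \<le> weight \<alpha> \<tau>"
proof (induction \<tau> rule: tree_induct)
  case (Node i ts)
  then have "\<alpha> * real (\<Sum>t\<in>#ts. num_nodes t) \<le> (\<Sum>t\<in>#ts. weight \<alpha> t)"
  proof (induction ts)
    case (add t ts)
    then have "\<alpha> * real (num_nodes t) \<le> weight \<alpha> t" "\<alpha> * real (\<Sum>t\<in>#ts. num_nodes t) \<le> (\<Sum>t\<in>#ts. weight \<alpha> t)"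
      by simp_all
    then show ?case by (simp add: distrib_left)
  qed simp
  then show ?case using assms by (simp add: weight_Node distrib_left)
qed

lemma weight_ge_forest_nodes:
  assumes "0 < \<alpha>" "\<alpha> < 1"
  shows "\<alpha> * real (forest_nodes F) \<le> (\<Sum>t\<in>#F. weight \<alpha> t)"
proof (induction F)
  case (add t F)
  then show ?case using weight_ge_num_nodes[OF assms, of t] by (simp add: forest_nodes_def distrib_left)
qed (simp add: forest_nodes_def)

lemma character_bound:
  fixes x :: "'d forest \<Rightarrow> real"
  assumes x: "x \<in> characters" and r: "0 < r" and C: "\<And>\<tau>. \<bar>x {#\<tau>#}\<bar> \<le> C \<tau> * r powr weight \<alpha> \<tau>"
  shows "\<bar>x H\<bar> \<le> (\<Prod>t\<in>#H. C t) * r powr (\<Sum>t\<in>#H. weight \<alpha> t)"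
proof (induction H)
  case empty
  show ?case using x r by (simp add: characters_def)
next
  case (add t H)
  have "x ({#t#} + H) = x {#t#} * x H" using x unfolding characters_def by blast
  then have "\<bar>x (add_mset t H)\<bar> = \<bar>x {#t#}\<bar> * \<bar>x H\<bar>" by (simp add: abs_mult)
  also have "\<dots> \<le> (C t * r powr weight \<alpha> t) * ((\<Prod>t\<in>#H. C t) * r powr (\<Sum>t\<in>#H. weight \<alpha> t))"
    using C[of t] add by (intro mult_mono) (auto intro: order.trans[OF abs_ge_zero])
  finally show ?case by (simp add: powr_add mult_ac)
qed

lemma translate_character: "f \<in> characters \<Longrightarrow> translate v f \<in> characters"
  unfolding characters_def translate_def
  by (auto simp: lin_unit subst_forest_union lin_times)

lemma interval_integral_lin:
  assumes "\<And>H. interval_lebesgue_integrable lborel a b (\<lambda>u. f H u :: real)"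
  shows "(LBINT u=a..b. lin (\<lambda>H. f H u) x) = lin (\<lambda>H. LBINT u=a..b. f H u) x"
    "interval_lebesgue_integrable lborel a b (\<lambda>u. lin (\<lambda>H. f H u) x)"
proof -
  have "interval_lebesgue_integrable lborel a b (\<lambda>u. \<Sum>H\<in>A. c H * f H u) \<and>
      (LBINT u=a..b. (\<Sum>H\<in>A. c H * f H u)) = (\<Sum>H\<in>A. c H * (LBINT u=a..b. f H u))" if "finite A" for A c
    using that
  proof (induction A)
    case empty
    show ?case by (simp add: interval_lebesgue_integrable_def set_integrable_def interval_lebesgue_integral_def set_lebesgue_integral_def)
  next
    case (insert H A)
    have "interval_lebesgue_integrable lborel a b (\<lambda>u. c H * f H u)"
      using assms[of H] by (rule interval_lebesgue_integrable_mult_right)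
    from interval_lebesgue_integral_add[OF this conjunct1[OF insert.IH]] insert show ?case by simp
  qed
  from this[OF finite_keys[of x], of "Poly_Mapping.lookup x"]
  show "(LBINT u=a..b. lin (\<lambda>H. f H u) x) = lin (\<lambda>H. LBINT u=a..b. f H u) x"
    "interval_lebesgue_integrable lborel a b (\<lambda>u. lin (\<lambda>H. f H u) x)"
    by (simp_all add: lin_def)
qed

text \<open>The continuous functions that represent the matching model supply continuity in
  \<open>u\<close> on trees, and multiplicativity extends it to forests.\<close>

lemma rough_path_integrable:
  assumes X: "X \<in> rough_paths \<alpha> T" and m: "matches T X P" and st: "s \<in> {0..T}" "t \<in> {0..T}"
  shows "interval_lebesgue_integrable lborel (ereal s) (ereal t) (\<lambda>u. X s u H)"
proof -
  have tree: "continuous_on {0..T} (\<lambda>u. X s u {#\<tau>#})" for \<tau>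
  proof -
    obtain f where f: "continuous_on UNIV f" "\<And>u. u \<in> {0..T} \<Longrightarrow> f u = lin (\<lambda>\<tau>. X s u {#\<tau>#}) (vec \<tau>)"
      using matches_vec[OF m st(1), of "vec \<tau>"] by metis
    have "continuous_on {0..T} f" using f(1) by (rule continuous_on_subset) simp
    then show ?thesis by (rule continuous_on_eq) (use f(2) in simp)
  qed
  have "continuous_on {0..T} (\<lambda>u. \<Prod>\<tau>\<in>#H. X s u {#\<tau>#})"
    by (induction H) (auto intro!: continuous_intros tree)
  then have "continuous_on {0..T} (\<lambda>u. X s u H)"
    by (rule continuous_on_eq) (use character_prod[OF rough_pathsD(1)[OF X st(1)], of _ H] in simp)
  then have "set_integrable lborel {0..T} (\<lambda>u. X s u H)"
    by (rule borel_integrable_atLeastAtMost')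
  then have "set_integrable lborel S (\<lambda>u. X s u H)" if "S \<subseteq> {0..T}" "S \<in> sets lborel" for S
    by (rule set_integrable_subset) (fact that)+
  moreover have "{s<..<t} \<subseteq> {0..T}" "{t<..<s} \<subseteq> {0..T}" using st by auto
  ultimately show ?thesis
    by (simp add: interval_lebesgue_integrable_def)
qed

theorem translate_rough_path:
  assumes \<alpha>: "0 < \<alpha>" "\<alpha> < 1" and v: "v \<in> B_minus_dual \<alpha>"
    and X: "X \<in> rough_paths \<alpha> T" and P: "(p, G) \<in> models \<alpha> T U" and m: "matches T X (p, G)"
  shows "(\<lambda>s t. translate v (X s t)) \<in> rough_paths \<alpha> T"
proof -
  let ?w = "\<lambda>t. v {#t#}"
  have char: "X s t \<in> characters" if "s \<in> {0..T}" "t \<in> {0..T}" for s t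
    by (rule rough_pathsD(1)[OF X that])
  have None_root: "translate v f {#Node None F#} = lin (\<lambda>H. f {#Node None H#}) (subst_forest ?w F)" for f F
    by (simp add: translate_def subst_tree_None_root B_minus_dual_None[OF \<alpha>(1) v])
  have "\<forall>\<tau>. \<exists>C. \<forall>s\<in>{0..T}. \<forall>t\<in>{0..T}. \<bar>X s t {#\<tau>#}\<bar> \<le> C * \<bar>t - s\<bar> powr weight \<alpha> \<tau>"
    using rough_path_weight_bound[OF \<alpha>(1) X P m] by blast
  then obtain C where C: "\<And>\<tau> s t. s \<in> {0..T} \<Longrightarrow> t \<in> {0..T} \<Longrightarrow> \<bar>X s t {#\<tau>#}\<bar> \<le> C \<tau> * \<bar>t - s\<bar> powr weight \<alpha> \<tau>"
    by metis
  have bounded: "bdd_above {\<bar>translate v (X s t) F\<bar> / \<bar>t - s\<bar> powr (\<alpha> * real (forest_nodes F)) | s t.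
                        s \<in> {0..T} \<and> t \<in> {0..T} \<and> s \<noteq> t}" for F
  proof -
    let ?x = "subst_forest ?w F"
    let ?W = "\<lambda>H. \<Sum>t\<in>#H. weight \<alpha> t"
    define B where "B = max 1 T"
    define D where "D H = \<bar>\<Prod>t\<in>#H. C t\<bar> * B powr ?W H" for H
    have "\<bar>translate v (X s t) F\<bar> / \<bar>t - s\<bar> powr (\<alpha> * real (forest_nodes F)) \<le>
        (\<Sum>H\<in>Poly_Mapping.keys ?x. \<bar>Poly_Mapping.lookup ?x H\<bar> * D H)"
      if st: "s \<in> {0..T}" "t \<in> {0..T}" "s \<noteq> t" for s t
    proof -
      let ?r = "\<bar>t - s\<bar>"
      have r: "0 < ?r" "?r \<le> B" using st by (auto simp: B_def)
      have "\<bar>X s t H\<bar> \<le> D H * ?r powr (\<alpha> * real (forest_nodes F))" if H: "H \<in> Poly_Mapping.keys ?x" for H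
      proof -
        have "\<bar>X s t H\<bar> \<le> (\<Prod>t\<in>#H. C t) * ?r powr ?W H"
          by (rule character_bound[OF char[OF st(1,2)] r(1) C[OF st(1,2)]])
        also have "\<dots> \<le> \<bar>\<Prod>t\<in>#H. C t\<bar> * (B powr ?W H * ?r powr (\<alpha> * real (forest_nodes F)))"
        proof (rule mult_mono)
          \<comment> \<open>The detour is needed because the number of nodes may drop from
            \<open>F\<close> to \<open>H\<close>, whereas the weight does not.\<close>
          have "\<alpha> * real (forest_nodes F) \<le> ?W F" by (rule weight_ge_forest_nodes[OF \<alpha>])
          also have "?W F \<le> ?W H"
            by (rule weight_subst_forest(1)[OF \<alpha>(1) B_minus_dual_support[OF \<alpha>(1) v] H])
          finally show "?r powr ?W H \<le> B powr ?W H * ?r powr (\<alpha> * real (forest_nodes F))"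
            using \<alpha> r by (intro powr_le_powr_mult) (auto simp: B_def)
        qed auto
        finally show ?thesis by (simp add: D_def mult.assoc)
      qed
      then have "(\<Sum>H\<in>Poly_Mapping.keys ?x. \<bar>Poly_Mapping.lookup ?x H\<bar> * \<bar>X s t H\<bar>) \<le>
          (\<Sum>H\<in>Poly_Mapping.keys ?x. \<bar>Poly_Mapping.lookup ?x H\<bar> * (D H * ?r powr (\<alpha> * real (forest_nodes F))))"
        by (intro sum_mono mult_left_mono) auto
      then have "\<bar>translate v (X s t) F\<bar> \<le>
          (\<Sum>H\<in>Poly_Mapping.keys ?x. \<bar>Poly_Mapping.lookup ?x H\<bar> * D H) * ?r powr (\<alpha> * real (forest_nodes F))"
        using lin_abs_le[of "X s t" ?x] by (simp add: translate_def sum_distrib_right mult.assoc)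
      then show ?thesis using r(1) by (simp add: divide_le_eq)
    qed
    then show ?thesis by (intro bdd_aboveI) blast
  qed
  have int': "translate v (X s t) {#Node None F#} = (LBINT u=ereal s..ereal t. translate v (X s u) F)"
    if "s \<in> {0..T}" "t \<in> {0..T}" for s t F
    unfolding None_root unfolding translate_def[of v] interval_integral_lin(1)[OF rough_path_integrable[OF X m that]]
    by (simp add: rough_pathsD(4)[OF X that])
  have chen': "translate v (X s t) = star (translate v (X s u)) (translate v (X u t))"
    if "s \<in> {0..T}" "u \<in> {0..T}" "t \<in> {0..T}" for s u t
    unfolding translate_star[symmetric] by (rule arg_cong[OF rough_pathsD(2)[OF X that(1,3,2)]])
  have time': "translate v (X s t) {#Node None {#}#} = t - s" if "s \<in> {0..T}" "t \<in> {0..T}" for s t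
    using rough_pathsD(3)[OF X that] by (simp add: None_root lin_unit)
  show ?thesis
    unfolding rough_paths_def mem_Collect_eq
  proof (intro conjI ballI allI)
    show "translate v (X s t) \<in> characters" if "s \<in> {0..T}" "t \<in> {0..T}" for s t
      by (rule translate_character[OF char[OF that]])
  qed (fact chen' bounded time' int')+
qed

theorem matches_renorm_model:
  assumes \<alpha>: "0 < \<alpha>" and v: "v \<in> B_minus_dual \<alpha>" and m: "matches T X P"
  shows "matches T (\<lambda>s t. translate v (X s t)) (renorm_model \<alpha> (assoc_char \<alpha> v) P)"
  unfolding matches_def
proof (intro allI ballI)
  fix b s assume s: "s \<in> {0..T}"
  let ?b = "lin (subst_tree (\<lambda>t. v {#t#})) b"
  obtain f where f: "continuous_on UNIV f" "represents f (fst P s (push symb_I (push phi ?b)))"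
    "\<And>t. t \<in> {0..T} \<Longrightarrow> f t = lin (\<lambda>\<tau>. X s t {#\<tau>#}) ?b"
    by (rule matches_vec[OF m s, of ?b]) blast
  have "fst (renorm_model \<alpha> (assoc_char \<alpha> v) P) s (push symb_I (push phi b)) = fst P s (push symb_I (push phi ?b))"
    by (cases P) (simp add: renorm_model_def renorm_map_I[OF \<alpha> v] renorm_map_phi[OF \<alpha> v])
  moreover have "f t = lin (\<lambda>\<tau>. translate v (X s t) {#\<tau>#}) b" if "t \<in> {0..T}" for t
    using f(3)[OF that] by (simp add: lin_lin translate_def)
  ultimately show "\<exists>f. continuous_on UNIV f \<and>
      represents f (fst (renorm_model \<alpha> (assoc_char \<alpha> v) P) s (push symb_I (push phi b))) \<and>
      (\<forall>t\<in>{0..T}. f t = lin (\<lambda>\<tau>. translate v (X s t) {#\<tau>#}) b)"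
    using f(1,2) by auto
qed

lemma agree_on_renorm_model: "agree_on T Q P \<Longrightarrow> agree_on T (renorm_model \<alpha> l Q) (renorm_model \<alpha> l P)"
  by (cases P; cases Q) (simp add: agree_on_def renorm_model_def)

theorem corresponds_renorm_model:
  assumes \<alpha>: "0 < \<alpha>" "\<alpha> < 1" and v: "v \<in> B_minus_dual \<alpha>" and XP: "corresponds \<alpha> T U X P"
  shows "corresponds \<alpha> T U (\<lambda>s t. translate v (X s t)) (renorm_model \<alpha> (assoc_char \<alpha> v) P)"
proof -
  note v' = B_minus_dual_uminus[OF v]
  have X: "X \<in> rough_paths \<alpha> T" and P: "P \<in> models \<alpha> T U" and m: "matches T X P"
    and unique: "\<And>Q. Q \<in> models \<alpha> T U \<Longrightarrow> matches T X Q \<Longrightarrow> agree_on T Q P"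
    using XP unfolding corresponds_def by blast+
  have "agree_on T Q (renorm_model \<alpha> (assoc_char \<alpha> v) P)"
    if Q: "Q \<in> models \<alpha> T U" and mQ: "matches T (\<lambda>s t. translate v (X s t)) Q" for Q
  proof -
    let ?Q = "renorm_model \<alpha> (assoc_char \<alpha> (\<lambda>F. - v F)) Q"
    have "matches T X ?Q"
      using matches_renorm_model[OF \<alpha>(1) v' mQ] by (simp add: translate_inverse[OF \<alpha>(1) v])
    then have "agree_on T ?Q P"
      by (intro unique renorm_model_in_models[OF \<alpha>(1) v' Q])
    then have "agree_on T (renorm_model \<alpha> (assoc_char \<alpha> v) ?Q) (renorm_model \<alpha> (assoc_char \<alpha> v) P)"
      by (rule agree_on_renorm_model)
    moreover have "renorm_model \<alpha> (assoc_char \<alpha> v) ?Q = Q"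
      using Q by (cases Q) (auto intro: renorm_model_inverse[OF \<alpha>(1) v] models_structure_group)
    ultimately show ?thesis by simp
  qed
  moreover have "(\<lambda>s t. translate v (X s t)) \<in> rough_paths \<alpha> T"
    using translate_rough_path[OF \<alpha> v X, of "fst P" "snd P" U] P m by simp
  ultimately show ?thesis
    unfolding corresponds_def
    using renorm_model_in_models[OF \<alpha>(1) v P] matches_renorm_model[OF \<alpha>(1) v m] by blast
qed

lemma Delta_minus_htilde:
  assumes "0 < \<alpha>"
  shows "Delta_minus \<alpha> (push (phi \<circ> tree_of_htilde) h) =
    push (map_prod (image_mset phi) (phi \<circ> tree_of_htilde)) (delta_minus_htilde \<alpha> h)"
proof -
  have "tree_of_htilde (htilde_of_tree t) = t" for t :: "'a rtree"
    by (simp add: tree_of_htilde_def htilde_of_tree_def)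
  then show ?thesis
    by (simp add: Delta_minus_def delta_minus_htilde_def push_push push_lin
        Delta_minus_symb_delta_minus[OF assms] map_prod_def case_prod_unfold)
qed

theorem theorem50:
  fixes \<alpha> T :: real
  assumes "0 < \<alpha>" and "\<alpha> < 1" and "0 < T"
  shows
    "(\<forall>h :: 'd::finite htilde \<Rightarrow>\<^sub>0 real.
        Delta_minus \<alpha> (push (phi \<circ> tree_of_htilde) h) =
        push (map_prod (image_mset phi) (phi \<circ> tree_of_htilde)) (delta_minus_htilde \<alpha> h))
     \<and>
     (\<forall>U. open U \<longrightarrow> {0<..<T} \<subseteq> U \<longrightarrow>
        (\<forall>(v :: 'd forest \<Rightarrow> real) \<in> B_minus_dual \<alpha>. \<forall>X P.
           corresponds \<alpha> T U X P \<longrightarrow>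
           corresponds \<alpha> T U (\<lambda>s t. translation v (X s t)) (renorm_model \<alpha> (assoc_char \<alpha> v) P)))
     \<and>
     (\<forall>v \<in> B_minus \<alpha>. \<forall>v' \<in> B_minus \<alpha>.
        assoc_char \<alpha> (to_dual (v + v' :: 'd rtree \<Rightarrow>\<^sub>0 real)) =
        conv_minus \<alpha> (assoc_char \<alpha> (to_dual v)) (assoc_char \<alpha> (to_dual v')))
     \<and>
     group (B_minus_group \<alpha> :: ('d rtree \<Rightarrow>\<^sub>0 real) monoid) \<and>
     group (G_minus_group \<alpha> :: ('d symb multiset \<Rightarrow> real) monoid) \<and>
     (\<lambda>v. assoc_char \<alpha> (to_dual v)) \<in>
       iso (B_minus_group \<alpha> :: ('d rtree \<Rightarrow>\<^sub>0 real) monoid) (G_minus_group \<alpha>)"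
proof (intro conjI allI ballI impI)
  fix h :: "'d htilde \<Rightarrow>\<^sub>0 real"
  show "Delta_minus \<alpha> (push (phi \<circ> tree_of_htilde) h) =
      push (map_prod (image_mset phi) (phi \<circ> tree_of_htilde)) (delta_minus_htilde \<alpha> h)"
    by (rule Delta_minus_htilde[OF assms(1)])
next
  fix U :: "real set" and v :: "'d forest \<Rightarrow> real"
    and X :: "real \<Rightarrow> real \<Rightarrow> 'd forest \<Rightarrow> real" and P :: "'d model"
  assume v: "v \<in> B_minus_dual \<alpha>" and XP: "corresponds \<alpha> T U X P"
  show "corresponds \<alpha> T U (\<lambda>s t. translation v (X s t)) (renorm_model \<alpha> (assoc_char \<alpha> v) P)"
    unfolding translation_eq[OF assms(1) v] by (rule corresponds_renorm_model[OF assms(1,2) v XP])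
next
  fix v v' :: "'d rtree \<Rightarrow>\<^sub>0 real"
  assume "v \<in> B_minus \<alpha>" "v' \<in> B_minus \<alpha>"
  then show "assoc_char \<alpha> (to_dual (v + v')) =
      conv_minus \<alpha> (assoc_char \<alpha> (to_dual v)) (assoc_char \<alpha> (to_dual v'))"
    by (rule assoc_char_add[OF assms(1)])
qed (rule group_B_minus, rule group_G_minus(1)[OF assms(1)], rule group_G_minus(2)[OF assms(1)])

end
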